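(* Let $n\ge 2$ and let $V\in L^\infty_{loc}(\mathbb R^n)$ be real-valued. Assume that there exists $R>1$ such that $V\ge 0$ on $\{|x|>R\}$ and that for some $r\ge R$ $$\int_{|x|>r}\frac{1}{|x|^{n+2}V(x)}\,dx<\infty\qquad\text{and}\qquad \int_{|x|>r}|x|^{4-2n}V(x)\,dx=\infty .$$ Then every non-constant bounded real-valued weak solution $u$ to $-\Delta u=Vu$ on $\mathbb R^n$ must change sign near $\infty$. Namely, if $u$ is a bounded weak solution to $-\Delta u=Vu$ on $\mathbb R^n$ and there is some $R'>0$ such that $u\ge 0$ on $\{|x|>R'\}$ (or $u\le 0$ on $\{|x|>R'\}$), then $u\equiv 0$.
   Context: A weak solution is a solution in the sense of distributions. Inequalities and equalities between functions are understood almost everywhere. "$u$ changes sign near $\infty$" means that there is no $R'>0$ such that $u\ge 0$ on $\{|x|>R'\}$ or $u\le 0$ on $\{|x|>R'\}$. The convention $1/0=+\infty$ is used in the first integral. *)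

theory Defs
  imports "HOL-Analysis.Analysis"
begin

definition partial_deriv :: "'a::euclidean_space \<Rightarrow> ('a \<Rightarrow> real) \<Rightarrow> 'a \<Rightarrow> real" where
  "partial_deriv b f x = frechet_derivative f (at x) b"

definition laplacian :: "('a::euclidean_space \<Rightarrow> real) \<Rightarrow> 'a \<Rightarrow> real" where
  "laplacian f x = (\<Sum>b\<in>Basis. partial_deriv b (partial_deriv b f) x)"

fun Ck :: "nat \<Rightarrow> ('a::euclidean_space \<Rightarrow> real) \<Rightarrow> bool" where
  "Ck 0 f \<longleftrightarrow> continuous_on UNIV f"
| "Ck (Suc k) f \<longleftrightarrow> (\<forall>x. f differentiable (at x)) \<and> (\<forall>b\<in>Basis. Ck k (partial_deriv b f))"

definition test_function :: "('a::euclidean_space \<Rightarrow> real) \<Rightarrow> bool" where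
  "test_function \<phi> \<longleftrightarrow> (\<forall>k. Ck k \<phi>) \<and> compact (closure {x. \<phi> x \<noteq> 0})"

definition L1_loc :: "('a::euclidean_space \<Rightarrow> real) \<Rightarrow> bool" where
  "L1_loc f \<longleftrightarrow> (\<forall>K. compact K \<longrightarrow> f absolutely_integrable_on K)"

definition Linf_loc :: "('a::euclidean_space \<Rightarrow> real) \<Rightarrow> bool" where
  "Linf_loc f \<longleftrightarrow> f \<in> borel_measurable lebesgue \<and>
     (\<forall>K. compact K \<longrightarrow> (\<exists>C. AE x in lebesgue. x \<in> K \<longrightarrow> \<bar>f x\<bar> \<le> C))"

definition ess_bounded :: "('a::euclidean_space \<Rightarrow> real) \<Rightarrow> bool" where
  "ess_bounded f \<longleftrightarrow> f \<in> borel_measurable lebesgue \<and> (\<exists>C. AE x in lebesgue. \<bar>f x\<bar> \<le> C)"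

(* Distributional solutions of - Laplace u = V u on the whole space. Local integrability of u and
   V u makes both sides distributions; it is automatic for V in L^infinity_loc and u bounded. *)
definition weak_solution :: "('a::euclidean_space \<Rightarrow> real) \<Rightarrow> ('a \<Rightarrow> real) \<Rightarrow> bool" where
  "weak_solution V u \<longleftrightarrow> L1_loc u \<and> L1_loc (\<lambda>x. V x * u x) \<and>
     (\<forall>\<phi>. test_function \<phi> \<longrightarrow>
        (LINT x|lebesgue. u x * (- laplacian \<phi> x)) = (LINT x|lebesgue. V x * u x * \<phi> x))"

definition ae_constant :: "('a::euclidean_space \<Rightarrow> real) \<Rightarrow> bool" where
  "ae_constant u \<longleftrightarrow> (\<exists>c. AE x in lebesgue. u x = c)"

definition nonneg_outside :: "real \<Rightarrow> ('a::euclidean_space \<Rightarrow> real) \<Rightarrow> bool" where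
  "nonneg_outside r f \<longleftrightarrow> (AE x in lebesgue. norm x > r \<longrightarrow> f x \<ge> 0)"

definition nonpos_outside :: "real \<Rightarrow> ('a::euclidean_space \<Rightarrow> real) \<Rightarrow> bool" where
  "nonpos_outside r f \<longleftrightarrow> (AE x in lebesgue. norm x > r \<longrightarrow> f x \<le> 0)"

definition changes_sign_near_infinity :: "('a::euclidean_space \<Rightarrow> real) \<Rightarrow> bool" where
  "changes_sign_near_infinity u \<longleftrightarrow> \<not> (\<exists>r>0. nonneg_outside r u \<or> nonpos_outside r u)"

end

theory Submission
  imports Defs
begin

text \<open>
  Write \<open>n\<close> for the dimension and \<open>f = V u\<close>.  If \<open>u\<close> does not change sign near infinity, then, after replacing \<open>u\<close> by \<open>- u\<close> if
  necessary, \<open>u\<close> and \<open>f\<close> are nonnegative outside some ball.  There \<open>u\<close> is superharmonic, which has two consequences.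

  On the one hand, the boundedness of \<open>u\<close> limits the size of \<open>f\<close>.  Testing the equation with the fundamental solution
  \<open>\<bar>x\<bar>\<^bsup>2-n\<^esup>\<close>, smoothed at the origin and cut off at a large radius, shows that \<open>\<integral> V u \<bar>x\<bar>\<^bsup>2-n\<^esup>\<close> converges at infinity
  (\<open>weighted_source_finite\<close>).

  On the other hand, a nonnegative superharmonic function in the exterior of a ball either vanishes almost everywhere there
  or is bounded below by a positive multiple of \<open>\<bar>x\<bar>\<^bsup>2-n\<^esup>\<close> near infinity (\<open>superharmonic_lower_bound\<close>).  In the second case
  \<open>\<integral> V \<bar>x\<bar>\<^bsup>4-2n\<^esup>\<close> would converge at infinity, contrary to the hypothesis.

  Hence \<open>u\<close> vanishes outside a ball.  A compactly supported solution of \<open>\<bar>\<Delta> u\<bar> \<le> C \<bar>u\<bar>\<close> is zero; because of the compact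
  support, an elementary Carleman estimate with the weight \<open>exp (\<tau> x\<^sub>1)\<close> suffices (\<open>carleman\<close>, \<open>compact_support_solution_0\<close>).

  Since \<open>u\<close> is only a weak solution, pointwise arguments are applied to its mollifications.  The radial mollifier is chosen such
  that its derivative with respect to the scale is the Laplacian of a nonnegative test function.  Mollifications of a
  superharmonic function therefore increase as the scale decreases (\<open>conv_kern_antimono\<close>), which replaces the mean value
  inequality, and they converge almost everywhere along a sequence of scales (\<open>conv_kern_AE\<close>).
\<close>

section \<open>Calculus of the classes \<open>C\<^sup>k\<close>\<close>

lemma partial_deriv_eq:
  "(f has_derivative f') (at x) \<Longrightarrow> partial_deriv b f x = f' b"
  unfolding partial_deriv_def by (metis frechet_derivative_at)

lemma Ck_SucI:
  assumes "\<And>x. (f has_derivative f' x) (at x)" "\<And>b. b \<in> Basis \<Longrightarrow> Ck k (\<lambda>x. f' x b)"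
  shows "Ck (Suc k) f"
proof -
  have "partial_deriv b f = (\<lambda>x. f' x b)" for b
    using partial_deriv_eq[OF assms(1)] by blast
  with assms show ?thesis by (auto simp: differentiable_def)
qed

lemma Ck_has_derivative:
  assumes "Ck (Suc k) f"
  shows "(f has_derivative frechet_derivative f (at x)) (at x)"
  using assms frechet_derivative_works by auto

lemma Ck_SucD: "Ck (Suc k) f \<Longrightarrow> Ck k f"
proof (induction k arbitrary: f)
  case 0
  then show ?case by (auto simp: continuous_on_eq_continuous_at intro: differentiable_imp_continuous_within)
next
  case (Suc k)
  from Suc.prems have "\<forall>x. f differentiable (at x)" "\<forall>b\<in>Basis. Ck (Suc k) (partial_deriv b f)" by auto
  then show ?case using Suc.IH by (auto simp del: Ck.simps(1))
qed

lemma Ck_const: "Ck k (\<lambda>x. c)"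
proof (induction k arbitrary: c)
  case (Suc k)
  show ?case by (rule Ck_SucI[where f' = "\<lambda>x h. 0"]) (auto intro: Suc)
qed auto

lemma Ck_add: "Ck k f \<Longrightarrow> Ck k g \<Longrightarrow> Ck k (\<lambda>x. f x + g x)"
proof (induction k arbitrary: f g)
  case 0 then show ?case by (auto intro: continuous_intros)
next
  case (Suc k)
  show ?case
    by (rule Ck_SucI[OF has_derivative_add[OF Ck_has_derivative[OF Suc.prems(1)] Ck_has_derivative[OF Suc.prems(2)]]])
       (use Suc in \<open>auto simp: partial_deriv_def[abs_def]\<close>)
qed

lemma Ck_mult: "Ck k f \<Longrightarrow> Ck k g \<Longrightarrow> Ck k (\<lambda>x. f x * g x)"
proof (induction k arbitrary: f g)
  case 0 then show ?case by (auto intro: continuous_intros)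
next
  case (Suc k)
  have "Ck k (\<lambda>x. f x * partial_deriv b g x + partial_deriv b f x * g x)" if "b \<in> Basis" for b
    using Suc that Ck_SucD by (intro Ck_add Suc.IH) auto
  then show ?case
    by (intro Ck_SucI[OF has_derivative_mult[OF Ck_has_derivative[OF Suc.prems(1)] Ck_has_derivative[OF Suc.prems(2)]]])
       (auto simp: partial_deriv_def[abs_def])
qed

text \<open>The outer function comes with the sequence \<open>h\<close> of all its derivatives, so that the induction on \<open>k\<close> can move from
  \<open>h j\<close> to \<open>h (Suc j)\<close>.  An open set \<open>S\<close> is allowed because real powers are smooth only on the positive half line.\<close>
lemma Ck_compose:
  fixes h :: "nat \<Rightarrow> real \<Rightarrow> real"
  assumes h: "\<And>j v. v \<in> S \<Longrightarrow> (h j has_real_derivative h (Suc j) v) (at v)"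
    and S: "\<And>x. f x \<in> S" and "Ck k f"
  shows "Ck k (\<lambda>x. h j (f x))"
  using \<open>Ck k f\<close>
proof (induction k arbitrary: j)
  case 0
  have "isCont (\<lambda>x. h j (f x)) x" for x
    using 0 continuous_on_eq_continuous_at[OF open_UNIV, of f] DERIV_isCont[OF h[OF S]]
    by (auto intro!: isCont_o2[where f = f and g = "h j"])
  then show ?case by (simp add: continuous_at_imp_continuous_on)
next
  case (Suc k)
  have "((\<lambda>x. h j (f x)) has_derivative (\<lambda>y. h (Suc j) (f x) * frechet_derivative f (at x) y)) (at x)" for x
    using has_derivative_compose[OF Ck_has_derivative[OF Suc.prems] h[OF S, unfolded has_field_derivative_def]]
    by simp
  moreover have "Ck k (\<lambda>x. h (Suc j) (f x) * partial_deriv b f x)" if "b \<in> Basis" for b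
    using Suc that Ck_SucD[OF Suc.prems] by (intro Ck_mult) auto
  ultimately show ?case by (intro Ck_SucI) (auto simp: partial_deriv_def[abs_def])
qed

lemma has_derivative_reflect:
  assumes "(\<phi> has_derivative \<phi>') (at (x - y))"
  shows "((\<lambda>y. \<phi> (x - y)) has_derivative (\<lambda>h. \<phi>' (- h))) (at y)"
proof -
  have "((\<lambda>y. x - y) has_derivative (\<lambda>h. - h)) (at y)" by (auto intro!: derivative_eq_intros)
  from has_derivative_compose[OF this assms] show ?thesis .
qed

lemma partial_deriv_reflect:
  assumes "\<phi> differentiable (at (x - y))"
  shows "partial_deriv b (\<lambda>y. \<phi> (x - y)) y = - partial_deriv b \<phi> (x - y)"
proof -
  have D: "(\<phi> has_derivative frechet_derivative \<phi> (at (x - y))) (at (x - y))"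
    using assms frechet_derivative_works by blast
  show ?thesis
    using partial_deriv_eq[OF has_derivative_reflect[OF D]] linear_neg[OF has_derivative_linear[OF D]]
    by (auto simp: partial_deriv_def)
qed

lemma Ck_reflect: "Ck k \<phi> \<Longrightarrow> Ck k (\<lambda>y. \<phi> (x - y))"
proof (induction k arbitrary: \<phi>)
  case 0 
  then have "continuous_on UNIV (\<phi> \<circ> (\<lambda>y. x - y))"
    by (intro continuous_on_compose) (auto intro: continuous_intros continuous_on_subset)
  then show ?case by (simp add: o_def)
next
  case (Suc k)
  have D: "(\<phi> has_derivative frechet_derivative \<phi> (at y)) (at y)" for y
    using Suc.prems frechet_derivative_works by auto
  have "Ck k (\<lambda>y. - 1 * partial_deriv b \<phi> (x - y))" if "b \<in> Basis" for b
    using Suc that by (intro Ck_mult Ck_const) auto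
  then show ?case
    by (intro Ck_SucI[OF has_derivative_reflect[OF D]])
      (simp add: partial_deriv_def[abs_def] linear_neg[OF has_derivative_linear[OF D]])
qed

lemma compact_closed_subset: "compact T \<Longrightarrow> closed S \<Longrightarrow> S \<subseteq> T \<Longrightarrow> compact S"
  for S :: "'a::t2_space set"
  by (metis compact_Int_closed inf.absorb2)

lemma test_function_partial_deriv:
  assumes "test_function \<phi>" "b \<in> Basis"
  shows "test_function (partial_deriv b \<phi>)"
proof -
  have "Ck k (partial_deriv b \<phi>)" for k
    using assms by (auto simp: test_function_def dest!: spec[of _ "Suc k"])
  moreover have "{x. partial_deriv b \<phi> x \<noteq> 0} \<subseteq> closure {x. \<phi> x \<noteq> 0}"
  proof (rule subsetI, rule ccontr)
    fix x assume x: "x \<in> {x. partial_deriv b \<phi> x \<noteq> 0}" "x \<notin> closure {x. \<phi> x \<noteq> 0}"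
    have "(\<phi> has_derivative (\<lambda>h. 0)) (at x)"
      by (rule has_derivative_transform_within_open[where s = "- closure {x. \<phi> x \<noteq> 0}" and f = "\<lambda>x. 0"])
         (use x closure_subset[of "{x. \<phi> x \<noteq> 0}"] in auto)
    from partial_deriv_eq[OF this] x show False by auto
  qed
  then have "closure {x. partial_deriv b \<phi> x \<noteq> 0} \<subseteq> closure {x. \<phi> x \<noteq> 0}"
    by (simp add: closure_minimal)
  ultimately show ?thesis using assms
    using compact_closed_subset[OF _ closed_closure] unfolding test_function_def by blast
qed

lemma test_functionI:
  fixes \<phi> :: "'a::euclidean_space \<Rightarrow> real"
  assumes "\<And>k. Ck k \<phi>" "\<And>x. norm x > M \<Longrightarrow> \<phi> x = 0"
  shows "test_function \<phi>"
proof -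
  have "closure {x. \<phi> x \<noteq> 0} \<subseteq> cball 0 M"
    by (rule closure_minimal) (use assms(2) in \<open>auto simp: not_less[symmetric]\<close>)
  then show ?thesis using assms(1) compact_closed_subset[OF compact_cball closed_closure]
    by (auto simp: test_function_def)
qed

lemma test_function_bounds:
  assumes "test_function \<phi>"
  obtains M B where "M > 0" "\<And>x. norm x > M \<Longrightarrow> \<phi> x = 0" "\<And>x. \<bar>\<phi> x\<bar> \<le> B"
proof -
  let ?K = "closure {x. \<phi> x \<noteq> 0}"
  have K: "compact ?K" and c: "continuous_on UNIV \<phi>"
    using assms by (auto simp: test_function_def dest!: spec[of _ 0])
  obtain M where M: "\<And>x. x \<in> ?K \<Longrightarrow> norm x \<le> M" using compact_imp_bounded[OF K] unfolding bounded_iff by auto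
  have "bounded (\<phi> ` ?K)"
    using K c by (intro compact_imp_bounded compact_continuous_image continuous_on_subset[OF c]) auto
  then obtain B where B: "\<And>x. x \<in> ?K \<Longrightarrow> \<bar>\<phi> x\<bar> \<le> B" unfolding bounded_iff by auto
  have out: "\<phi> x = 0" if "x \<notin> ?K" for x using that closure_subset[of "{x. \<phi> x \<noteq> 0}"] by auto
  show ?thesis
  proof (rule that[of "max 1 M" "max 0 B"])
    show "\<phi> x = 0" if "norm x > max 1 M" for x using that M[of x] by (intro out) auto
    show "\<bar>\<phi> x\<bar> \<le> max 0 B" for x using B[of x] out[of x] by fastforce
  qed auto
qed

lemma test_function_continuous: "test_function \<phi> \<Longrightarrow> continuous_on S \<phi>"
  by (auto simp: test_function_def dest!: spec[of _ 0] intro: continuous_on_subset)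

text \<open>In \<open>\<integral> u y * \<phi> (x - y) dy\<close> the weak equation is tested with \<open>y \<mapsto> \<phi> (x - y)\<close>; this lemma and
  \<open>laplacian_reflect\<close> make that legitimate.\<close>
lemma test_function_reflect:
  fixes x :: "'a::euclidean_space"
  assumes "test_function \<phi>" shows "test_function (\<lambda>y. \<phi> (x - y))"
proof -
  obtain M B where M: "M > 0" "\<And>x. norm x > M \<Longrightarrow> \<phi> x = 0" using test_function_bounds[OF assms] by metis
  show ?thesis
  proof (rule test_functionI[where M = "M + norm x"])
    fix y :: 'a assume "norm y > M + norm x" 
    then show "\<phi> (x - y) = 0" using norm_triangle_ineq2[of y x] by (intro M(2)) (simp add: norm_minus_commute)
  qed (use assms in \<open>auto simp: test_function_def intro: Ck_reflect\<close>)
qed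

lemma test_function_differentiable: "test_function \<phi> \<Longrightarrow> \<phi> differentiable (at x)"
  by (auto simp: test_function_def dest!: spec[of _ "Suc 0"])

lemma test_function_DERIV_line:
  assumes "test_function \<phi>"
  shows "((\<lambda>t. \<phi> (x + t *\<^sub>R b)) has_real_derivative partial_deriv b \<phi> (x + t *\<^sub>R b)) (at t)"
proof -
  have D: "(\<phi> has_derivative frechet_derivative \<phi> (at (x + t *\<^sub>R b))) (at (x + t *\<^sub>R b))"
    using test_function_differentiable[OF assms] frechet_derivative_works by blast
  have "((\<lambda>t. x + t *\<^sub>R b) has_derivative (\<lambda>h. h *\<^sub>R b)) (at t)"
    by (auto intro!: derivative_eq_intros)
  from has_derivative_compose[OF this D] show ?thesis
    unfolding has_field_derivative_def partial_deriv_def linear_scale[OF has_derivative_linear[OF D]]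
    by (elim has_derivative_eq_rhs) (auto simp: mult.commute)
qed

lemma laplacian_reflect:
  assumes "test_function \<phi>"
  shows "laplacian (\<lambda>y. \<phi> (x - y)) y = laplacian \<phi> (x - y)"
proof -
  have "partial_deriv b (partial_deriv b (\<lambda>y. \<phi> (x - y))) y = partial_deriv b (partial_deriv b \<phi>) (x - y)"
    if b: "b \<in> Basis" for b
  proof -
    have 1: "partial_deriv b (\<lambda>y. \<phi> (x - y)) = (\<lambda>y. - partial_deriv b \<phi> (x - y))"
      using partial_deriv_reflect[OF test_function_differentiable[OF assms]] by blast
    have t: "test_function (partial_deriv b \<phi>)" using assms b by (rule test_function_partial_deriv)
    have D: "((\<lambda>y. partial_deriv b \<phi> (x - y)) has_derivative frechet_derivative (\<lambda>y. partial_deriv b \<phi> (x - y)) (at y)) (at y)"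
      using test_function_differentiable[OF test_function_reflect[OF t]] frechet_derivative_works by blast
    have "partial_deriv b (\<lambda>y. - partial_deriv b \<phi> (x - y)) y = - partial_deriv b (\<lambda>y. partial_deriv b \<phi> (x - y)) y"
      using partial_deriv_eq[OF has_derivative_minus[OF D], of b] by (simp add: partial_deriv_def)
    then show ?thesis unfolding 1 partial_deriv_reflect[OF test_function_differentiable[OF t]] by simp
  qed
  then show ?thesis by (simp add: laplacian_def)
qed

section \<open>Radial functions\<close>

lemma quadratic_has_derivative:
  "((\<lambda>x. c * ((x - a) \<bullet> (x - a)) + d) has_derivative (\<lambda>h. 2 * c * ((x - a) \<bullet> h))) (at x)"
  for x a :: "'a::euclidean_space"
  by (auto intro!: derivative_eq_intros simp: inner_commute algebra_simps)

lemma Ck_quadratic: "Ck k (\<lambda>x::'a::euclidean_space. c * ((x - a) \<bullet> (x - a)) + d)"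
proof -
  have lin: "Ck k (\<lambda>x::'a. 2 * c * ((x - a) \<bullet> b))" for k b
  proof (cases k)
    case (Suc k)
    have "((\<lambda>x. 2 * c * ((x - a) \<bullet> b)) has_derivative (\<lambda>h. 2 * c * (h \<bullet> b))) (at x)" for x :: 'a
      by (auto intro!: derivative_eq_intros)
    from Ck_SucI[OF this Ck_const] Suc show ?thesis by simp
  qed (auto intro!: continuous_intros)
  show ?thesis
  proof (cases k)
    case (Suc k)
    from Ck_SucI[OF quadratic_has_derivative lin] Suc show ?thesis by simp
  qed (auto intro!: continuous_intros)
qed

lemma partial_deriv_radial:
  fixes h h1 :: "real \<Rightarrow> real" and a :: "'a::euclidean_space" and c d :: real
  defines "q \<equiv> \<lambda>x. c * ((x - a) \<bullet> (x - a)) + d"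
  assumes "(h has_real_derivative h1 (q x)) (at (q x))"
  shows "partial_deriv b (\<lambda>x. h (q x)) x = 2 * c * ((x - a) \<bullet> b) * h1 (q x)"
proof -
  have "((\<lambda>x. h (q x)) has_derivative (\<lambda>y. h1 (q x) * (2 * c * ((x - a) \<bullet> y)))) (at x)"
    using has_derivative_compose[OF quadratic_has_derivative[of c a d] assms(2)[unfolded has_field_derivative_def q_def]]
    by (simp add: q_def)
  from partial_deriv_eq[OF this] show ?thesis by simp
qed

text \<open>The mollifiers and cutoffs below are functions of \<open>\<bar>x\<bar>\<^sup>2\<close>.  Their second derivatives are explicit; in particular they commute,
  and the mollifiers are the only functions for which symmetry of mixed derivatives is used.\<close>
lemma partial_deriv2_radial:
  fixes h h1 h2 :: "real \<Rightarrow> real" and a :: "'a::euclidean_space" and c d :: real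
  defines "q \<equiv> \<lambda>x. c * ((x - a) \<bullet> (x - a)) + d"
  assumes 1: "\<And>x. (h has_real_derivative h1 (q x)) (at (q x))"
    and 2: "\<And>x. (h1 has_real_derivative h2 (q x)) (at (q x))"
  shows "partial_deriv b (partial_deriv b' (\<lambda>x. h (q x))) x
       = 4 * c\<^sup>2 * ((x - a) \<bullet> b) * ((x - a) \<bullet> b') * h2 (q x) + 2 * c * (b \<bullet> b') * h1 (q x)"
proof -
  have eq: "partial_deriv b' (\<lambda>x. h (q x)) = (\<lambda>x. 2 * c * ((x - a) \<bullet> b') * h1 (q x))"
    using partial_deriv_radial[of h h1 c _ a d, OF 1[unfolded q_def]] by (auto simp: q_def)
  have D: "((\<lambda>x. h1 (q x)) has_derivative (\<lambda>y. h2 (q x) * (2 * c * ((x - a) \<bullet> y)))) (at x)"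
    using has_derivative_compose[OF quadratic_has_derivative[of c a d] 2[unfolded has_field_derivative_def q_def]]
    by (simp add: q_def)
  have L: "((\<lambda>x. 2 * c * ((x - a) \<bullet> b')) has_derivative (\<lambda>y. 2 * c * (y \<bullet> b'))) (at x)"
    by (auto intro!: derivative_eq_intros)
  from partial_deriv_eq[OF has_derivative_mult[OF L D], of b] show ?thesis
    unfolding eq by (simp add: power2_eq_square algebra_simps)
qed

lemma sum_inner_Basis_square: "(\<Sum>b\<in>Basis. (x \<bullet> b) * (x \<bullet> b)) = x \<bullet> (x::'a::euclidean_space)"
  by (rule euclidean_inner[symmetric])

lemma laplacian_radial:
  fixes h h1 h2 :: "real \<Rightarrow> real" and a :: "'a::euclidean_space" and c d :: real
  defines "q \<equiv> \<lambda>x. c * ((x - a) \<bullet> (x - a)) + d"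
  assumes 1: "\<And>x. (h has_real_derivative h1 (q x)) (at (q x))"
    and 2: "\<And>x. (h1 has_real_derivative h2 (q x)) (at (q x))"
  shows "laplacian (\<lambda>x. h (q x)) x
       = 2 * c * DIM('a) * h1 (q x) + 4 * c\<^sup>2 * ((x - a) \<bullet> (x - a)) * h2 (q x)"
proof -
  have "laplacian (\<lambda>x. h (q x)) x = (\<Sum>b\<in>Basis. 4 * c\<^sup>2 * h2 (q x) * (((x - a) \<bullet> b) * ((x - a) \<bullet> b)) + 2 * c * h1 (q x))"
    unfolding laplacian_def
    unfolding q_def
    by (intro sum.cong refl, subst partial_deriv2_radial[of h h1 c a d h2, OF 1[unfolded q_def] 2[unfolded q_def]])
       (simp add: inner_same_Basis)
  also have "\<dots> = 4 * c\<^sup>2 * h2 (q x) * ((x - a) \<bullet> (x - a)) + DIM('a) * (2 * c * h1 (q x))"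
    by (simp add: sum.distrib sum_distrib_left[symmetric] sum_inner_Basis_square)
  finally show ?thesis by simp
qed

section \<open>A smooth function vanishing on a half line\<close>

text \<open>The derivatives of \<open>exp (- 1 / t)\<close> are this function times polynomials in \<open>1 / t\<close>; the
  polynomials are generated by \<open>p \<mapsto> X\<^sup>2 (p - p')\<close>.\<close>
primrec flat_poly :: "nat \<Rightarrow> real poly" where
  "flat_poly 0 = 1"
| "flat_poly (Suc j) = [:0, 0, 1:] * (flat_poly j - pderiv (flat_poly j))"

text \<open>\<open>flat 0\<close> is \<open>t \<mapsto> exp (- 1 / t)\<close>, extended by \<open>0\<close> to \<open>t \<le> 0\<close>, and \<open>flat j\<close> is its \<open>j\<close>-th derivative.\<close>
definition flat :: "nat \<Rightarrow> real \<Rightarrow> real" where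
  "flat j t = (if t > 0 then poly (flat_poly j) (1 / t) * exp (- (1 / t)) else 0)"

lemma poly_exp_decay: "((\<lambda>y. y * poly p y * exp (- y)) \<longlongrightarrow> 0) at_top" for p :: "real poly"
proof -
  have "((\<lambda>y. \<Sum>i\<le>degree p. coeff p i * (y ^ Suc i / exp y)) \<longlongrightarrow> (\<Sum>i\<le>degree p. coeff p i * 0)) at_top"
    by (intro tendsto_sum tendsto_mult tendsto_const tendsto_power_div_exp_0)
  moreover have "(\<Sum>i\<le>degree p. coeff p i * (y ^ Suc i / exp y)) = y * poly p y * exp (- y)" for y
    by (simp add: poly_altdef exp_minus sum_distrib_left sum_distrib_right divide_inverse mult_ac)
  ultimately show ?thesis by simp
qed

lemma flat_deriv: "(flat j has_real_derivative flat (Suc j) t) (at t)"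
proof -
  consider "t > 0" | "t < 0" | "t = 0" by linarith
  then show ?thesis
  proof cases
    case 1
    have "((\<lambda>t. poly (flat_poly j) (1 / t) * exp (- (1 / t))) has_real_derivative flat (Suc j) t) (at t)"
    proof -
      have i: "((\<lambda>t. 1 / t) has_real_derivative (- ((1 / t) ^ 2))) (at t)"
        using 1 by (auto intro!: derivative_eq_intros simp: power2_eq_square)
      have "((\<lambda>t. poly (flat_poly j) (1 / t) * exp (- (1 / t))) has_real_derivative
          poly (flat_poly j) (1 / t) * (exp (- (1 / t)) * (1 / t) ^ 2)
          + (poly (pderiv (flat_poly j)) (1 / t) * (- ((1 / t) ^ 2))) * exp (- (1 / t))) (at t)"
        by (rule DERIV_cong[OF DERIV_mult[OF DERIV_chain2[OF poly_DERIV i] DERIV_chain2[OF DERIV_exp DERIV_minus[OF i]]]])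
           (simp add: algebra_simps)
      also have "poly (flat_poly j) (1 / t) * (exp (- (1 / t)) * (1 / t) ^ 2)
          + (poly (pderiv (flat_poly j)) (1 / t) * (- ((1 / t) ^ 2))) * exp (- (1 / t)) = flat (Suc j) t"
        using 1 by (simp add: flat_def power2_eq_square algebra_simps)
      finally show ?thesis .
    qed
    then show ?thesis
      by (rule has_field_derivative_transform_within_open[where S = "{0<..}"]) (use 1 in \<open>auto simp: flat_def\<close>)
  next
    case 2
    have "((\<lambda>t. 0) has_real_derivative flat (Suc j) t) (at t)"
      using 2 by (simp add: flat_def)
    then show ?thesis
      by (rule has_field_derivative_transform_within_open[where S = "{..<0}"]) (use 2 in \<open>auto simp: flat_def\<close>)
  next
    case 3
    have "((\<lambda>h. flat j h / h) \<longlongrightarrow> 0) (at_right 0)"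
    proof -
      have "((\<lambda>h. inverse h * poly (flat_poly j) (inverse h) * exp (- inverse h)) \<longlongrightarrow> 0) (at_right (0::real))"
        by (rule filterlim_compose[OF poly_exp_decay filterlim_inverse_at_top_right])
      then show ?thesis
        by (rule Lim_transform_eventually)
           (auto simp: eventually_at_filter flat_def divide_inverse mult_ac)
    qed
    moreover have "((\<lambda>h. flat j h / h) \<longlongrightarrow> 0) (at_left 0)"
      by (rule tendsto_eventually) (auto simp: eventually_at_filter flat_def)
    ultimately have "((\<lambda>h. flat j h / h) \<longlongrightarrow> 0) (at 0)"
      by (simp add: filterlim_split_at)
    then show ?thesis unfolding 3 DERIV_def by (simp add: flat_def[of _ 0])
  qed
qed

section \<open>Integrals depending on a parameter\<close>

text \<open>The mean value theorem turns the bound on \<open>f'\<close> into a bound on the difference quotients, to which dominated convergence applies.\<close>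
lemma DERIV_integral:
  fixes f f' :: "real \<Rightarrow> 'b \<Rightarrow> real"
  assumes t0: "t0 \<in> {a<..<b}"
    and int: "\<And>t. t \<in> {a<..<b} \<Longrightarrow> integrable M (f t)"
    and D: "\<And>t y. t \<in> {a<..<b} \<Longrightarrow> ((\<lambda>t. f t y) has_real_derivative f' t y) (at t)"
    and bound: "\<And>t y. t \<in> {a<..<b} \<Longrightarrow> \<bar>f' t y\<bar> \<le> w y" and w: "integrable M w"
    and meas: "f' t0 \<in> borel_measurable M"
  shows "((\<lambda>t. \<integral>y. f t y \<partial>M) has_real_derivative (\<integral>y. f' t0 y \<partial>M)) (at t0)"
proof -
  have lip: "\<bar>(f t y - f t0 y) / (t - t0)\<bar> \<le> w y" if t: "t \<in> {a<..<b}" "t \<noteq> t0" for t y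
  proof -
    have "norm (f t y - f t0 y) \<le> w y * norm (t - t0)"
      by (rule field_differentiable_bound[where S = "{a<..<b}"])
         (use t t0 D bound in \<open>auto intro: has_field_derivative_at_within\<close>)
    then show ?thesis using t by (simp add: field_simps abs_mult)
  qed
  have "((\<lambda>t. ((\<integral>y. f t y \<partial>M) - (\<integral>y. f t0 y \<partial>M)) / (t - t0)) \<longlongrightarrow> (\<integral>y. f' t0 y \<partial>M)) (at t0)"
    unfolding tendsto_at_iff_sequentially
  proof (intro allI impI)
    fix X assume X: "\<forall>i. X i \<in> UNIV - {t0}" "X \<longlonglongrightarrow> t0"
    have "eventually (\<lambda>i. X i \<in> {a<..<b}) sequentially"
      using X(2) t0 by (intro topological_tendstoD) auto
    then obtain N where N: "\<And>i. i \<ge> N \<Longrightarrow> X i \<in> {a<..<b}" by (auto simp: eventually_sequentially)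
    \<comment> \<open>The difference quotients are dominated only near \<open>t0\<close>, so the first terms of the sequence are dropped.\<close>
    define Y where "Y i = X (i + N)" for i
    have Y: "Y i \<in> {a<..<b}" "Y i \<noteq> t0" for i using N X by (auto simp: Y_def)
    have Yl: "Y \<longlonglongrightarrow> t0" unfolding Y_def using X(2) by (rule LIMSEQ_ignore_initial_segment)
    have "(\<lambda>i. \<integral>y. (f (Y i) y - f t0 y) / (Y i - t0) \<partial>M) \<longlonglongrightarrow> (\<integral>y. f' t0 y \<partial>M)"
    proof (rule integral_dominated_convergence[where w = w])
      show "(\<lambda>y. (f (Y i) y - f t0 y) / (Y i - t0)) \<in> borel_measurable M" for i
        using int[OF Y(1)] int[OF t0] by (auto intro: borel_measurable_integrable)
      show "AE y in M. (\<lambda>i. (f (Y i) y - f t0 y) / (Y i - t0)) \<longlonglongrightarrow> f' t0 y"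
      proof (rule AE_I2)
        fix y
        have "((\<lambda>t. (f t y - f t0 y) / (t - t0)) \<longlongrightarrow> f' t0 y) (at t0)"
          using D[OF t0] by (simp add: has_field_derivative_iff)
        then show "(\<lambda>i. (f (Y i) y - f t0 y) / (Y i - t0)) \<longlonglongrightarrow> f' t0 y"
          unfolding tendsto_at_iff_sequentially using Y Yl by (auto simp: o_def)
      qed
      show "AE y in M. norm ((f (Y i) y - f t0 y) / (Y i - t0)) \<le> w y" for i
        using lip[OF Y] by auto
    qed (use meas w in auto)
    then have "(\<lambda>i. ((\<integral>y. f (Y i) y \<partial>M) - (\<integral>y. f t0 y \<partial>M)) / (Y i - t0)) \<longlonglongrightarrow> (\<integral>y. f' t0 y \<partial>M)"
      by (simp add: Bochner_Integration.integral_diff[OF int[OF Y(1)] int[OF t0]])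
    then show "((\<lambda>t. ((\<integral>y. f t y \<partial>M) - (\<integral>y. f t0 y \<partial>M)) / (t - t0)) \<circ> X) \<longlonglongrightarrow> (\<integral>y. f' t0 y \<partial>M)"
      unfolding Y_def o_def by (rule LIMSEQ_offset)
  qed
  then show ?thesis by (simp add: has_field_derivative_iff)
qed

lemma integrable_bounded_support:
  fixes f :: "'a::euclidean_space \<Rightarrow> real"
  assumes [measurable]: "f \<in> borel_measurable borel" and "\<And>x. \<bar>f x\<bar> \<le> B" "\<And>x. norm x > M \<Longrightarrow> f x = 0"
  shows "integrable lborel f"
proof (rule Bochner_Integration.integrable_bound)
  show "integrable lborel (\<lambda>x. B * indicator (cball 0 M) x :: real)"
    by (intro integrable_mult_right integrable_real_indicator emeasure_bounded_finite) auto
  show "AE x in lborel. norm (f x) \<le> norm (B * indicator (cball 0 M) x)"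
  proof (rule AE_I2)
    fix x show "norm (f x) \<le> norm (B * indicator (cball 0 M) x)"
      using assms(2)[of x] assms(3)[of x] by (cases "norm x \<le> M") (auto simp: indicator_def)
  qed
qed simp

lemma integrable_cball_const: "integrable lborel (\<lambda>x::'a::euclidean_space. B * indicator (cball a M) x :: real)"
  by (intro integrable_mult_right integrable_real_indicator emeasure_bounded_finite) auto

lemma nn_integral_affine:
  fixes f :: "'a::euclidean_space \<Rightarrow> ennreal"
  assumes [measurable]: "f \<in> borel_measurable borel" and c: "c \<noteq> 0"
  shows "(\<integral>\<^sup>+x. f x \<partial>lborel) = ennreal (\<bar>c\<bar> ^ DIM('a)) * (\<integral>\<^sup>+x. f (t + c *\<^sub>R x) \<partial>lborel)"
  by (subst lborel_affine[OF c, of t]) (simp add: nn_integral_density nn_integral_distr nn_integral_cmult)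

lemma integral_affine:
  fixes f :: "'a::euclidean_space \<Rightarrow> real"
  assumes [measurable]: "f \<in> borel_measurable borel" and c: "c \<noteq> 0"
  shows "(LBINT x. f x) = \<bar>c\<bar> ^ DIM('a) * (LBINT x. f (t + c *\<^sub>R x))"
  by (subst lborel_affine[OF c, of t]) (simp add: integral_density integral_distr)

text \<open>Translation invariance makes the integral of a directional derivative of a compactly
  supported function vanish: the integral of \<open>F (x + t b)\<close> does not depend on \<open>t\<close>.\<close>
lemma integral_directional_derivative_0:
  fixes F G :: "'a::euclidean_space \<Rightarrow> real"
  assumes F: "continuous_on UNIV F" and G: "continuous_on UNIV G"
    and supp: "\<And>x. norm x > M \<Longrightarrow> F x = 0" "\<And>x. norm x > M \<Longrightarrow> G x = 0"
    and D: "\<And>x. ((\<lambda>t. F (x + t *\<^sub>R b)) has_real_derivative G x) (at 0)"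
  shows "(LBINT x. G x) = 0"
proof -
  have [measurable]: "F \<in> borel_measurable borel" "G \<in> borel_measurable borel"
    using F G by (auto intro: borel_measurable_continuous_onI)
  have bdd: "\<exists>B. \<forall>x. \<bar>H x\<bar> \<le> B" if "continuous_on UNIV H" "\<And>x. norm x > M \<Longrightarrow> H x = 0" for H :: "'a \<Rightarrow> real"
  proof -
    have "bounded (H ` cball 0 M)"
      by (intro compact_imp_bounded compact_continuous_image continuous_on_subset[OF that(1)]) auto
    then obtain B where "\<And>x. norm x \<le> M \<Longrightarrow> \<bar>H x\<bar> \<le> B" unfolding bounded_iff by (metis imageI mem_cball_0 real_norm_def)
    then have "\<bar>H x\<bar> \<le> max 0 B" for x using that(2)[of x] by (cases "norm x \<le> M") fastforce+
    then show ?thesis by blast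
  qed
  obtain BF where BF: "\<And>x. \<bar>F x\<bar> \<le> BF" using bdd[OF F supp(1)] by blast
  obtain BG where BG: "\<And>x. \<bar>G x\<bar> \<le> BG" using bdd[OF G supp(2)] by blast
  have BG0: "BG \<ge> 0" using BG[of 0] by linarith
  have far: "norm (x + t *\<^sub>R b) > M" if "norm x > M + norm b" "t \<in> {-1<..<1}" for x t
  proof -
    have "norm (t *\<^sub>R b) \<le> norm b" using that by (auto intro: mult_left_le_one_le)
    then show ?thesis using that norm_triangle_ineq4[of "x + t *\<^sub>R b" "t *\<^sub>R b"] by simp
  qed
  have "((\<lambda>t. \<integral>x. F (x + t *\<^sub>R b) \<partial>lborel) has_real_derivative (LBINT x. G (x + 0 *\<^sub>R b))) (at 0)"
  proof (rule DERIV_integral[where a = "-1" and b = 1 and w = "\<lambda>x. BG * indicator (cball 0 (M + norm b)) x"])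
    fix t :: real assume t: "t \<in> {-1<..<1}"
    show "integrable lborel (\<lambda>x. F (x + t *\<^sub>R b))"
      by (rule integrable_bounded_support[where M = "M + norm b"]) (use BF far t supp in auto)
    fix x
    have "((\<lambda>s. F ((x + t *\<^sub>R b) + (s - t) *\<^sub>R b)) has_real_derivative G (x + t *\<^sub>R b) * 1) (at t)"
      by (rule DERIV_chain2[where g = "\<lambda>s. s - t"]) (use D in \<open>auto intro!: derivative_eq_intros\<close>)
    then show "((\<lambda>t. F (x + t *\<^sub>R b)) has_real_derivative G (x + t *\<^sub>R b)) (at t)"
      by (simp add: scaleR_diff_left)
    show "\<bar>G (x + t *\<^sub>R b)\<bar> \<le> BG * indicator (cball 0 (M + norm b)) x"
      using BG[of "x + t *\<^sub>R b"] far[of x t] t supp(2)[of "x + t *\<^sub>R b"] BG0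
      by (cases "norm x > M + norm b") (auto simp: indicator_def)
  qed (simp_all only: integrable_cball_const greaterThanLessThan_iff, simp_all)
  moreover have "(LBINT x. F (x + t *\<^sub>R b)) = (LBINT x. F x)" for t
    using integral_affine[of F 1 "t *\<^sub>R b"] by (simp add: add.commute)
  ultimately have "((\<lambda>t::real. \<integral>x. F x \<partial>lborel) has_real_derivative (LBINT x. G x)) (at 0)" by simp
  then show ?thesis using DERIV_unique DERIV_const by blast
qed

section \<open>Convolution with a test function\<close>

text \<open>Convolution is the tool that turns weak solutions into smooth ones: all derivatives fall on the test function.\<close>
definition conv :: "('a::euclidean_space \<Rightarrow> real) \<Rightarrow> ('a \<Rightarrow> real) \<Rightarrow> 'a \<Rightarrow> real" where
  "conv u \<phi> x = (LBINT y. u y * \<phi> (x - y))"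

definition locally_bounded :: "('a::euclidean_space \<Rightarrow> real) \<Rightarrow> bool" where
  "locally_bounded f \<longleftrightarrow> (\<forall>M. \<exists>C. \<forall>x. norm x \<le> M \<longrightarrow> \<bar>f x\<bar> \<le> C)"

lemma locally_boundedD:
  assumes "locally_bounded u"
  obtains C where "C \<ge> 0" "\<And>x. norm x \<le> M \<Longrightarrow> \<bar>u x\<bar> \<le> C"
proof -
  obtain C where "\<And>x. norm x \<le> M \<Longrightarrow> \<bar>u x\<bar> \<le> C" using assms unfolding locally_bounded_def by metis
  then show ?thesis using that[of "max 0 C"] by fastforce
qed

lemma test_function_measurable: "test_function \<phi> \<Longrightarrow> \<phi> \<in> borel_measurable borel"
  by (intro borel_measurable_continuous_onI test_function_continuous)

text \<open>For \<open>x\<close> in a bounded set, only \<open>y\<close> in a bounded set contribute to \<open>conv u \<phi> x\<close>.  This one majorant serves for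
  continuity and for differentiability of the convolution.\<close>
lemma conv_dominated:
  assumes u: "locally_bounded u" and \<phi>: "\<And>z. \<bar>\<phi> z\<bar> \<le> B" "\<And>z. norm z > M \<Longrightarrow> \<phi> z = 0" 
  shows "\<exists>w. integrable lborel w \<and> (\<forall>x y. norm x \<le> N \<longrightarrow> \<bar>u y * \<phi> (x - y)\<bar> \<le> w y)"
proof -
  obtain C where C: "C \<ge> 0" "\<And>y. norm y \<le> M + N \<Longrightarrow> \<bar>u y\<bar> \<le> C" using locally_boundedD[OF u] by blast
  have B: "B \<ge> 0" using \<phi>(1)[of 0] by linarith
  have "\<bar>u y * \<phi> (x - y)\<bar> \<le> C * B * indicator (cball 0 (M + N)) y" if "norm x \<le> N" for x y
  proof (cases "norm y \<le> M + N")
    case True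
    then show ?thesis using C(2)[OF True] \<phi>(1)[of "x - y"] C(1) B by (auto simp: abs_mult intro!: mult_mono)
  next
    case False
    then have "norm (x - y) > M" using that norm_triangle_ineq2[of y x] by (simp add: norm_minus_commute)
    then show ?thesis using \<phi>(2) C(1) B by (simp add: indicator_def)
  qed
  then show ?thesis by (intro exI[of _ "\<lambda>y. C * B * indicator (cball 0 (M + N)) y"] conjI integrable_cball_const) simp
qed

lemma conv_integrable:
  assumes [measurable]: "u \<in> borel_measurable borel" and u: "locally_bounded u" and \<phi>: "test_function \<phi>"
  shows "integrable lborel (\<lambda>y. u y * \<phi> (x - y))"
proof -
  have [measurable]: "\<phi> \<in> borel_measurable borel" using \<phi> by (rule test_function_measurable)
  obtain M B where MB: "\<And>x. norm x > M \<Longrightarrow> \<phi> x = 0" "\<And>x. \<bar>\<phi> x\<bar> \<le> B" using test_function_bounds[OF \<phi>] by metis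
  obtain w where w0: "integrable lborel w \<and> (\<forall>x' y. norm x' \<le> norm x \<longrightarrow> \<bar>u y * \<phi> (x' - y)\<bar> \<le> w y)"
    using conv_dominated[OF u MB(2,1), where N = "norm x"] ..
  then have w: "integrable lborel w" "\<And>x' y. norm x' \<le> norm x \<Longrightarrow> \<bar>u y * \<phi> (x' - y)\<bar> \<le> w y" by simp_all
  show ?thesis
  proof (rule Bochner_Integration.integrable_bound[OF w(1)])
    show "AE y in lborel. norm (u y * \<phi> (x - y)) \<le> norm (w y)"
      using w(2)[of x] by (intro AE_I2) (simp add: order_trans[OF _ abs_ge_self])
  qed simp
qed

lemma conv_continuous:
  fixes u :: "'a::euclidean_space \<Rightarrow> real"
  assumes [measurable]: "u \<in> borel_measurable borel" and u: "locally_bounded u" and \<phi>: "test_function \<phi>"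
  shows "continuous_on UNIV (conv u \<phi>)"
  unfolding continuous_on_sequentially
proof (intro allI ballI impI, elim conjE)
  fix X and x :: 'a assume X: "X \<longlonglongrightarrow> x"
  have [measurable]: "\<phi> \<in> borel_measurable borel" using \<phi> by (rule test_function_measurable)
  obtain M B where MB: "\<And>x. norm x > M \<Longrightarrow> \<phi> x = 0" "\<And>x. \<bar>\<phi> x\<bar> \<le> B" using test_function_bounds[OF \<phi>] by metis
  obtain N where N: "\<And>i. norm (X i) \<le> N" 
    using convergent_imp_bounded[OF X] unfolding bounded_iff by auto
  obtain w where w0: "integrable lborel w \<and> (\<forall>x' y. norm x' \<le> N \<longrightarrow> \<bar>u y * \<phi> (x' - y)\<bar> \<le> w y)"
    using conv_dominated[OF u MB(2,1), where N = "N"] ..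
  then have w: "integrable lborel w" "\<And>x' y. norm x' \<le> N \<Longrightarrow> \<bar>u y * \<phi> (x' - y)\<bar> \<le> w y" by simp_all
  have "(\<lambda>i. \<integral>y. u y * \<phi> (X i - y) \<partial>lborel) \<longlonglongrightarrow> (LBINT y. u y * \<phi> (x - y))"
  proof (rule integral_dominated_convergence[OF _ _ w(1)])
    have "(\<lambda>i. \<phi> (X i - y)) \<longlonglongrightarrow> \<phi> (x - y)" for y
      by (rule continuous_on_tendsto_compose[OF test_function_continuous[OF \<phi>, of UNIV]])
         (auto intro!: tendsto_intros X)
    then show "AE y in lborel. (\<lambda>i. u y * \<phi> (X i - y)) \<longlonglongrightarrow> u y * \<phi> (x - y)"
      by (intro AE_I2 tendsto_mult tendsto_const)
    show "AE y in lborel. norm (u y * \<phi> (X i - y)) \<le> w y" for i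
      using w(2)[OF N] by simp
  qed simp_all
  then show "(conv u \<phi> \<circ> X) \<longlonglongrightarrow> conv u \<phi> x" by (simp add: conv_def[abs_def] o_def)
qed

lemma conv_DERIV:
  fixes u :: "'a::euclidean_space \<Rightarrow> real"
  assumes [measurable]: "u \<in> borel_measurable borel" and u: "locally_bounded u"
    and \<phi>: "test_function \<phi>" and b: "b \<in> Basis"
  shows "((\<lambda>t. conv u \<phi> (x + t *\<^sub>R b)) has_real_derivative conv u (partial_deriv b \<phi>) (x + t *\<^sub>R b)) (at t)"
proof -
  let ?d = "partial_deriv b \<phi>"
  have d: "test_function ?d" using \<phi> b by (rule test_function_partial_deriv)
  have [measurable]: "\<phi> \<in> borel_measurable borel" "?d \<in> borel_measurable borel"
    using \<phi> d by (auto intro: test_function_measurable)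
  obtain M B where MB: "\<And>x. norm x > M \<Longrightarrow> ?d x = 0" "\<And>x. \<bar>?d x\<bar> \<le> B" using test_function_bounds[OF d] by metis
  obtain w where w0: "integrable lborel w \<and> (\<forall>x' y. norm x' \<le> norm x + (\<bar>t\<bar> + 1) * norm b \<longrightarrow> \<bar>u y * ?d (x' - y)\<bar> \<le> w y)"
    using conv_dominated[OF u MB(2,1), where N = "norm x + (\<bar>t\<bar> + 1) * norm b"] ..
  then have w: "integrable lborel w" "\<And>x' y. norm x' \<le> norm x + (\<bar>t\<bar> + 1) * norm b \<Longrightarrow> \<bar>u y * ?d (x' - y)\<bar> \<le> w y" by simp_all
  have near: "norm (x + s *\<^sub>R b) \<le> norm x + (\<bar>t\<bar> + 1) * norm b" if "s \<in> {t - 1<..<t + 1}" for s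
  proof -
    have "norm (s *\<^sub>R b) \<le> (\<bar>t\<bar> + 1) * norm b" using that by (auto intro!: mult_right_mono)
    then show ?thesis using norm_triangle_ineq[of x "s *\<^sub>R b"] by linarith
  qed
  show ?thesis unfolding conv_def
  proof (rule DERIV_integral[where a = "t - 1" and b = "t + 1" and w = w])
    fix s y
    have "((\<lambda>s. \<phi> ((x - y) + s *\<^sub>R b)) has_real_derivative ?d ((x - y) + s *\<^sub>R b)) (at s)"
      by (rule test_function_DERIV_line[OF \<phi>])
    then show "((\<lambda>s. u y * \<phi> (x + s *\<^sub>R b - y)) has_real_derivative u y * ?d (x + s *\<^sub>R b - y)) (at s)"
      by (intro DERIV_cmult) (simp add: algebra_simps)
    assume "s \<in> {t - 1<..<t + 1}"
    then show "\<bar>u y * ?d (x + s *\<^sub>R b - y)\<bar> \<le> w y" by (rule w(2)[OF near])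
  qed (use w(1) conv_integrable[OF assms(1) u \<phi>] in simp_all)
qed

text \<open>The distributional equation \<open>- \<Delta> u = f\<close>, for Borel functions on which bounds and signs can be imposed at every point.\<close>
definition weak_poisson :: "('a::euclidean_space \<Rightarrow> real) \<Rightarrow> ('a \<Rightarrow> real) \<Rightarrow> bool" where
  "weak_poisson u f \<longleftrightarrow> u \<in> borel_measurable borel \<and> locally_bounded u \<and>
     f \<in> borel_measurable borel \<and> locally_bounded f \<and>
     (\<forall>\<phi>. test_function \<phi> \<longrightarrow> (LBINT x. u x * laplacian \<phi> x) = - (LBINT x. f x * \<phi> x))"

lemma conv_laplacian:
  assumes uf: "weak_poisson u f" and \<phi>: "test_function \<phi>"
  shows "conv u (laplacian \<phi>) x = - conv f \<phi> x"
  using uf test_function_reflect[OF \<phi>] by (simp add: weak_poisson_def conv_def laplacian_reflect[OF \<phi>, symmetric])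

lemma conv_laplacian_sum:
  assumes u: "u \<in> borel_measurable borel" "locally_bounded u" and \<phi>: "test_function \<phi>"
  shows "(\<Sum>b\<in>Basis. conv u (partial_deriv b (partial_deriv b \<phi>)) x) = conv u (laplacian \<phi>) x"
proof -
  have "(\<Sum>b\<in>Basis. conv u (partial_deriv b (partial_deriv b \<phi>)) x)
      = (LBINT y. (\<Sum>b\<in>Basis. u y * partial_deriv b (partial_deriv b \<phi>) (x - y)))"
    unfolding conv_def
    by (intro Bochner_Integration.integral_sum[symmetric] conv_integrable u test_function_partial_deriv \<phi>)
  then show ?thesis by (simp add: conv_def sum_distrib_left laplacian_def)
qed

section \<open>Radial mollifiers\<close>

lemma flat_0: "t \<le> 0 \<Longrightarrow> flat j t = 0" by (simp add: flat_def)
lemma flat_pos: "t > 0 \<Longrightarrow> flat 0 t > 0" "t > 0 \<Longrightarrow> flat (Suc 0) t > 0" by (auto simp: flat_def)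
lemma flat_nonneg: "flat 0 t \<ge> 0" "flat (Suc 0) t \<ge> 0" by (auto simp: flat_def)
lemma flat_le_1: "flat 0 t \<le> 1" by (auto simp: flat_def)
lemma flat_continuous: "continuous_on S (flat j)"
  by (meson DERIV_isCont continuous_at_imp_continuous_on flat_deriv)

text \<open>Since \<open>flat 0\<close> vanishes on the negative half line, \<open>bump 0 s\<close> is supported in the ball of radius \<open>s\<close>.  The index \<open>j\<close> differentiates
  the profile: up to a factor, \<open>bump 1 s\<close> is the radial derivative of \<open>bump 0 s\<close> divided by \<open>\<bar>z\<bar>\<close>, and it is
  positive inside the ball because \<open>exp (- 1 / t)\<close> is increasing.\<close>
definition bump :: "nat \<Rightarrow> real \<Rightarrow> 'a::euclidean_space \<Rightarrow> real" where
  "bump j s z = flat j (1 - (z \<bullet> z) / s\<^sup>2)"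

lemma bump_quadratic: "bump j s = (\<lambda>z. flat j (- (1 / s\<^sup>2) * ((z - 0) \<bullet> (z - 0)) + 1))"
  by (simp add: bump_def[abs_def])

lemma bump_support: "s > 0 \<Longrightarrow> norm z \<ge> s \<Longrightarrow> bump j s z = 0"
  by (auto simp: bump_def dot_square_norm field_simps intro!: flat_0 power_mono)

lemma bump_Ck: "Ck k (bump j s)"
  unfolding bump_quadratic
  by (rule Ck_compose[where h = flat and S = UNIV, OF flat_deriv UNIV_I Ck_quadratic])

lemma bump_test: "s > 0 \<Longrightarrow> test_function (bump j s)"
  by (rule test_functionI[where M = s]) (auto intro: bump_Ck bump_support)

lemma bump_nonneg: "bump 0 s z \<ge> 0" "bump (Suc 0) s z \<ge> 0"
  using flat_nonneg by (auto simp: bump_def)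

definition mass :: "'a::euclidean_space itself \<Rightarrow> real" where
  "mass _ = (LBINT z. bump (Suc 0) 1 (z :: 'a))"

lemma bump_integrable: "s > 0 \<Longrightarrow> integrable lborel (bump j s)"
  using integrable_bounded_support[OF test_function_measurable[OF bump_test], of s]
  by (metis bump_test test_function_bounds)

lemma mass_pos: "mass TYPE('a::euclidean_space) > 0"
proof -
  have int: "integrable lborel (bump (Suc 0) 1 :: 'a \<Rightarrow> real)" by (rule bump_integrable) simp
  have "mass TYPE('a) \<ge> 0" unfolding mass_def by (intro integral_nonneg_AE) (simp add: bump_nonneg)
  moreover have "mass TYPE('a) \<noteq> 0"
  proof
    assume "mass TYPE('a) = 0"
    then have "AE z in lborel. bump (Suc 0) 1 (z::'a) = 0"
      unfolding mass_def using integral_nonneg_eq_0_iff_AE[OF int] by (simp add: bump_nonneg)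
    then have "AE z in lborel. z \<notin> ball (0::'a) 1"
    proof (eventually_elim)
      fix z :: 'a assume "bump (Suc 0) 1 z = 0"
      then have "\<not> 1 - z \<bullet> z > 0" using flat_pos(2)[of "1 - z \<bullet> z"] by (auto simp: bump_def)
      then show "z \<notin> ball 0 1" by (auto simp: dot_square_norm abs_square_less_1)
    qed
    then have "emeasure lborel (ball (0::'a) 1) = 0"
      using AE_iff_null_sets[of "ball (0::'a) 1" lborel] by (auto simp: null_sets_def)
    then show False using content_ball_pos[of 1 "0::'a"] by (simp add: measure_def)
  qed
  ultimately show ?thesis by simp
qed

definition kern :: "real \<Rightarrow> 'a::euclidean_space \<Rightarrow> real" where
  "kern s z = bump (Suc 0) s z / (s ^ DIM('a) * mass TYPE('a))"

lemma kern_test: 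
  assumes "s > 0" shows "test_function (kern s :: 'a::euclidean_space \<Rightarrow> real)"
proof (rule test_functionI[where M = s])
  have "kern s = (\<lambda>z::'a. bump (Suc 0) s z * (1 / (s ^ DIM('a) * mass TYPE('a))))" by (auto simp: kern_def)
  then show "Ck k (kern s :: 'a \<Rightarrow> real)" for k by (simp only: Ck_mult bump_Ck Ck_const)
qed (use assms in \<open>simp add: kern_def bump_support\<close>)

lemma kern_nonneg: "s > 0 \<Longrightarrow> kern s (z :: 'a::euclidean_space) \<ge> 0"
  using mass_pos[where 'a = 'a] by (simp add: kern_def bump_nonneg)

lemma kern_support: "s > 0 \<Longrightarrow> norm z \<ge> s \<Longrightarrow> kern s z = 0"
  by (simp add: kern_def bump_support)

lemma kern_measurable [measurable]: "kern s \<in> borel_measurable borel"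
  unfolding kern_def[abs_def] using bump_Ck[of 0]
  by (intro borel_measurable_divide borel_measurable_const borel_measurable_continuous_onI) simp

lemma kern_integral: 
  assumes s: "s > 0"
  shows "(LBINT y. kern s (x - y :: 'a::euclidean_space)) = 1"
proof -
  have "(LBINT z. kern s (z::'a)) = s ^ DIM('a) * (LBINT z. kern s (0 + s *\<^sub>R z :: 'a))"
    using integral_affine[of "kern s :: 'a \<Rightarrow> real" s 0] s by simp
  also have "(\<lambda>z. kern s (0 + s *\<^sub>R z :: 'a)) = (\<lambda>z. bump (Suc 0) 1 z / (s ^ DIM('a) * mass TYPE('a)))"
    using s by (auto simp: kern_def bump_def power2_eq_square field_simps)
  also have "s ^ DIM('a) * (LBINT z. bump (Suc 0) 1 (z::'a) / (s ^ DIM('a) * mass TYPE('a))) = 1"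
    using s mass_pos[where 'a = 'a] mass_def[of "TYPE('a)"] by (simp add: divide_simps)
  finally have "(LBINT z. kern s (z::'a)) = 1" .
  then show ?thesis using integral_affine[of "kern s :: 'a \<Rightarrow> real" "-1" x] by simp
qed

lemma kern_integrable: 
  assumes "s > 0" shows "integrable lborel (\<lambda>y. kern s (x - y))"
  using kern_integral[OF assms, of x] not_integrable_integral_eq by force

lemma kern_partial_commute:
  "partial_deriv b (partial_deriv b' (kern s)) = partial_deriv b' (partial_deriv b (kern s))"
proof -
  define h where "h j v = flat j v / (s ^ DIM('a) * mass TYPE('a))" for j v
  have D: "(h j has_real_derivative h (Suc j) v) (at v)" for j v
    unfolding h_def[abs_def] by (intro DERIV_cdivide flat_deriv)
  have k: "kern s = (\<lambda>z::'a. h (Suc 0) (- (1 / s\<^sup>2) * ((z - 0) \<bullet> (z - 0)) + 1))"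
    by (simp add: kern_def[abs_def] bump_def h_def)
  show ?thesis unfolding k
    by (intro ext, subst (1 2) partial_deriv2_radial[OF D D]) (simp add: inner_commute)
qed

section \<open>Mean values of superharmonic functions\<close>

lemma conv_nonneg:
  assumes "\<And>z. \<phi> z \<ge> 0" "\<And>y. \<phi> (x - y) \<noteq> 0 \<Longrightarrow> u y \<ge> 0"
  shows "conv u \<phi> x \<ge> 0"
  unfolding conv_def using assms by (intro integral_nonneg_AE AE_I2) (metis mult_nonneg_nonneg mult_zero_right order_refl)

lemma laplacian_bump:
  "laplacian (bump 0 s) (z::'a::euclidean_space)
     = - (2 / s\<^sup>2) * DIM('a) * bump (Suc 0) s z + 4 / s\<^sup>2 * ((z \<bullet> z) / s\<^sup>2) * bump (Suc (Suc 0)) s z"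
proof -
  have "laplacian (bump 0 s) z = 2 * - (1 / s\<^sup>2) * DIM('a) * flat (Suc 0) (- (1 / s\<^sup>2) * ((z - 0) \<bullet> (z - 0)) + 1)
     + 4 * (- (1 / s\<^sup>2))\<^sup>2 * ((z - 0) \<bullet> (z - 0)) * flat (Suc (Suc 0)) (- (1 / s\<^sup>2) * ((z - 0) \<bullet> (z - 0)) + 1)"
    unfolding bump_quadratic by (rule laplacian_radial[OF flat_deriv flat_deriv])
  then show ?thesis by (simp add: bump_quadratic power2_eq_square numeral_2_eq_2)
qed

text \<open>This identity is the reason for building the mollifier from \<open>bump 1\<close>: with this choice its derivative in the scale is the
  Laplacian of a nonnegative test function, \<open>\<partial>\<^sub>s (s\<^bsup>-n\<^esup> K (z / s)) = - div (s\<^bsup>-n-1\<^esup> z K (z / s))\<close>, and \<open>z K\<close> is a gradient.\<close>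
lemma kern_scale_DERIV:
  assumes s: "s > 0"
  shows "((\<lambda>s. kern s (z::'a::euclidean_space)) has_real_derivative
     s / (2 * s ^ DIM('a) * mass TYPE('a)) * laplacian (bump 0 s) z) (at s)"
proof -
  let ?n = "DIM('a)" and ?m = "mass TYPE('a)"
  have m: "?m > 0" by (rule mass_pos)
  have q: "((\<lambda>s. 1 - (z \<bullet> z) / s\<^sup>2) has_real_derivative 2 * (z \<bullet> z) / s ^ 3) (at s)"
    using s by (auto intro!: derivative_eq_intros simp: power2_eq_square power3_eq_cube field_simps)
  have b: "((\<lambda>s. bump (Suc 0) s z) has_real_derivative bump (Suc (Suc 0)) s z * (2 * (z \<bullet> z) / s ^ 3)) (at s)"
    unfolding bump_def by (rule DERIV_chain2[OF flat_deriv q])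
  have p: "((\<lambda>s. 1 / (s ^ ?n * ?m)) has_real_derivative - (real ?n / (s ^ ?n * s * ?m))) (at s)"
  proof -
    have "((\<lambda>s. 1 / (s ^ ?n * ?m)) has_real_derivative - (real ?n * s ^ (?n - 1) * ?m / (s ^ ?n * ?m)\<^sup>2)) (at s)"
      using s m by (auto intro!: derivative_eq_intros simp: power2_eq_square)
    moreover have "s ^ ?n = s ^ (?n - 1) * s" using DIM_positive[where 'a = 'a] by (metis power_minus_mult)
    ultimately show ?thesis using s m by (simp add: power2_eq_square field_simps)
  qed
  have "((\<lambda>s. bump (Suc 0) s z * (1 / (s ^ ?n * ?m))) has_real_derivative
      bump (Suc (Suc 0)) s z * (2 * (z \<bullet> z) / s ^ 3) * (1 / (s ^ ?n * ?m)) + - (real ?n / (s ^ ?n * s * ?m)) * bump (Suc 0) s z) (at s)"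
    by (rule DERIV_mult[OF b p])
  also have "bump (Suc (Suc 0)) s z * (2 * (z \<bullet> z) / s ^ 3) * (1 / (s ^ ?n * ?m)) + - (real ?n / (s ^ ?n * s * ?m)) * bump (Suc 0) s z
     = s / (2 * s ^ ?n * ?m) * laplacian (bump 0 s) z"
    using s m unfolding laplacian_bump by (simp add: field_simps power2_eq_square power3_eq_cube)
  finally show ?thesis by (simp add: kern_def)
qed

text \<open>A form of the mean value inequality.  By \<open>kern_scale_DERIV\<close> the derivative of \<open>conv u (kern s) x\<close> in \<open>s\<close> is a positive multiple of
  \<open>conv u (laplacian (bump 0 s)) x = - conv f (bump 0 s) x\<close>, which is nonpositive as soon as \<open>f\<close> is nonnegative on the ball of
  radius \<open>t\<close> around \<open>x\<close>.\<close>
lemma conv_kern_antimono: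
  fixes u :: "'a::euclidean_space \<Rightarrow> real"
  assumes uf: "weak_poisson u f" and e: "0 < e" "e \<le> t"
    and f: "\<And>y. dist x y < t \<Longrightarrow> f y \<ge> 0"
  shows "conv u (kern t) x \<le> conv u (kern e) x"
proof (rule DERIV_nonpos_imp_nonincreasing[OF e(2)])
  fix s assume s: "e \<le> s" "s \<le> t"
  let ?D = "\<lambda>s z::'a. s / (2 * s ^ DIM('a) * mass TYPE('a)) * laplacian (bump 0 s) z"
  have [simp]: "mass TYPE('a) \<noteq> 0" using mass_pos[where 'a = 'a] by simp
  have [measurable]: "u \<in> borel_measurable borel" and u: "locally_bounded u"
    using uf by (auto simp: weak_poisson_def)
  have s0: "s > 0" using s e by simp
  have [measurable]: "laplacian (bump 0 s) \<in> borel_measurable (borel :: 'a measure)"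
    unfolding laplacian_def[abs_def]
    by (intro borel_measurable_sum test_function_measurable test_function_partial_deriv bump_test s0)
  have cont: "continuous_on ({s / 2..2 * s} \<times> cball 0 (2 * s)) (\<lambda>(s, z). ?D s z)"
    unfolding laplacian_bump bump_def case_prod_unfold
    by (intro continuous_intros continuous_on_compose2[OF flat_continuous[of UNIV]]) (use s0 in auto)
  have "bounded ((\<lambda>(s, z). ?D s z) ` ({s / 2..2 * s} \<times> cball 0 (2 * s)))"
    by (intro compact_imp_bounded compact_continuous_image cont compact_Times) auto
  then obtain B where B1: "\<forall>v \<in> (\<lambda>(s, z). ?D s z) ` ({s / 2..2 * s} \<times> cball 0 (2 * s)). norm v \<le> B"
    unfolding bounded_iff ..
  have B: "\<bar>?D s' z\<bar> \<le> B" if "s' \<in> {s / 2..2 * s}" "norm z \<le> 2 * s" for s' z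
    using that by (intro B1[rule_format, unfolded real_norm_def] image_eqI[of _ _ "(s', z)"]) auto
  define \<psi> :: "'a \<Rightarrow> real" where "\<psi> z = B * indicator (cball 0 (2 * s)) z" for z
  have B0: "B \<ge> 0" by (rule order_trans[OF abs_ge_zero B[of s 0]]) (use s0 in auto)
  have dom: "\<bar>?D s' z\<bar> \<le> \<psi> z" if "s' \<in> {s / 2<..<2 * s}" for s' z
  proof (cases "norm z \<le> 2 * s")
    case False
    then have "laplacian (bump 0 s') z = 0" using that s0 unfolding laplacian_bump by (simp add: bump_support)
    then show ?thesis using B0 by (simp add: \<psi>_def)
  qed (use B that in \<open>auto simp: \<psi>_def\<close>)
  have \<psi>: "\<bar>\<psi> z\<bar> \<le> B" "norm z > 2 * s \<Longrightarrow> \<psi> z = 0" for z using B0 by (auto simp: \<psi>_def indicator_def)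
  obtain w where w: "integrable lborel w \<and> (\<forall>x' y. norm x' \<le> norm x \<longrightarrow> \<bar>u y * \<psi> (x' - y)\<bar> \<le> w y)"
    using conv_dominated[OF u \<psi>, where N = "norm x"] ..
  have "((\<lambda>s. conv u (kern s) x) has_real_derivative (LBINT y. u y * ?D s (x - y))) (at s)"
    unfolding conv_def
  proof (rule DERIV_integral[where a = "s / 2" and b = "2 * s" and w = w])
    fix s' y assume s': "s' \<in> {s / 2<..<2 * s}"
    then have "s' > 0" using s0 by simp
    then show "((\<lambda>s. u y * kern s (x - y)) has_real_derivative u y * ?D s' (x - y)) (at s')"
      by (intro DERIV_cmult kern_scale_DERIV)
    have "\<bar>u y * ?D s' (x - y)\<bar> \<le> \<bar>u y * \<psi> (x - y)\<bar>"
      using dom[OF s', of "x - y"] by (simp only: abs_mult) (intro mult_left_mono, auto)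
    then show "\<bar>u y * ?D s' (x - y)\<bar> \<le> w y" using w by (meson order_refl order_trans)
  qed (use s0 w in \<open>auto intro!: conv_integrable u kern_test\<close>)
  moreover have "(LBINT y. u y * ?D s (x - y)) = s / (2 * s ^ DIM('a) * mass TYPE('a)) * conv u (laplacian (bump 0 s)) x"
    unfolding conv_def by (simp flip: integral_mult_right_zero add: mult_ac)
  moreover have "conv f (bump 0 s) x \<ge> 0"
  proof (rule conv_nonneg)
    fix y assume "bump 0 s (x - y) \<noteq> 0"
    then have "dist x y < s" using bump_support[OF s0, of "x - y" 0] by (force simp: dist_norm)
    then show "f y \<ge> 0" using f s by simp
  qed (simp add: bump_nonneg)
  ultimately have D: "((\<lambda>s. conv u (kern s) x) has_real_derivative
      s / (2 * s ^ DIM('a) * mass TYPE('a)) * (- conv f (bump 0 s) x)) (at s)"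
    and f0: "conv f (bump 0 s) x \<ge> 0"
    using conv_laplacian[OF uf bump_test[OF s0, of 0], of x] by simp_all
  show "\<exists>d. ((\<lambda>s. conv u (kern s) x) has_real_derivative d) (at s) \<and> d \<le> 0"
    by (rule exI, rule conjI, rule D) (use f0 s0 mass_pos[where 'a = 'a] in \<open>simp add: mult_nonneg_nonneg\<close>)
qed

section \<open>Convergence of mollifications\<close>

lemma AE_lborel_negligible: "negligible N \<Longrightarrow> AE x in lborel. x \<notin> N"
  using AE_not_in[of N lebesgue] by (simp add: negligible_iff_null_sets AE_completion_iff)

text \<open>A measurable function is the almost everywhere limit of continuous functions; truncating these at the bound of \<open>u\<close> makes the
  convergence dominated.\<close>
lemma ex_continuous_approx:
  fixes u :: "'a::euclidean_space \<Rightarrow> real"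
  assumes [measurable]: "u \<in> borel_measurable borel" and u: "locally_bounded u" and e: "e > 0"
  obtains g where "continuous_on UNIV g" "(\<integral>\<^sup>+x. ennreal (\<bar>u x - g x\<bar>) * indicator (cball 0 M) x \<partial>lborel) \<le> ennreal e"
proof -
  obtain C where C: "C \<ge> 0" "\<And>x. norm x \<le> M \<Longrightarrow> \<bar>u x\<bar> \<le> C" using locally_boundedD[OF u] by blast
  have "u \<in> borel_measurable lebesgue" by (simp add: measurable_completion)
  then have "u measurable_on UNIV" by (simp add: measurable_on_iff_borel_measurable)
  then obtain N g where N: "negligible N" and g: "\<And>n. continuous_on UNIV (g n)"
      and lim: "\<And>x. x \<notin> N \<Longrightarrow> (\<lambda>n. g n x) \<longlonglongrightarrow> u x"
    unfolding measurable_on_def by auto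
  \<comment> \<open>Truncation does not affect the limit on \<open>cball 0 M\<close>, where \<open>\<bar>u\<bar> \<le> C\<close>.\<close>
  define h where "h n x = max (- C) (min C (g n x))" for n :: nat and x
  have hc: "continuous_on UNIV (h n)" for n unfolding h_def by (intro continuous_intros g)
  have [measurable]: "h n \<in> borel_measurable borel" for n using hc by (rule borel_measurable_continuous_onI)
  have [measurable]: "cball (0::'a) M \<in> sets borel" by simp
  have hb: "\<bar>h n x\<bar> \<le> C" for n x using C(1) by (auto simp: h_def)
  have "(\<lambda>n. \<integral>x. \<bar>u x - h n x\<bar> * indicator (cball 0 M) x \<partial>lborel) \<longlonglongrightarrow> (\<integral>x. 0 \<partial>(lborel :: 'a measure))"
  proof (rule integral_dominated_convergence[where w = "\<lambda>x. 2 * C * indicator (cball 0 M) x"])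
    show "AE x in lborel. (\<lambda>n. \<bar>u x - h n x\<bar> * indicator (cball 0 M) x) \<longlonglongrightarrow> 0"
      using AE_lborel_negligible[OF N]
    proof eventually_elim
      fix x assume "x \<notin> N"
      show "(\<lambda>n. \<bar>u x - h n x\<bar> * indicator (cball 0 M) x) \<longlonglongrightarrow> 0"
      proof (cases "norm x \<le> M")
        case True
        then have "u x = max (- C) (min C (u x))" using C(2)[OF True] by auto
        moreover have "(\<lambda>n. h n x) \<longlonglongrightarrow> max (- C) (min C (u x))" unfolding h_def by (intro tendsto_intros lim \<open>x \<notin> N\<close>)
        ultimately have "(\<lambda>n. h n x) \<longlonglongrightarrow> u x" by simp
        then have "(\<lambda>n. \<bar>u x - h n x\<bar> * indicator (cball 0 M) x) \<longlonglongrightarrow> \<bar>u x - u x\<bar> * indicator (cball 0 M) x" by (intro tendsto_intros)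
        then show ?thesis by simp
      qed simp
    qed
    show "AE x in lborel. norm (\<bar>u x - h n x\<bar> * indicator (cball 0 M) x) \<le> 2 * C * indicator (cball 0 M) x" for n
    proof (rule AE_I2)
      fix x show "norm (\<bar>u x - h n x\<bar> * indicator (cball 0 M) x) \<le> 2 * C * indicator (cball 0 M) x"
        using C(2)[of x] hb[of n x] by (auto simp: indicator_def)
    qed
  qed (simp_all only: integrable_cball_const, simp_all)
  then have "eventually (\<lambda>n. (LBINT x. \<bar>u x - h n x\<bar> * indicator (cball 0 M) x) < e) sequentially"
    using e by (intro order_tendstoD(2)[where a = e]) auto
  then obtain n where n: "(LBINT x. \<bar>u x - h n x\<bar> * indicator (cball 0 M) x) < e"
    using eventually_happens trivial_limit_sequentially by blast
  have int: "integrable lborel (\<lambda>x. \<bar>u x - h n x\<bar> * indicator (cball 0 M) x)"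
  proof (rule integrable_bounded_support[where M = M and B = "2 * C"])
    fix x show "\<bar>\<bar>u x - h n x\<bar> * indicator (cball 0 M) x\<bar> \<le> 2 * C"
      using C(1) C(2)[of x] hb[of n x] by (auto simp: indicator_def)
  qed auto
  have "(\<integral>\<^sup>+x. ennreal (\<bar>u x - h n x\<bar>) * indicator (cball 0 M) x \<partial>lborel)
     = (\<integral>\<^sup>+x. ennreal (\<bar>u x - h n x\<bar> * indicator (cball 0 M) x) \<partial>lborel)"
    by (intro nn_integral_cong) (auto simp: indicator_def)
  also have "\<dots> = ennreal (LBINT x. \<bar>u x - h n x\<bar> * indicator (cball 0 M) x)"
    by (intro nn_integral_eq_integral int) auto
  also have "\<dots> \<le> ennreal e" using n by (intro ennreal_leI) simp
  finally show ?thesis using that hc by blast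
qed

lemma nn_integral_conv_kern:
  fixes d :: "'a::euclidean_space \<Rightarrow> ennreal"
  assumes [measurable]: "d \<in> borel_measurable borel" and s: "s > 0"
  shows "(\<integral>\<^sup>+x. (\<integral>\<^sup>+y. d y * ennreal (kern s (x - y)) \<partial>lborel) \<partial>lborel) = (\<integral>\<^sup>+y. d y \<partial>lborel)"
proof -
  have "(\<integral>\<^sup>+x. (\<integral>\<^sup>+y. d y * ennreal (kern s (x - y)) \<partial>lborel) \<partial>lborel)
     = (\<integral>\<^sup>+y. (\<integral>\<^sup>+x. d y * ennreal (kern s (x - y)) \<partial>lborel) \<partial>lborel)"
    by (rule lborel_pair.Fubini') measurable
  also have "\<dots> = (\<integral>\<^sup>+y. d y * (\<integral>\<^sup>+x. ennreal (kern s (x - y)) \<partial>lborel) \<partial>lborel)"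
    by (intro nn_integral_cong nn_integral_cmult) measurable
  also have "\<dots> = (\<integral>\<^sup>+y. d y * 1 \<partial>lborel)"
  proof (intro nn_integral_cong arg_cong2[where f = "(*)"] refl)
    fix y :: 'a
    have "(\<integral>\<^sup>+x. ennreal (kern s (x - y)) \<partial>lborel) = (\<integral>\<^sup>+x. ennreal (kern s (0 - x :: 'a)) \<partial>lborel)"
      using nn_integral_affine[of "\<lambda>x. ennreal (kern s (x - y))" "-1" y] by simp
    also have "\<dots> = ennreal (LBINT x. kern s (0 - x :: 'a))"
      by (intro nn_integral_eq_integral kern_integrable s) (simp add: kern_nonneg s)
    finally show "(\<integral>\<^sup>+x. ennreal (kern s (x - y)) \<partial>lborel) = 1" using kern_integral[OF s, of "0::'a"] by simp
  qed
  finally show ?thesis by simp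
qed

text \<open>Replace \<open>u\<close> by a continuous \<open>g\<close> that is close to it in \<open>L\<^sup>1\<close>.  For \<open>g\<close> the error is controlled by uniform continuity, and
  convolution with a kernel of mass one does not increase the \<open>L\<^sup>1\<close> distance between \<open>u\<close> and \<open>g\<close>.\<close>
lemma conv_kern_L1:
  fixes u :: "'a::euclidean_space \<Rightarrow> real"
  assumes [measurable]: "u \<in> borel_measurable borel" and u: "locally_bounded u" and e: "e > 0"
  obtains s0 where "0 < s0" "s0 \<le> 1"
    "\<And>s. 0 < s \<Longrightarrow> s \<le> s0 \<Longrightarrow> (\<integral>\<^sup>+x. ennreal (\<bar>conv u (kern s) x - u x\<bar>) * indicator (cball 0 M) x \<partial>lborel) \<le> ennreal e"
proof -
  define vol where "vol = measure lborel (cball (0::'a) M)"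
  have vol: "emeasure lborel (cball (0::'a) M) = ennreal vol" "vol \<ge> 0"
    unfolding vol_def using emeasure_bounded_finite[of "cball (0::'a) M"]
    by (auto intro!: emeasure_eq_ennreal_measure)
  define \<eta> where "\<eta> = e / (2 * (vol + 1))"
  have \<eta>: "\<eta> > 0" using e vol by (simp add: \<eta>_def)
  have \<eta>v: "\<eta> * vol \<le> e / 2" using e vol by (simp add: \<eta>_def field_simps)
  obtain g where g: "continuous_on UNIV g" and gu: "(\<integral>\<^sup>+x. ennreal (\<bar>u x - g x\<bar>) * indicator (cball 0 (M + 1)) x \<partial>lborel) \<le> ennreal (e / 4)"
    using ex_continuous_approx[OF assms(1) u, of "e / 4" "M + 1"] e by auto
  have [measurable]: "g \<in> borel_measurable borel" using g by (rule borel_measurable_continuous_onI)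
  have "uniformly_continuous_on (cball 0 (M + 1)) g"
    using g by (intro compact_uniformly_continuous continuous_on_subset[OF g]) auto
  then obtain \<delta> where \<delta>: "\<delta> > 0" "\<And>x y. norm x \<le> M + 1 \<Longrightarrow> norm y \<le> M + 1 \<Longrightarrow> dist y x < \<delta> \<Longrightarrow> dist (g y) (g x) < \<eta>"
    unfolding uniformly_continuous_on_def using \<eta> by (metis mem_cball_0)
  have [measurable]: "cball (0::'a) (M + 1) \<in> sets borel" by simp
  \<comment> \<open>The error is cut off on the ball of radius \<open>M + 1\<close>, which contains the support of the kernel around each point of \<open>cball 0 M\<close>.\<close>
  define d where "d y = ennreal \<bar>u y - g y\<bar> * indicator (cball 0 (M + 1)) y" for y
  have [measurable]: "d \<in> borel_measurable borel" unfolding d_def[abs_def] by measurable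
  show ?thesis
  proof (rule that[of "min 1 (\<delta> / 2)"])
    fix s assume s: "0 < s" "s \<le> min 1 (\<delta> / 2)"
    have pw: "ennreal \<bar>conv u (kern s) x - u x\<bar> \<le> (\<integral>\<^sup>+y. d y * ennreal (kern s (x - y)) \<partial>lborel) + ennreal \<eta> + d x"
      if x: "norm x \<le> M" for x
    proof -
      have near: "norm y \<le> M + 1 \<and> \<bar>g y - g x\<bar> \<le> \<eta>" if "kern s (x - y) \<noteq> 0" for y
      proof -
        have "norm (x - y) < s" using kern_support[OF s(1), of "x - y"] that by force
        moreover have "norm y \<le> norm x + norm (x - y)" using norm_triangle_ineq4[of x "x - y"] by simp
        ultimately show ?thesis using \<delta>(2)[of x y] x s \<delta>(1) by (auto simp: dist_norm norm_minus_commute)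
      qed
      have "conv u (kern s) x - u x = (LBINT y. (u y - u x) * kern s (x - y))"
        unfolding conv_def left_diff_distrib
        using kern_integral[OF s(1), of x]
        by (subst Bochner_Integration.integral_diff) (auto intro!: conv_integrable u kern_test s integrable_mult_right kern_integrable)
      also have "ennreal \<bar>\<dots>\<bar> \<le> (\<integral>\<^sup>+y. ennreal \<bar>(u y - u x) * kern s (x - y)\<bar> \<partial>lborel)"
        using integral_norm_bound_ennreal[of lborel "\<lambda>y. (u y - u x) * kern s (x - y)"]
        by (simp add: left_diff_distrib Bochner_Integration.integrable_diff conv_integrable u kern_test s integrable_mult_right kern_integrable)
      also have "\<dots> \<le> (\<integral>\<^sup>+y. d y * ennreal (kern s (x - y)) + (ennreal \<eta> + d x) * ennreal (kern s (x - y)) \<partial>lborel)"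
      proof (rule nn_integral_mono)
        fix y
        show "ennreal \<bar>(u y - u x) * kern s (x - y)\<bar> \<le> d y * ennreal (kern s (x - y)) + (ennreal \<eta> + d x) * ennreal (kern s (x - y))"
        proof (cases "kern s (x - y) = 0")
          case False
          then have n: "norm y \<le> M + 1" "\<bar>g y - g x\<bar> \<le> \<eta>" using near by auto
          have "\<bar>u y - u x\<bar> \<le> \<bar>u y - g y\<bar> + \<eta> + \<bar>u x - g x\<bar>" using n(2) by linarith
          then have "\<bar>(u y - u x) * kern s (x - y)\<bar> \<le> (\<bar>u y - g y\<bar> + (\<eta> + \<bar>u x - g x\<bar>)) * kern s (x - y)"
            using kern_nonneg[OF s(1), of "x - y"] by (simp add: abs_mult mult_right_mono)
          then have "ennreal \<bar>(u y - u x) * kern s (x - y)\<bar> \<le> ennreal ((\<bar>u y - g y\<bar> + (\<eta> + \<bar>u x - g x\<bar>)) * kern s (x - y))"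
            by (rule ennreal_leI)
          also have "\<dots> = (ennreal \<bar>u y - g y\<bar> + (ennreal \<eta> + ennreal \<bar>u x - g x\<bar>)) * ennreal (kern s (x - y))"
            using \<eta> kern_nonneg[OF s(1), of "x - y"] by (simp add: ennreal_mult ennreal_plus)
          also have "\<dots> = d y * ennreal (kern s (x - y)) + (ennreal \<eta> + d x) * ennreal (kern s (x - y))"
            using n x by (simp add: d_def distrib_right)
          finally show ?thesis .
        qed simp
      qed
      also have "\<dots> = (\<integral>\<^sup>+y. d y * ennreal (kern s (x - y)) \<partial>lborel) + (ennreal \<eta> + d x) * (\<integral>\<^sup>+y. ennreal (kern s (x - y)) \<partial>lborel)"
        by (simp add: nn_integral_add nn_integral_cmult)
      also have "(\<integral>\<^sup>+y. ennreal (kern s (x - y)) \<partial>lborel) = 1"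
        using kern_integral[OF s(1), of x] by (subst nn_integral_eq_integral) (auto intro!: kern_integrable s kern_nonneg)
      finally show ?thesis by (simp add: add.assoc)
    qed
    have "(\<integral>\<^sup>+x. ennreal (\<bar>conv u (kern s) x - u x\<bar>) * indicator (cball 0 M) x \<partial>lborel)
      \<le> (\<integral>\<^sup>+x. (\<integral>\<^sup>+y. d y * ennreal (kern s (x - y)) \<partial>lborel) + ennreal \<eta> * indicator (cball 0 M) x + d x \<partial>lborel)"
    proof (rule nn_integral_mono)
      fix x
      show "ennreal (\<bar>conv u (kern s) x - u x\<bar>) * indicator (cball 0 M) x
         \<le> (\<integral>\<^sup>+y. d y * ennreal (kern s (x - y)) \<partial>lborel) + ennreal \<eta> * indicator (cball 0 M) x + d x"
        using pw[of x] by (cases "norm x \<le> M") (auto simp: indicator_def)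
    qed
    also have "\<dots> = (\<integral>\<^sup>+y. d y \<partial>lborel) + ennreal \<eta> * ennreal vol + (\<integral>\<^sup>+y. d y \<partial>lborel)"
    proof -
      have [measurable]: "cball (0::'a) M \<in> sets borel" by simp
      have [measurable]: "(\<lambda>x. \<integral>\<^sup>+y. d y * ennreal (kern s (x - y)) \<partial>lborel) \<in> borel_measurable borel"
        by measurable
      show ?thesis
        by (simp add: nn_integral_add nn_integral_conv_kern s nn_integral_cmult nn_integral_cmult_indicator vol)
    qed
    also have "\<dots> \<le> ennreal (e / 4) + ennreal (e / 2) + ennreal (e / 4)"
    proof (intro add_mono)
      show "(\<integral>\<^sup>+y. d y \<partial>lborel) \<le> ennreal (e / 4)" using gu by (simp add: d_def)
      then show "(\<integral>\<^sup>+y. d y \<partial>lborel) \<le> ennreal (e / 4)" .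
      show "ennreal \<eta> * ennreal vol \<le> ennreal (e / 2)" using \<eta>v \<eta> vol by (simp flip: ennreal_mult add: ennreal_leI)
    qed
    also have "\<dots> = ennreal e" using e by (simp flip: ennreal_plus)
    finally show "(\<integral>\<^sup>+x. ennreal (\<bar>conv u (kern s) x - u x\<bar>) * indicator (cball 0 M) x \<partial>lborel) \<le> ennreal e" .
  qed (use \<delta> in auto)
qed

text \<open>Two functions are mollified along a common sequence of scales, because the Carleman estimate below needs the convergence of a
  solution and of its source at the same time.\<close>
lemma conv_kern_AE2:
  fixes u f :: "'a::euclidean_space \<Rightarrow> real"
  assumes [measurable]: "u \<in> borel_measurable borel" "f \<in> borel_measurable borel"
    and u: "locally_bounded u" and f: "locally_bounded f"
  obtains s :: "nat \<Rightarrow> real" where "\<And>j. s j > 0" "\<And>j. s j \<le> 1" "s \<longlonglongrightarrow> 0"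
    "AE x in lborel. norm x \<le> M \<longrightarrow> (\<lambda>j. conv u (kern (s j)) x) \<longlonglongrightarrow> u x \<and> (\<lambda>j. conv f (kern (s j)) x) \<longlonglongrightarrow> f x"
proof -
  define err where "err v s = (\<integral>\<^sup>+x. ennreal (\<bar>conv v (kern s) x - v x\<bar>) * indicator (cball 0 M) x \<partial>lborel)"
    for v :: "'a \<Rightarrow> real" and s
  define P where "P s (j::nat) \<longleftrightarrow> 0 < s \<and> s \<le> inverse (real (Suc j)) \<and>
    err u s \<le> ennreal (inverse (real (Suc j))) \<and> err f s \<le> ennreal (inverse (real (Suc j)))" for s j
  have "\<exists>s. P s j" for j
  proof -
    have pos: "inverse (real (Suc j)) > 0" by simp
    obtain s0 where s0: "0 < s0" "\<And>s. 0 < s \<Longrightarrow> s \<le> s0 \<Longrightarrow> err u s \<le> ennreal (inverse (real (Suc j)))"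
      using conv_kern_L1[OF assms(1) u pos, of M] unfolding err_def by blast
    obtain s1 where s1: "0 < s1" "\<And>s. 0 < s \<Longrightarrow> s \<le> s1 \<Longrightarrow> err f s \<le> ennreal (inverse (real (Suc j)))"
      using conv_kern_L1[OF assms(2) f pos, of M] unfolding err_def by blast
    have "P (min (min s0 s1) (inverse (real (Suc j)))) j" using s0 s1 by (simp add: P_def)
    then show ?thesis ..
  qed
  then obtain s where s: "\<And>j. P (s j) j" by metis
  have sp: "s j > 0" for j using s by (simp add: P_def)
  have [measurable]: "conv u (kern (s j)) \<in> borel_measurable borel" "conv f (kern (s j)) \<in> borel_measurable borel" for j
    by (rule borel_measurable_continuous_onI conv_continuous[OF assms(1) u kern_test[OF sp]]
         conv_continuous[OF assms(2) f kern_test[OF sp]])+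
  have [measurable]: "cball (0::'a) M \<in> sets borel" by simp
  define F where "F j x = (\<bar>conv u (kern (s j)) x - u x\<bar> + \<bar>conv f (kern (s j)) x - f x\<bar>) * indicator (cball 0 M) x" for j x
  have [measurable]: "F j \<in> borel_measurable borel" for j unfolding F_def[abs_def] by measurable
  have nF: "(\<integral>\<^sup>+x. ennreal (norm (F j x)) \<partial>lborel) \<le> ennreal (2 * inverse (real (Suc j)))" for j
  proof -
    have "(\<integral>\<^sup>+x. ennreal (norm (F j x)) \<partial>lborel) = (\<integral>\<^sup>+x. ennreal (\<bar>conv u (kern (s j)) x - u x\<bar>) * indicator (cball 0 M) x
         + ennreal (\<bar>conv f (kern (s j)) x - f x\<bar>) * indicator (cball 0 M) x \<partial>lborel)"
      by (intro nn_integral_cong) (auto simp: F_def indicator_def)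
    also have "\<dots> = err u (s j) + err f (s j)" unfolding err_def by (rule nn_integral_add) measurable
    also have "\<dots> \<le> ennreal (inverse (real (Suc j))) + ennreal (inverse (real (Suc j)))"
      using s[of j] unfolding P_def by (intro add_mono) auto
    also have "\<dots> = ennreal (2 * inverse (real (Suc j)))" by (subst ennreal_plus[symmetric]) auto
    finally show ?thesis .
  qed
  have Fi: "integrable lborel (F j)" for j
    unfolding integrable_iff_bounded using nF[of j] by (auto intro: le_less_trans)
  have Fn: "(LBINT x. norm (F j x)) \<le> 2 * inverse (real (Suc j))" for j
  proof -
    have "ennreal (LBINT x. norm (F j x)) = (\<integral>\<^sup>+x. ennreal (norm (F j x)) \<partial>lborel)"
      using Fi[of j] by (intro nn_integral_eq_integral[symmetric] integrable_norm) auto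
    then have "ennreal (LBINT x. norm (F j x)) \<le> ennreal (2 * inverse (real (Suc j)))" using nF[of j] by (simp only:)
    then show ?thesis by (rule ennreal_le_iff[THEN iffD1, rotated]) simp
  qed
  have "(\<lambda>j. 2 * inverse (real (Suc j))) \<longlonglongrightarrow> 2 * 0" by (intro tendsto_intros LIMSEQ_inverse_real_of_nat)
  then have l2: "(\<lambda>j. 2 * inverse (real (Suc j))) \<longlonglongrightarrow> 0" by simp
  have "(\<lambda>j. \<integral>x. norm (F j x) \<partial>lborel) \<longlonglongrightarrow> 0"
    by (rule tendsto_sandwich[OF _ _ tendsto_const l2]) (use Fn in auto)
  from tendsto_L1_AE_subseq[OF Fi this] obtain r :: "nat \<Rightarrow> nat" where r: "strict_mono r"
    and ae: "AE x in lborel. (\<lambda>j. F (r j) x) \<longlonglongrightarrow> 0" by auto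
  have "s \<longlonglongrightarrow> 0"
    by (rule tendsto_sandwich[OF _ _ tendsto_const LIMSEQ_inverse_real_of_nat])
       (use s in \<open>auto simp: P_def intro!: always_eventually less_imp_le\<close>)
  show ?thesis
  proof (rule that[of "s \<circ> r"])
    show "(s \<circ> r) \<longlonglongrightarrow> 0" using \<open>s \<longlonglongrightarrow> 0\<close> r by (rule LIMSEQ_subseq_LIMSEQ)
    show "(s \<circ> r) j > 0" for j using sp by simp
    have "s j \<le> inverse (real (Suc j))" for j using s by (simp add: P_def)
    moreover have "inverse (real (Suc j)) \<le> 1" for j by (simp add: divide_simps)
    ultimately show "(s \<circ> r) j \<le> 1" for j by (metis comp_apply order_trans)
    show "AE x in lborel. norm x \<le> M \<longrightarrow> (\<lambda>j. conv u (kern ((s \<circ> r) j)) x) \<longlonglongrightarrow> u x \<and> (\<lambda>j. conv f (kern ((s \<circ> r) j)) x) \<longlonglongrightarrow> f x"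
      using ae
    proof eventually_elim
      fix x assume l: "(\<lambda>j. F (r j) x) \<longlonglongrightarrow> 0"
      show "norm x \<le> M \<longrightarrow> (\<lambda>j. conv u (kern ((s \<circ> r) j)) x) \<longlonglongrightarrow> u x \<and> (\<lambda>j. conv f (kern ((s \<circ> r) j)) x) \<longlonglongrightarrow> f x"
      proof (intro impI conjI)
        assume "norm x \<le> M"
        then have F: "F j x = \<bar>conv u (kern (s j)) x - u x\<bar> + \<bar>conv f (kern (s j)) x - f x\<bar>" for j by (simp add: F_def)
        have "(\<lambda>j. conv u (kern (s (r j))) x - u x) \<longlonglongrightarrow> 0" "(\<lambda>j. conv f (kern (s (r j))) x - f x) \<longlonglongrightarrow> 0"
          by (rule Lim_null_comparison[OF _ l], simp add: F)+
        then show "(\<lambda>j. conv u (kern ((s \<circ> r) j)) x) \<longlonglongrightarrow> u x" "(\<lambda>j. conv f (kern ((s \<circ> r) j)) x) \<longlonglongrightarrow> f x"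
          by (simp_all add: LIM_zero_iff)
      qed
    qed
  qed
qed

lemma conv_kern_AE:
  fixes u :: "'a::euclidean_space \<Rightarrow> real"
  assumes "u \<in> borel_measurable borel" "locally_bounded u"
  obtains s :: "nat \<Rightarrow> real" where "\<And>j. s j > 0" "s \<longlonglongrightarrow> 0"
    "AE x in lborel. norm x \<le> M \<longrightarrow> (\<lambda>j. conv u (kern (s j)) x) \<longlonglongrightarrow> u x"
proof (rule conv_kern_AE2[OF assms(1,1,2,2), of M])
  fix s :: "nat \<Rightarrow> real"
  assume "\<And>j. s j > 0" "s \<longlonglongrightarrow> 0"
    "AE x in lborel. norm x \<le> M \<longrightarrow> (\<lambda>j. conv u (kern (s j)) x) \<longlonglongrightarrow> u x \<and> (\<lambda>j. conv u (kern (s j)) x) \<longlonglongrightarrow> u x"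
  then show ?thesis using that[of s] by simp
qed

section \<open>Positivity of superharmonic functions\<close>

lemma weak_poissonD:
  assumes "weak_poisson u f"
  shows "u \<in> borel_measurable borel" "locally_bounded u" "f \<in> borel_measurable borel" "locally_bounded f"
  using assms by (auto simp: weak_poisson_def)

text \<open>By the monotonicity of mollifications, \<open>u z\<close> is at least its weighted mean over the ball of radius \<open>3 d\<close> around \<open>z\<close>.  This ball
  contains \<open>ball x d\<close> with room to spare, so the weight is bounded below there and the mean is at least a multiple of the integral
  of \<open>u\<close> over \<open>ball x d\<close>.\<close>
lemma superharmonic_pos_locally:
  fixes u :: "'a::euclidean_space \<Rightarrow> real"
  assumes uf: "weak_poisson u f" and d: "d > 0"
    and nn: "\<And>y. dist x y < 4 * d \<Longrightarrow> u y \<ge> 0" "\<And>y. dist x y < 4 * d \<Longrightarrow> f y \<ge> 0"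
    and nz: "\<not> (AE y in lborel. y \<in> ball x d \<longrightarrow> u y = 0)"
  shows "\<exists>m>0. AE z in lborel. z \<in> ball x d \<longrightarrow> u z \<ge> m"
proof -
  note u = weak_poissonD(1,2)[OF uf]
  have [measurable]: "u \<in> borel_measurable borel" by (rule u)
  have [measurable]: "ball x d \<in> sets borel" by simp
  let ?k = "kern (3 * d) :: 'a \<Rightarrow> real"
  have d3: "3 * d > 0" using d by simp
  have kpos: "?k w > 0" if "norm w \<le> 2 * d" for w
  proof -
    have "(norm w)\<^sup>2 \<le> (2 * d)\<^sup>2" using that by (intro power_mono) auto
    also have "\<dots> < (3 * d)\<^sup>2" using d by (simp add: power2_eq_square)
    finally have "(norm w)\<^sup>2 < (3 * d)\<^sup>2" .
    then have "1 - (w \<bullet> w) / (3 * d)\<^sup>2 > 0" using d by (simp add: dot_square_norm)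
    from flat_pos(2)[OF this] show ?thesis using d mass_pos[where 'a = 'a] by (simp add: kern_def bump_def)
  qed
  have "\<exists>w0\<in>cball (0::'a) (2 * d). \<forall>w\<in>cball 0 (2 * d). ?k w0 \<le> ?k w"
    using d by (intro continuous_attains_inf test_function_continuous kern_test) auto
  then obtain w0 :: 'a where w0: "norm w0 \<le> 2 * d" "\<And>w :: 'a. norm w \<le> 2 * d \<Longrightarrow> ?k w0 \<le> ?k w" by auto
  define c where "c = ?k w0"
  have c: "c > 0" "\<And>w :: 'a. norm w \<le> 2 * d \<Longrightarrow> c \<le> ?k w" using kpos w0 by (auto simp: c_def)
  obtain C where C: "C \<ge> 0" "\<And>y. norm y \<le> norm x + d \<Longrightarrow> \<bar>u y\<bar> \<le> C" using locally_boundedD[OF u(2)] by blast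
  define v where "v y = u y * indicator (ball x d) y" for y
  have in_ball: "norm y \<le> norm x + d" if "y \<in> ball x d" for y
    using that norm_triangle_ineq2[of y x] by (auto simp: dist_norm norm_minus_commute)
  have vi: "integrable lborel v"
  proof (rule integrable_bounded_support[where M = "norm x + d" and B = C])
    show "v \<in> borel_measurable borel" unfolding v_def[abs_def] by measurable
    fix y show "\<bar>v y\<bar> \<le> C" using C in_ball[of y] by (auto simp: v_def indicator_def)
    show "v y = 0" if "norm x + d < norm y" using that in_ball[of y] by (force simp: v_def indicator_def)
  qed
  have v0: "v y \<ge> 0" for y using nn(1)[of y] d by (auto simp: v_def indicator_def)
  define m where "m = c * (LBINT y. v y)"
  have "(LBINT y. v y) \<noteq> 0"
  proof
    assume "(LBINT y. v y) = 0"
    then have "AE y in lborel. v y = 0" using integral_nonneg_eq_0_iff_AE[OF vi] v0 by simp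
    then have "AE y in lborel. y \<in> ball x d \<longrightarrow> u y = 0" by eventually_elim (auto simp: v_def)
    with nz show False ..
  qed
  moreover have "(LBINT y. v y) \<ge> 0" using v0 by (intro integral_nonneg_AE) auto
  ultimately have m: "m > 0" using c by (simp add: m_def)
  have low: "conv u ?k z \<ge> m" if z: "z \<in> ball x d" for z
  proof -
    have "m = (LBINT y. c * v y)" by (simp add: m_def)
    also have "\<dots> \<le> conv u ?k z" unfolding conv_def
    proof (rule integral_mono)
      fix y
      show "c * v y \<le> u y * ?k (z - y)"
      proof (cases "y \<in> ball x d")
        case True
        then have "norm (z - y) \<le> 2 * d" using z dist_triangle[of z y x] by (auto simp: dist_norm norm_minus_commute)
        from c(2)[OF this] True v0[of y] show ?thesis
          by (simp add: v_def mult.commute[of c] mult_left_mono)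
      next
        case False
        have "u y * ?k (z - y) \<ge> 0"
        proof (cases "norm (z - y) \<ge> 3 * d")
          case True then show ?thesis using d kern_support[of "3 * d" "z - y"] by simp
        next
          case False2: False
          then have "dist x y < 4 * d" using z dist_triangle[of x y z] by (auto simp: dist_norm norm_minus_commute)
          then show ?thesis using nn(1) d by (simp add: kern_nonneg)
        qed
        with False show ?thesis by (simp add: v_def)
      qed
    qed (auto intro!: vi conv_integrable u kern_test d3)
    finally show ?thesis .
  qed
  have mono: "conv u (kern s) z \<ge> m" if z: "z \<in> ball x d" and s: "0 < s" "s \<le> 3 * d" for z s
  proof -
    have f: "f y \<ge> 0" if "dist z y < 3 * d" for y
      using nn(2)[of y] z that dist_triangle[of x y z] by (auto simp: dist_commute)
    have "conv u ?k z \<le> conv u (kern s) z" by (rule conv_kern_antimono[OF uf s f])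
    with low[OF z] show ?thesis by linarith
  qed
  obtain s :: "nat \<Rightarrow> real" where s: "\<And>j. s j > 0" "s \<longlonglongrightarrow> 0"
    and ae: "AE z in lborel. norm z \<le> norm x + d \<longrightarrow> (\<lambda>j. conv u (kern (s j)) z) \<longlonglongrightarrow> u z"
    using conv_kern_AE[OF u] by blast
  have ev: "eventually (\<lambda>j. s j < 3 * d) sequentially" using s(2) d by (intro order_tendstoD(2)) auto
  have "AE z in lborel. z \<in> ball x d \<longrightarrow> u z \<ge> m"
    using ae
  proof eventually_elim
    fix z assume a: "norm z \<le> norm x + d \<longrightarrow> (\<lambda>j. conv u (kern (s j)) z) \<longlonglongrightarrow> u z"
    show "z \<in> ball x d \<longrightarrow> u z \<ge> m"
    proof
      assume z: "z \<in> ball x d"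
      with a in_ball have l: "(\<lambda>j. conv u (kern (s j)) z) \<longlonglongrightarrow> u z" by blast
      show "u z \<ge> m"
        by (rule tendsto_lowerbound[OF l]) (use ev mono[OF z] s(1) in \<open>auto elim!: eventually_mono\<close>)
    qed
  qed
  with m show ?thesis by blast
qed

lemma AE_notin_open: 
  fixes B :: "'a::euclidean_space set"
  assumes "open B" "AE y in lborel. y \<notin> B" shows "B = {}"
proof -
  have "B \<in> null_sets lborel" using assms AE_iff_null_sets[of B lborel] by auto
  then have "negligible B" by (simp add: negligible_iff_null_sets null_sets_completionI)
  then show ?thesis using open_not_negligible assms by blast
qed

text \<open>A measure theoretic strong minimum principle.  By \<open>superharmonic_pos_locally\<close> every point of the exterior region has a neighbourhood
  on which \<open>u\<close> either vanishes or is bounded below by a positive constant.  Both kinds of points form open sets; the exterior of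
  a ball is connected in dimension at least two, so that only one kind occurs.\<close>
lemma superharmonic_pos_on_compact:
  fixes u :: "'a::euclidean_space \<Rightarrow> real"
  assumes uf: "weak_poisson u f" and dim: "DIM('a) \<ge> 2"
    and nn: "\<And>y. norm y > \<rho> \<Longrightarrow> u y \<ge> 0" "\<And>y. norm y > \<rho> \<Longrightarrow> f y \<ge> 0"
    and nz: "\<not> (AE y in lborel. norm y > \<rho> \<longrightarrow> u y = 0)"
    and K: "compact K" "\<And>y. y \<in> K \<Longrightarrow> norm y > \<rho>"
  shows "\<exists>m>0. AE y in lborel. y \<in> K \<longrightarrow> u y \<ge> m"
proof -
  define Z where "Z = {B. open B \<and> (AE y in lborel. y \<in> B \<longrightarrow> u y = 0)}"
  define P where "P = {B. open B \<and> (\<exists>m>0. AE y in lborel. y \<in> B \<longrightarrow> u y \<ge> m)}"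
  have om: "{y. norm y > \<rho>} = - cball (0::'a) \<rho>" by auto
  have con: "connected {y::'a. norm y > \<rho>}"
    unfolding om by (rule connected_complement_bounded_convex) (use dim in auto)
  have open': "open (\<Union>Z)" "open (\<Union>P)" by (auto simp: Z_def P_def)
  have disj: "\<Union>Z \<inter> \<Union>P \<inter> {y. norm y > \<rho>} = {}"
  proof -
    have "B \<inter> B' = {}" if B: "B \<in> Z" "B' \<in> P" for B B'
    proof (rule AE_notin_open)
      show "open (B \<inter> B')" using B by (auto simp: Z_def P_def)
      obtain m where "m > 0" and m: "AE y in lborel. y \<in> B' \<longrightarrow> u y \<ge> m" using B by (auto simp: P_def)
      have z: "AE y in lborel. y \<in> B \<longrightarrow> u y = 0" using B by (auto simp: Z_def)
      show "AE y in lborel. y \<notin> B \<inter> B'" using z m by eventually_elim (use \<open>m > 0\<close> in auto)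
    qed
    then show ?thesis by blast
  qed
  have cover: "{y. norm y > \<rho>} \<subseteq> \<Union>Z \<union> \<Union>P"
  proof
    fix x :: 'a assume "x \<in> {y. norm y > \<rho>}"
    then have x: "norm x > \<rho>" by simp
    define d where "d = (norm x - \<rho>) / 4"
    have d: "d > 0" using x by (simp add: d_def)
    have far: "norm y > \<rho>" if "dist x y < 4 * d" for y
      using that norm_triangle_ineq2[of x y] by (simp add: d_def dist_norm)
    have mem: "x \<in> ball x d" "open (ball x d)" using d by auto
    show "x \<in> \<Union>Z \<union> \<Union>P"
    proof (cases "AE y in lborel. y \<in> ball x d \<longrightarrow> u y = 0")
      case True
      then have "ball x d \<in> Z" by (simp add: Z_def)
      with mem show ?thesis by blast
    next
      case False
      have "\<exists>m>0. AE z in lborel. z \<in> ball x d \<longrightarrow> u z \<ge> m"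
        by (rule superharmonic_pos_locally[OF uf d _ _ False]) (use far nn in auto)
      then have "ball x d \<in> P" by (simp add: P_def)
      with mem show ?thesis by blast
    qed
  qed
  have "\<not> {y. norm y > \<rho>} \<subseteq> \<Union>Z"
  proof
    assume sub: "{y. norm y > \<rho>} \<subseteq> \<Union>Z"
    obtain Z' where Z': "Z' \<subseteq> Z" "countable Z'" "\<Union>Z' = \<Union>Z"
      using Lindelof[of Z] by (auto simp: Z_def)
    have "AE y in lborel. \<forall>B\<in>Z'. y \<in> B \<longrightarrow> u y = 0"
      using Z' by (subst AE_ball_countable) (auto simp: Z_def)
    then have "AE y in lborel. norm y > \<rho> \<longrightarrow> u y = 0"
      by eventually_elim (use sub Z' in blast)
    with nz show False ..
  qed
  with cover have "\<Union>P \<inter> {y. norm y > \<rho>} \<noteq> {}" by blast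
  with connectedD[OF con open' disj cover] have "\<Union>Z \<inter> {y. norm y > \<rho>} = {}" by blast
  with cover K(2) have "K \<subseteq> \<Union>P" by blast
  with K(1) obtain P' where P': "P' \<subseteq> P" "finite P'" "K \<subseteq> \<Union>P'"
    by (rule compactE) (auto simp: P_def)
  have "\<forall>B\<in>P'. \<exists>m>0. AE y in lborel. y \<in> B \<longrightarrow> u y \<ge> m" using P' by (auto simp: P_def)
  then obtain \<mu> where \<mu>: "\<And>B. B \<in> P' \<Longrightarrow> \<mu> B > 0" "\<And>B. B \<in> P' \<Longrightarrow> AE y in lborel. y \<in> B \<longrightarrow> u y \<ge> \<mu> B" 
    by metis
  define m where "m = Min (insert 1 (\<mu> ` P'))"
  have m: "m > 0" "\<And>B. B \<in> P' \<Longrightarrow> m \<le> \<mu> B" using P' \<mu> by (auto simp: m_def)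
  have "AE y in lborel. \<forall>B\<in>P'. y \<in> B \<longrightarrow> u y \<ge> \<mu> B"
    using \<mu>(2) P'(2) by (simp add: AE_finite_allI)
  then have "AE y in lborel. y \<in> K \<longrightarrow> u y \<ge> m"
  proof eventually_elim
    fix y assume "\<forall>B\<in>P'. y \<in> B \<longrightarrow> u y \<ge> \<mu> B"
    with P'(3) m(2) show "y \<in> K \<longrightarrow> u y \<ge> m" by (meson UnionE order_trans subsetD)
  qed
  with m show ?thesis by blast
qed

section \<open>A lower bound at infinity\<close>

lemma DERIV2_nonneg_at_local_min:
  fixes g :: "real \<Rightarrow> real"
  assumes e: "e > 0" and g: "\<And>t. \<bar>t\<bar> < e \<Longrightarrow> (g has_real_derivative g1 t) (at t)"
    and g1: "(g1 has_real_derivative D) (at 0)" and min: "\<And>t. \<bar>t\<bar> < e \<Longrightarrow> g 0 \<le> g t"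
  shows "D \<ge> 0"
proof (rule ccontr)
  assume "\<not> D \<ge> 0"
  then obtain d where d: "d > 0" "\<And>h. 0 < h \<Longrightarrow> h < d \<Longrightarrow> g1 (0 + h) < g1 0"
    using DERIV_neg_dec_right[OF g1] by auto
  have z: "g1 0 = 0" by (rule DERIV_local_min[OF g e]) (use e min in auto)
  define h where "h = min d e / 2"
  have h: "h > 0" "h < d" "h < e" using d e by (auto simp: h_def)
  obtain z where z': "0 < z" "z < h" "g h - g 0 = (h - 0) * g1 z"
    using MVT2[of 0 h g g1] h g by auto
  then have "g h - g 0 < 0" using d(2)[of z] h z by (simp add: mult_pos_neg)
  with min[of h] h show False by simp
qed

lemma sum_inner_Basis_power2: "(\<Sum>b\<in>Basis. (x \<bullet> b)\<^sup>2) = x \<bullet> (x::'a::euclidean_space)"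
  using sum_inner_Basis_square[of x] by (simp add: power2_eq_square)

text \<open>Comparison with the barrier \<open>m (\<bar>x\<bar> / \<rho>1)\<^bsup>-(n - 2 + \<delta>)\<^esup>\<close>.  The extra exponent \<open>\<delta> > 0\<close> makes the barrier strictly
  subharmonic, and makes it decay at infinity even for \<open>n = 2\<close>; the extra constant \<open>\<kappa>\<close> then dominates it on large spheres.  A
  negative minimum of the difference would thus be attained at an interior point, where the Laplacian of the difference is negative:
  this contradicts the second derivative test.\<close>
lemma conv_kern_lower_bound:
  fixes u :: "'a::euclidean_space \<Rightarrow> real"
  assumes uf: "weak_poisson u f" and rho: "0 < \<rho>" "\<rho> < \<rho>1"
    and nn: "\<And>y. norm y > \<rho> \<Longrightarrow> u y \<ge> 0" "\<And>y. norm y > \<rho> \<Longrightarrow> f y \<ge> 0"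
    and m: "m > 0" "AE y in lborel. \<bar>norm y - \<rho>1\<bar> \<le> \<rho>1 - \<rho> \<longrightarrow> u y \<ge> m"
    and s: "0 < s" "s < \<rho>1 - \<rho>" and x: "norm x0 \<ge> \<rho>1" and \<kappa>: "\<kappa> > 0" and \<delta>: "\<delta> > 0" and dim: "DIM('a) \<ge> 2"
  shows "conv u (kern s) x0 + \<kappa> \<ge> m * ((x0 \<bullet> x0) / \<rho>1\<^sup>2) powr (- (real DIM('a) - 2 + \<delta>) / 2)"
proof (rule ccontr)
  define p where "p = real DIM('a) - 2 + \<delta>"
  define \<alpha> where "\<alpha> = - p / 2"
  have p: "p > 0" using dim \<delta> by (simp add: p_def)
  have [measurable]: "u \<in> borel_measurable borel" by (rule weak_poissonD[OF uf])
  note u = weak_poissonD(1,2)[OF uf]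
  note k = kern_test[OF s(1), where 'a = 'a]
  define w where "w = conv u (kern s)"
  define \<beta> where "\<beta> x = m * ((x \<bullet> x) / \<rho>1\<^sup>2) powr \<alpha>" for x :: 'a
  define G where "G x = w x + \<kappa> - \<beta> x" for x
  assume "\<not> conv u (kern s) x0 + \<kappa> \<ge> m * ((x0 \<bullet> x0) / \<rho>1\<^sup>2) powr (- (real DIM('a) - 2 + \<delta>) / 2)"
  then have neg: "G x0 < 0" by (simp add: G_def w_def \<beta>_def \<alpha>_def p_def)
  have near: "norm y > \<rho>" if "norm (x - y) < s" "norm x \<ge> \<rho>1" for x y :: 'a
    using that s norm_triangle_ineq2[of x y] by linarith
  have kern_near: "norm (x - y) < s" if "kern s (x - y) \<noteq> 0" for x y :: 'a
    using kern_support[OF s(1), of "x - y"] that by force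
  have w0: "w x \<ge> 0" if "norm x \<ge> \<rho>1" for x
    unfolding w_def by (rule conv_nonneg[OF kern_nonneg[OF s(1)]]) (use that near[OF kern_near] nn(1) in blast)
  have f0: "conv f (kern s) x \<ge> 0" if "norm x \<ge> \<rho>1" for x
    by (rule conv_nonneg[OF kern_nonneg[OF s(1)]]) (use that near[OF kern_near] nn(2) in blast)
  have wm: "w x \<ge> m" if "norm x = \<rho>1" for x
  proof -
    have "m = (LBINT y. m * kern s (x - y))" by (simp add: kern_integral[OF s(1)])
    also have "\<dots> \<le> w x" unfolding w_def conv_def
    proof (rule integral_mono_AE)
      show "AE y in lborel. m * kern s (x - y) \<le> u y * kern s (x - y)"
        using m(2)
      proof eventually_elim
        fix y assume a: "\<bar>norm y - \<rho>1\<bar> \<le> \<rho>1 - \<rho> \<longrightarrow> u y \<ge> m"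
        show "m * kern s (x - y) \<le> u y * kern s (x - y)"
        proof (cases "kern s (x - y) = 0")
          case False
          then have "\<bar>norm y - \<rho>1\<bar> \<le> \<rho>1 - \<rho>"
            using kern_near[OF False] that s norm_triangle_ineq3[of x y] by linarith
          with a show ?thesis by (intro mult_right_mono) (auto simp: kern_nonneg s)
        qed simp
      qed
    qed (auto intro!: conv_integrable u k integrable_mult_right kern_integrable s)
    finally show ?thesis .
  qed
  obtain M where M: "M > norm x0" "m * (M\<^sup>2 / \<rho>1\<^sup>2) powr \<alpha> \<le> \<kappa>"
  proof -
    have "((\<lambda>M. m * (M\<^sup>2 / \<rho>1\<^sup>2) powr \<alpha>) \<longlongrightarrow> m * 0) at_top"
    proof (intro tendsto_mult tendsto_const tendsto_neg_powr)
      show "\<alpha> < 0" using p by (simp add: \<alpha>_def)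
      show "filterlim (\<lambda>M. M\<^sup>2 / \<rho>1\<^sup>2) at_top at_top"
      proof -
        have "filterlim (\<lambda>M::real. inverse (\<rho>1\<^sup>2) * M\<^sup>2) at_top at_top"
          by (rule filterlim_tendsto_pos_mult_at_top[OF tendsto_const _ filterlim_pow_at_top[OF _ filterlim_ident]])
             (use rho in auto)
        then show ?thesis by (simp add: divide_inverse mult.commute)
      qed
    qed
    then have "eventually (\<lambda>M. m * (M\<^sup>2 / \<rho>1\<^sup>2) powr \<alpha> < \<kappa>) at_top" using \<kappa> by (intro order_tendstoD(2)) auto
    then have "eventually (\<lambda>M. norm x0 < M \<and> m * (M\<^sup>2 / \<rho>1\<^sup>2) powr \<alpha> < \<kappa>) at_top"
      by (intro eventually_conj eventually_gt_at_top)
    then obtain M where "norm x0 < M \<and> m * (M\<^sup>2 / \<rho>1\<^sup>2) powr \<alpha> < \<kappa>"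
      using eventually_happens trivial_limit_at_top_linorder by blast
    then show ?thesis by (intro that) auto
  qed
  define A where "A = cball (0::'a) M - ball 0 \<rho>1"
  have A: "compact A" unfolding A_def by (intro compact_diff) auto
  have x0A: "x0 \<in> A" using x M by (simp add: A_def)
  have wc: "continuous_on A w" 
    unfolding w_def using conv_continuous[OF u k] continuous_on_subset by blast
  have "continuous_on A G" unfolding G_def \<beta>_def
    by (intro continuous_intros wc) (use rho in \<open>auto simp: A_def\<close>)
  with A x0A obtain x1 where x1: "x1 \<in> A" "\<And>y. y \<in> A \<Longrightarrow> G x1 \<le> G y"
    using continuous_attains_inf[of A G] by blast
  have "G x1 < 0" using x1(2)[OF x0A] neg by simp
  have "norm x1 \<noteq> \<rho>1"
  proof
    assume "norm x1 = \<rho>1"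
    then have "\<beta> x1 = m" using rho by (simp add: \<beta>_def dot_square_norm)
    with wm[OF \<open>norm x1 = \<rho>1\<close>] \<kappa> \<open>G x1 < 0\<close> show False by (simp add: G_def)
  qed
  moreover have "norm x1 \<noteq> M"
  proof
    assume "norm x1 = M"
    then have "\<beta> x1 \<le> \<kappa>" using M by (simp add: \<beta>_def dot_square_norm)
    with w0[of x1] x1(1) \<open>G x1 < 0\<close> show False by (simp add: G_def A_def)
  qed
  ultimately have inner: "\<rho>1 < norm x1" "norm x1 < M" using x1(1) by (auto simp: A_def)
  define e where "e = min (norm x1 - \<rho>1) (M - norm x1)"
  have e: "e > 0" using inner by (simp add: e_def)
  define m' where "m' = m / (\<rho>1\<^sup>2) powr \<alpha>"
  have m': "m' > 0" using m rho by (simp add: m'_def)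
  define q where "q = x1 \<bullet> x1"
  have q: "q > 0" unfolding q_def using inner rho by (auto simp: dot_square_norm)
  have \<beta>': "\<beta> y = m' * (y \<bullet> y) powr \<alpha>" for y using rho by (simp add: \<beta>_def m'_def powr_divide)
  \<comment> \<open>\<open>D b\<close> is the second derivative of \<open>G\<close> at \<open>x1\<close> in the direction \<open>b\<close>.\<close>
  define D where "D b = conv u (partial_deriv b (partial_deriv b (kern s))) x1
       - m' * (\<alpha> * ((\<alpha> - 1) * q powr (\<alpha> - 2) * (2 * (x1 \<bullet> b))\<^sup>2 + 2 * q powr (\<alpha> - 1)))" for b
  have "D b \<ge> 0" if b: "b \<in> Basis" for b
  proof (rule DERIV2_nonneg_at_local_min[OF e])
    let ?q = "\<lambda>t. (x1 + t *\<^sub>R b) \<bullet> (x1 + t *\<^sub>R b)"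
    have inA: "x1 + t *\<^sub>R b \<in> A" if "\<bar>t\<bar> < e" for t
      using that b norm_triangle_ineq[of x1 "t *\<^sub>R b"] norm_triangle_ineq2[of x1 "- (t *\<^sub>R b)"] 
      by (auto simp: A_def e_def)
    show "G (x1 + 0 *\<^sub>R b) \<le> G (x1 + t *\<^sub>R b)" if "\<bar>t\<bar> < e" for t using x1(2) inA[OF that] by simp
    have dq: "(?q has_real_derivative 2 * ((x1 + t *\<^sub>R b) \<bullet> b)) (at t)" for t
      by (auto intro!: derivative_eq_intros simp: has_field_derivative_def inner_commute algebra_simps)
    have qpos: "?q t > 0" if "\<bar>t\<bar> < e" for t
      using inA[OF that] rho by (auto simp: A_def dot_square_norm)
    have dp: "((\<lambda>t. ?q t powr a) has_real_derivative a * ?q t powr (a - 1) * (2 * ((x1 + t *\<^sub>R b) \<bullet> b))) (at t)" if "\<bar>t\<bar> < e" for t a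
      by (rule DERIV_chain2[OF has_real_derivative_powr[OF qpos[OF that]] dq])
    show "((\<lambda>t. G (x1 + t *\<^sub>R b)) has_real_derivative
       conv u (partial_deriv b (kern s)) (x1 + t *\<^sub>R b) - m' * (\<alpha> * ?q t powr (\<alpha> - 1) * (2 * ((x1 + t *\<^sub>R b) \<bullet> b)))) (at t)"
      if "\<bar>t\<bar> < e" for t
    proof -
      have "((\<lambda>t. (w (x1 + t *\<^sub>R b) + \<kappa>) - m' * ?q t powr \<alpha>) has_real_derivative
         (conv u (partial_deriv b (kern s)) (x1 + t *\<^sub>R b) + 0) - m' * (\<alpha> * ?q t powr (\<alpha> - 1) * (2 * ((x1 + t *\<^sub>R b) \<bullet> b)))) (at t)"
        unfolding w_def
        by (rule DERIV_diff[OF DERIV_add[OF conv_DERIV[OF u k b] DERIV_const] DERIV_cmult[OF dp[OF that]]])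
      then show ?thesis by (simp add: G_def \<beta>')
    qed
    have dl: "((\<lambda>t. 2 * ((x1 + t *\<^sub>R b) \<bullet> b)) has_real_derivative 2) (at 0)"
      using b by (auto intro!: derivative_eq_intros simp: inner_add_left inner_same_Basis)
    have "((\<lambda>t. conv u (partial_deriv b (kern s)) (x1 + t *\<^sub>R b) - m' * (\<alpha> * (?q t powr (\<alpha> - 1) * (2 * ((x1 + t *\<^sub>R b) \<bullet> b)))))
      has_real_derivative conv u (partial_deriv b (partial_deriv b (kern s))) (x1 + 0 *\<^sub>R b)
        - m' * (\<alpha> * (((\<alpha> - 1) * ?q 0 powr (\<alpha> - 1 - 1) * (2 * ((x1 + 0 *\<^sub>R b) \<bullet> b))) * (2 * ((x1 + 0 *\<^sub>R b) \<bullet> b))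
            + 2 * ?q 0 powr (\<alpha> - 1)))) (at 0)"
      by (rule DERIV_diff[OF conv_DERIV[OF u test_function_partial_deriv[OF k b] b] DERIV_cmult[OF DERIV_cmult[OF DERIV_mult[OF dp dl]]]])
         (use e in auto)
    then show "((\<lambda>t. conv u (partial_deriv b (kern s)) (x1 + t *\<^sub>R b) - m' * (\<alpha> * ?q t powr (\<alpha> - 1) * (2 * ((x1 + t *\<^sub>R b) \<bullet> b))))
      has_real_derivative D b) (at 0)"
      by (simp add: D_def q_def power2_eq_square mult.assoc)
  qed
  then have "(\<Sum>b\<in>Basis. D b) \<ge> 0" by (intro sum_nonneg) auto
  moreover have "(\<Sum>b\<in>Basis. D b) < 0"
  proof -
    have "(\<Sum>b\<in>Basis. D b) = conv u (laplacian (kern s)) x1 -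
       (\<Sum>b\<in>Basis. m' * \<alpha> * (\<alpha> - 1) * q powr (\<alpha> - 2) * 4 * (x1 \<bullet> b)\<^sup>2 + m' * \<alpha> * 2 * q powr (\<alpha> - 1))"
      unfolding D_def sum_subtractf conv_laplacian_sum[OF u k]
      by (simp add: algebra_simps power2_eq_square)
    also have "\<dots> = conv u (laplacian (kern s)) x1 -
       (m' * \<alpha> * (\<alpha> - 1) * q powr (\<alpha> - 2) * 4 * q + DIM('a) * (m' * \<alpha> * 2 * q powr (\<alpha> - 1)))"
      by (simp add: sum.distrib sum_distrib_left[symmetric] sum_inner_Basis_power2 q_def)
    also have "q powr (\<alpha> - 2) = q powr (\<alpha> - 1) / q"
      using q by (simp add: powr_diff power2_eq_square powr_numeral)
    also have "conv u (laplacian (kern s)) x1 = - conv f (kern s) x1"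
      by (rule conv_laplacian[OF uf k])
    also have "- conv f (kern s) x1 - (m' * \<alpha> * (\<alpha> - 1) * (q powr (\<alpha> - 1) / q) * 4 * q + DIM('a) * (m' * \<alpha> * 2 * q powr (\<alpha> - 1)))
       = - conv f (kern s) x1 - m' * q powr (\<alpha> - 1) * (p * \<delta>)"
    proof -
      \<comment> \<open>This is where the choice of the exponent enters: \<open>\<Delta> \<bar>x\<bar>\<^bsup>-p\<^esup> = p (p + 2 - n) \<bar>x\<bar>\<^bsup>-p-2\<^esup>\<close> with \<open>p + 2 - n = \<delta>\<close>.\<close>
      have "4 * \<alpha> * (\<alpha> - 1) + DIM('a) * (\<alpha> * 2) = p * \<delta>" by (simp add: \<alpha>_def p_def field_simps)
      then have "m' * q powr (\<alpha> - 1) * (4 * \<alpha> * (\<alpha> - 1) + DIM('a) * (\<alpha> * 2)) = m' * q powr (\<alpha> - 1) * (p * \<delta>)" by simp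
      then show ?thesis using q by (simp add: algebra_simps)
    qed
    also have "\<dots> < 0" using f0[of x1] inner m' q p \<delta> by (smt (verit) mult_pos_pos powr_gt_zero)
    finally show ?thesis .
  qed
  ultimately show False by simp
qed

text \<open>The previous bound is uniform in the scale \<open>s\<close>, in \<open>\<kappa>\<close> and in \<open>\<delta>\<close>; let all three tend to zero.  The comparison function is
  written with \<open>1 + \<bar>x\<bar>\<^sup>2\<close> in place of \<open>\<bar>x\<bar>\<^sup>2\<close> to agree with the test functions of the next part.\<close>
lemma superharmonic_lower_bound:
  fixes u :: "'a::euclidean_space \<Rightarrow> real"
  assumes uf: "weak_poisson u f" and dim: "DIM('a) \<ge> 2" and rho: "0 < \<rho>" "\<rho> < \<rho>1"
    and nn: "\<And>y. norm y > \<rho> \<Longrightarrow> u y \<ge> 0" "\<And>y. norm y > \<rho> \<Longrightarrow> f y \<ge> 0"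
    and nz: "\<not> (AE y in lborel. norm y > \<rho> \<longrightarrow> u y = 0)"
  shows "\<exists>c>0. AE x in lborel. norm x > \<rho>1 \<longrightarrow> u x \<ge> c * (1 + x \<bullet> x) powr ((2 - real DIM('a)) / 2)"
proof -
  define \<rho>2 where "\<rho>2 = (\<rho> + \<rho>1) / 2"
  have rho2: "\<rho> < \<rho>2" "\<rho>2 < \<rho>1" using rho by (auto simp: \<rho>2_def)
  define K where "K = cball (0::'a) (2 * \<rho>1) - ball 0 \<rho>2"
  have "compact K" unfolding K_def by (intro compact_diff) auto
  then obtain m where m: "m > 0" "AE y in lborel. y \<in> K \<longrightarrow> u y \<ge> m"
    using superharmonic_pos_on_compact[OF uf dim nn nz, of K] rho2 by (auto simp: K_def)
  have m2: "AE y in lborel. \<bar>norm y - \<rho>1\<bar> \<le> \<rho>1 - \<rho>2 \<longrightarrow> u y \<ge> m"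
    using m(2) by eventually_elim (use rho rho2 in \<open>auto simp: K_def\<close>)
  let ?a = "(2 - real DIM('a)) / 2"
  have low: "conv u (kern s) x \<ge> m * ((x \<bullet> x) / \<rho>1\<^sup>2) powr ?a" if s: "0 < s" "s < \<rho>1 - \<rho>2" and x: "norm x \<ge> \<rho>1" for s x
  proof -
    have "norm x > 0" using x rho by linarith
    then have xp: "(x \<bullet> x) / \<rho>1\<^sup>2 > 0" using rho by (simp add: dot_square_norm)
    have L: "(\<lambda>k. conv u (kern s) x + inverse (real (Suc k))) \<longlonglongrightarrow> conv u (kern s) x + 0"
      by (intro tendsto_intros LIMSEQ_inverse_real_of_nat)
    have "(\<lambda>k. m * ((x \<bullet> x) / \<rho>1\<^sup>2) powr (- (real DIM('a) - 2 + inverse (real (Suc k))) / 2))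
       \<longlonglongrightarrow> m * ((x \<bullet> x) / \<rho>1\<^sup>2) powr (- (real DIM('a) - 2 + 0) / 2)"
      using xp by (intro tendsto_intros LIMSEQ_inverse_real_of_nat) auto
    from LIMSEQ_le[OF this L]
    show ?thesis using conv_kern_lower_bound[OF uf _ rho2(2) _ _ m(1) m2 s x _ _ dim] rho rho2 nn by simp
  qed
  define c where "c = m / (\<rho>1\<^sup>2) powr ?a"
  have c: "c > 0" using m rho by (simp add: c_def)
  have cx: "m * ((x \<bullet> x) / \<rho>1\<^sup>2) powr ?a \<ge> c * (1 + x \<bullet> x) powr ?a" if "norm x > \<rho>1" for x :: 'a
  proof -
    have "(1 + x \<bullet> x) powr ?a \<le> (x \<bullet> x) powr ?a"
      using that rho dim by (intro powr_mono2') (auto simp: dot_square_norm)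
    then show ?thesis using c rho by (simp add: c_def powr_divide field_simps)
  qed
  have bnd: "AE x in lborel. norm x \<le> real M \<longrightarrow> norm x > \<rho>1 \<longrightarrow> u x \<ge> c * (1 + x \<bullet> x) powr ?a" for M :: nat
  proof -
    obtain s :: "nat \<Rightarrow> real" where s: "\<And>j. s j > 0" "s \<longlonglongrightarrow> 0"
      and ae: "AE z in lborel. norm z \<le> real M \<longrightarrow> (\<lambda>j. conv u (kern (s j)) z) \<longlonglongrightarrow> u z"
      using conv_kern_AE[OF weak_poissonD(1,2)[OF uf]] by blast
    have ev: "eventually (\<lambda>j. s j < \<rho>1 - \<rho>2) sequentially" using s(2) rho2 by (intro order_tendstoD(2)) auto
    show ?thesis using ae
    proof eventually_elim
      fix x assume a: "norm x \<le> real M \<longrightarrow> (\<lambda>j. conv u (kern (s j)) x) \<longlonglongrightarrow> u x"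
      show "norm x \<le> real M \<longrightarrow> norm x > \<rho>1 \<longrightarrow> u x \<ge> c * (1 + x \<bullet> x) powr ?a"
      proof (intro impI)
        assume x: "norm x \<le> real M" "norm x > \<rho>1"
        have "u x \<ge> m * ((x \<bullet> x) / \<rho>1\<^sup>2) powr ?a"
          by (rule tendsto_lowerbound[OF a[rule_format, OF x(1)]]) (use ev low x s(1) in \<open>auto elim!: eventually_mono\<close>)
        with cx[OF x(2)] show "u x \<ge> c * (1 + x \<bullet> x) powr ?a" by linarith
      qed
    qed
  qed
  have "AE x in lborel. \<forall>M::nat. norm x \<le> real M \<longrightarrow> norm x > \<rho>1 \<longrightarrow> u x \<ge> c * (1 + x \<bullet> x) powr ?a"
    using bnd by (subst AE_all_countable) blast
  then have "AE x in lborel. norm x > \<rho>1 \<longrightarrow> u x \<ge> c * (1 + x \<bullet> x) powr ?a"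
    by eventually_elim (use real_arch_simple in blast)
  with c show ?thesis by blast
qed

section \<open>Finiteness of a weighted integral of the source\<close>

lemma two_power_square: "(2 ^ k)\<^sup>2 = (4::real) ^ k"
  by (simp add: power2_eq_square power_mult_distrib[symmetric])

lemma powr_nonpos_le_one: "(v::real) \<ge> 1 \<Longrightarrow> b \<le> 0 \<Longrightarrow> v powr b \<le> 1"
  using powr_mono[of b 0 v] by simp

text \<open>Sum over dyadic annuli: on \<open>2\<^sup>k < \<bar>x\<bar> \<le> 2\<^bsup>k+1\<^esup>\<close> the integrand is at most \<open>2\<^bsup>2kb\<^esup>\<close>, and the volume is at most a constant
  times \<open>2\<^bsup>n(k+1)\<^esup>\<close>.\<close>
lemma nn_integral_power_cball:
  fixes b :: real
  defines "g \<equiv> \<lambda>x::'a::euclidean_space. ennreal ((1 + x \<bullet> x) powr b)"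
  assumes b: "b \<le> 0"
  shows "(\<integral>\<^sup>+x. g x * indicator (cball 0 (2 ^ k)) x \<partial>lborel)
     \<le> ennreal (unit_ball_vol DIM('a) * (1 + 2 ^ DIM('a) * (\<Sum>i<k. (2 powr (DIM('a) + 2 * b)) ^ i)))"
proof (induction k)
  case 0
  have "(\<integral>\<^sup>+x. g x * indicator (cball 0 1) x \<partial>lborel) \<le> (\<integral>\<^sup>+x. 1 * indicator (cball (0::'a) 1) x \<partial>lborel)"
  proof (intro nn_integral_mono mult_right_mono)
    fix x :: 'a
    have "(1 + x \<bullet> x) powr b \<le> 1" using b by (intro powr_nonpos_le_one) auto
    then show "g x \<le> 1" by (simp add: g_def)
  qed auto
  then show ?case by (simp add: emeasure_cball)
next
  case (Suc k)
  let ?B = "\<lambda>k. cball (0::'a) (2 ^ k)"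
  define w where "w = unit_ball_vol (real DIM('a))"
  have w: "w \<ge> 0" by (simp add: w_def)
  have "(\<integral>\<^sup>+x. g x * indicator (?B (Suc k)) x \<partial>lborel)
     \<le> (\<integral>\<^sup>+x. g x * indicator (?B k) x + ennreal ((4 ^ k) powr b) * indicator (?B (Suc k)) x \<partial>lborel)"
  proof (rule nn_integral_mono)
    fix x :: 'a
    show "g x * indicator (?B (Suc k)) x \<le> g x * indicator (?B k) x + ennreal ((4 ^ k) powr b) * indicator (?B (Suc k)) x"
    proof (cases "norm x \<le> 2 ^ k")
      case False
      then have "(2 ^ k)\<^sup>2 \<le> (norm x)\<^sup>2" by (intro power_mono) auto
      then have "4 ^ k \<le> 1 + x \<bullet> x" by (simp add: dot_square_norm two_power_square)
      then have "(1 + x \<bullet> x) powr b \<le> (4 ^ k) powr b" using b by (intro powr_mono2') auto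
      with False show ?thesis by (auto simp: g_def indicator_def intro!: ennreal_leI)
    qed (auto simp: indicator_def)
  qed
  also have "\<dots> = (\<integral>\<^sup>+x. g x * indicator (?B k) x \<partial>lborel) + ennreal ((4 ^ k) powr b) * emeasure lborel (?B (Suc k))"
  proof -
    have [measurable]: "?B k \<in> sets borel" "?B (Suc k) \<in> sets borel" by simp_all
    have [measurable]: "g \<in> borel_measurable borel" unfolding g_def by measurable
    have "(\<integral>\<^sup>+x. g x * indicator (?B k) x + ennreal ((4 ^ k) powr b) * indicator (?B (Suc k)) x \<partial>lborel)
       = (\<integral>\<^sup>+x. g x * indicator (?B k) x \<partial>lborel) + (\<integral>\<^sup>+x. ennreal ((4 ^ k) powr b) * indicator (?B (Suc k)) x \<partial>lborel)"
      by (rule nn_integral_add) measurable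
    also have "(\<integral>\<^sup>+x. ennreal ((4 ^ k) powr b) * indicator (?B (Suc k)) x \<partial>lborel) = ennreal ((4 ^ k) powr b) * emeasure lborel (?B (Suc k))"
      by (rule nn_integral_cmult_indicator) simp
    finally show ?thesis .
  qed
  also have "\<dots> \<le> ennreal (w * (1 + 2 ^ DIM('a) * (\<Sum>i<k. (2 powr (DIM('a) + 2 * b)) ^ i))) +
      ennreal (w * (2 ^ DIM('a) * (2 powr (DIM('a) + 2 * b)) ^ k))"
  proof (intro add_mono)
    have "(4::real) ^ k = 2 powr (2 * k)" by (simp add: powr_powr[symmetric] powr_realpow[symmetric])
    moreover have "(2 ^ Suc k :: real) ^ DIM('a) = 2 powr ((1 + real k) * DIM('a))"
      unfolding power_mult[symmetric] by (subst powr_realpow[symmetric]) (auto simp: algebra_simps)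
    ultimately have "(4 ^ k) powr b * (w * (2 ^ Suc k) ^ DIM('a)) = w * (2 powr (2 * real k * b) * 2 powr ((1 + real k) * DIM('a)))"
      by (simp add: powr_powr)
    also have "\<dots> = w * (2 powr DIM('a) * 2 powr (k * (DIM('a) + 2 * b)))"
    proof -
      have "2 * real k * b + (1 + real k) * real DIM('a) = real DIM('a) + real k * (real DIM('a) + 2 * b)" by (simp add: algebra_simps)
      then show ?thesis by (simp only: powr_add[symmetric])
    qed
    also have "\<dots> = w * (2 ^ DIM('a) * (2 powr (DIM('a) + 2 * b)) ^ k)"
      by (simp add: powr_realpow[symmetric] powr_powr mult.commute)
    finally have "(4 ^ k) powr b * (w * (2 ^ Suc k) ^ DIM('a)) = w * (2 ^ DIM('a) * (2 powr (DIM('a) + 2 * b)) ^ k)" .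
    then show "ennreal ((4 ^ k) powr b) * emeasure lborel (?B (Suc k)) \<le> ennreal (w * (2 ^ DIM('a) * (2 powr (DIM('a) + 2 * b)) ^ k))"
      by (simp only: emeasure_cball zero_le_power w_def[symmetric] zero_le_numeral ennreal_mult[symmetric] powr_ge_zero
            mult_nonneg_nonneg w order_refl)
  qed (use Suc in \<open>simp add: w_def\<close>)
  also have "\<dots> = ennreal (w * (1 + 2 ^ DIM('a) * (\<Sum>i<Suc k. (2 powr (DIM('a) + 2 * b)) ^ i)))"
    using w by (subst ennreal_plus[symmetric]) (auto simp: algebra_simps sum_nonneg)
  finally show ?case by (simp add: w_def)
qed

text \<open>For \<open>a = (2 - n) / 2\<close> the first factor is a smooth version of the fundamental solution \<open>\<bar>x\<bar>\<^bsup>2-n\<^esup>\<close>; the second one cuts it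
  off at radius \<open>T\<close> without needing a plateau.\<close>
definition trunc_potential :: "real \<Rightarrow> real \<Rightarrow> 'a::euclidean_space \<Rightarrow> real" where
  "trunc_potential a T x = (1 + x \<bullet> x) powr a * flat 0 (1 - (1 + x \<bullet> x) / T\<^sup>2)"

lemma Ck_trunc_potential: "Ck k (trunc_potential a T)"
proof -
  define h where "h j v = (\<Prod>i<j. a - real i) * v powr (a - real j)" for j v
  have h: "(h j has_real_derivative h (Suc j) v) (at v)" if "v \<in> {0<..}" for j v
  proof -
    have "((\<lambda>v. v powr (a - real j)) has_real_derivative (a - real j) * v powr (a - real j - 1)) (at v)"
      using that by (intro has_real_derivative_powr) auto
    moreover have "h j = (\<lambda>v. (\<Prod>i<j. a - real i) * v powr (a - real j))" by (auto simp: h_def)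
    ultimately show ?thesis using DERIV_cmult[of "\<lambda>v. v powr (a - real j)" _ v UNIV "\<Prod>i<j. a - real i"]
      by (simp add: h_def diff_diff_add add.commute mult.assoc)
  qed
  have 1: "Ck k (\<lambda>x::'a. h 0 (1 * ((x - 0) \<bullet> (x - 0)) + 1))"
    by (rule Ck_compose[where h = h and S = "{0<..}", OF h])
       (auto intro: add_nonneg_pos Ck_quadratic[of _ 1 0 1, simplified])
  have 2: "Ck k (\<lambda>x::'a. flat 0 (- (1 / T\<^sup>2) * ((x - 0) \<bullet> (x - 0)) + (1 - 1 / T\<^sup>2)))"
    by (rule Ck_compose[where h = flat and S = UNIV, OF flat_deriv UNIV_I Ck_quadratic])
  show ?thesis using Ck_mult[OF 1 2]
    by (simp add: h_def trunc_potential_def[abs_def] add.commute add_divide_distrib algebra_simps)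
qed

lemma trunc_potential_support: "T > 0 \<Longrightarrow> norm x > T \<Longrightarrow> trunc_potential a T x = 0"
proof -
  assume T: "T > 0" "norm x > T"
  then have "T\<^sup>2 \<le> (norm x)\<^sup>2" by (intro power_mono) auto
  then have "T\<^sup>2 \<le> 1 + x \<bullet> x" by (simp add: dot_square_norm)
  then have "1 - (1 + x \<bullet> x) / T\<^sup>2 \<le> 0" using T by (simp add: field_simps)
  then show ?thesis by (simp add: trunc_potential_def flat_0)
qed

lemma trunc_potential_test: "T > 0 \<Longrightarrow> test_function (trunc_potential a T)"
  by (rule test_functionI[where M = T]) (auto intro: Ck_trunc_potential trunc_potential_support)

text \<open>For this value of \<open>a\<close> the two contributions of order \<open>v\<^bsup>a-1\<^esup>\<close> in the Laplacian of \<open>v\<^sup>a\<close> cancel, which leaves a term of the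
  integrable order \<open>v\<^bsup>a-2\<^esup>\<close>.\<close>
lemma laplacian_trunc_potential:
  assumes T: "T > 0" and a: "a = (2 - real DIM('a)) / 2"
  shows "laplacian (trunc_potential a T) (x::'a::euclidean_space) =
    (let v = 1 + x \<bullet> x in - 4 * a * (a - 1) * v powr (a - 2) * flat 0 (1 - v / T\<^sup>2)
      - (2 * real DIM('a) + 8 * a * ((v - 1) / v)) * (v powr a / T\<^sup>2) * flat 1 (1 - v / T\<^sup>2)
      + 4 * ((v - 1) / T\<^sup>2) * (v powr a / T\<^sup>2) * flat 2 (1 - v / T\<^sup>2))"
proof -
  define \<tau> where "\<tau> = T\<^sup>2"
  have \<tau>: "\<tau> > 0" using T by (simp add: \<tau>_def)
  define h where "h v = v powr a * flat 0 (1 - v / \<tau>)" for v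
  define h1 where "h1 v = a * v powr (a - 1) * flat 0 (1 - v / \<tau>) - v powr a * flat (Suc 0) (1 - v / \<tau>) / \<tau>" for v
  define h2 where "h2 v = a * (a - 1) * v powr (a - 2) * flat 0 (1 - v / \<tau>) 
      - 2 * a * v powr (a - 1) * flat (Suc 0) (1 - v / \<tau>) / \<tau> + v powr a * flat (Suc (Suc 0)) (1 - v / \<tau>) / (\<tau> * \<tau>)" for v
  have f: "((\<lambda>v. flat j (1 - v / \<tau>)) has_real_derivative flat (Suc j) (1 - v / \<tau>) * (- 1 / \<tau>)) (at v)" for j v
    by (rule DERIV_chain2[OF flat_deriv]) (use \<tau> in \<open>auto intro!: derivative_eq_intros\<close>)
  have p: "((\<lambda>v. v powr b) has_real_derivative b * v powr (b - 1)) (at v)" if "v > 0" for b v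
    using that by (rule has_real_derivative_powr)
  have d1: "(h has_real_derivative h1 v) (at v)" if "v > 0" for v
    unfolding h_def h1_def by (rule DERIV_cong[OF DERIV_mult[OF p[OF that] f]]) (simp add: algebra_simps)
  have d2: "(h1 has_real_derivative h2 v) (at v)" if "v > 0" for v
    unfolding h1_def h2_def
    by (rule DERIV_cong[OF DERIV_diff[OF DERIV_mult[OF DERIV_cmult[OF p[OF that]] f] DERIV_cdivide[OF DERIV_mult[OF p[OF that] f]]]])
       (use \<tau> in \<open>simp add: field_simps power2_eq_square numeral_eq_Suc\<close>)
  define v where "v = 1 + x \<bullet> x"
  have v: "v > 0" unfolding v_def by (rule add_pos_nonneg) auto
  have pos: "1 * ((y - 0) \<bullet> (y - 0)) + 1 > 0" for y :: 'a by (rule add_nonneg_pos) auto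
  have c: "trunc_potential a T = (\<lambda>x::'a. h (1 * ((x - 0) \<bullet> (x - 0)) + 1))"
    by (auto simp: trunc_potential_def h_def \<tau>_def add.commute)
  have "laplacian (trunc_potential a T) x = 2 * 1 * real DIM('a) * h1 (1 * ((x - 0) \<bullet> (x - 0)) + 1) 
     + 4 * 1\<^sup>2 * ((x - 0) \<bullet> (x - 0)) * h2 (1 * ((x - 0) \<bullet> (x - 0)) + 1)"
    unfolding c by (rule laplacian_radial[OF d1[OF pos] d2[OF pos]])
  then have L: "laplacian (trunc_potential a T) x = 2 * real DIM('a) * h1 v + 4 * (v - 1) * h2 v" by (simp add: v_def add.commute)
  have n: "real DIM('a) = 2 - 2 * a" by (simp add: a field_simps)
  have e1: "v powr (a - 1) = v powr (a - 2) * v" using v powr_mult_base[of v "a - 2"] by (simp add: mult.commute)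
  have e2: "v powr (a - 1) = v powr a / v" using v by (simp add: powr_diff)
  have "2 * real DIM('a) * (a * v powr (a - 1)) + 4 * (v - 1) * (a * (a - 1) * v powr (a - 2)) = - 4 * a * (a - 1) * v powr (a - 2)"
    unfolding n e1 by (simp add: algebra_simps)
  then have g0: "(2 * real DIM('a) * (a * v powr (a - 1)) + 4 * (v - 1) * (a * (a - 1) * v powr (a - 2))) * F = - 4 * a * (a - 1) * v powr (a - 2) * F" for F by simp
  show ?thesis
    unfolding L Let_def \<tau>_def[symmetric] v_def[symmetric] g0[symmetric] h1_def h2_def e2
    using \<tau> v by (simp add: field_simps power2_eq_square numeral_eq_Suc)
qed

lemma flat_bounded: "\<exists>B\<ge>0. \<forall>t\<le>1. \<bar>flat j t\<bar> \<le> B"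
proof -
  have "bounded (flat j ` {0..1})"
    by (intro compact_imp_bounded compact_continuous_image flat_continuous) auto
  then obtain B where B: "\<forall>y\<in>flat j ` {0..1}. \<bar>y\<bar> \<le> B" unfolding bounded_iff by auto
  have "\<bar>flat j t\<bar> \<le> max 0 B" if "t \<le> 1" for t
  proof (cases "t \<le> 0")
    case False
    then have "flat j t \<in> flat j ` {0..1}" using that by auto
    then have "\<bar>flat j t\<bar> \<le> B" using B by blast
    then show ?thesis by simp
  qed (simp add: flat_0)
  then show ?thesis by (intro exI[of _ "max 0 B"]) auto
qed

lemma abs_mult_mid: "(y::real) \<ge> 0 \<Longrightarrow> \<bar>x * y * z\<bar> = \<bar>x\<bar> * (\<bar>z\<bar> * y)"
  by (simp add: abs_mult)

lemma laplacian_trunc_potential_bound: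
  assumes a: "a = (2 - real DIM('a)) / 2"
  shows "\<exists>C\<ge>0. \<forall>T>0. \<forall>x::'a::euclidean_space. \<bar>laplacian (trunc_potential a T) x\<bar>
     \<le> C * ((1 + x \<bullet> x) powr (a - 2) + (1 + x \<bullet> x) powr a / T\<^sup>2) * indicator (cball 0 T) x"
proof -
  obtain B0 where B0: "B0 \<ge> 0" "\<And>t. t \<le> 1 \<Longrightarrow> \<bar>flat 0 t\<bar> \<le> B0" using flat_bounded by blast
  obtain B1 where B1: "B1 \<ge> 0" "\<And>t. t \<le> 1 \<Longrightarrow> \<bar>flat 1 t\<bar> \<le> B1" using flat_bounded by blast
  obtain B2 where B2: "B2 \<ge> 0" "\<And>t. t \<le> 1 \<Longrightarrow> \<bar>flat 2 t\<bar> \<le> B2" using flat_bounded by blast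
  define C where "C = 4 * \<bar>a\<bar> * \<bar>a - 1\<bar> * B0 + (2 * real DIM('a) + 8 * \<bar>a\<bar>) * B1 + 4 * B2"
  have C: "C \<ge> 0" using B0 B1 B2 by (simp add: C_def)
  have "\<bar>laplacian (trunc_potential a T) x\<bar> \<le> C * ((1 + x \<bullet> x) powr (a - 2) + (1 + x \<bullet> x) powr a / T\<^sup>2) * indicator (cball 0 T) x"
    if T: "T > 0" for T and x :: 'a
  proof -
    define v where "v = 1 + x \<bullet> x"
    have v: "v \<ge> 1" by (simp add: v_def)
    note L = laplacian_trunc_potential[OF T a, of x, unfolded Let_def, folded v_def]
    show ?thesis
    proof (cases "v \<le> T\<^sup>2")
      case False
      then have z: "1 - v / T\<^sup>2 \<le> 0" using T by (simp add: field_simps)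
      have "laplacian (trunc_potential a T) x = 0" unfolding L by (simp add: flat_0[OF z])
      then show ?thesis using C by simp
    next
      case True
      then have "(norm x)\<^sup>2 \<le> T\<^sup>2" by (simp add: v_def dot_square_norm)
      then have ind: "indicator (cball 0 T) x = (1::real)" using T by (simp add: power2_le_iff_abs_le)
      have t: "1 - v / T\<^sup>2 \<le> 1" using v by simp
      have r1: "\<bar>(v - 1) / v\<bar> \<le> 1" using v by simp
      have r2: "\<bar>(v - 1) / T\<^sup>2\<bar> \<le> 1" using v True T by simp
      have p1: "\<bar>- 4 * a * (a - 1) * v powr (a - 2) * flat 0 (1 - v / T\<^sup>2)\<bar> \<le> (4 * \<bar>a\<bar> * \<bar>a - 1\<bar> * B0) * v powr (a - 2)"
      proof -
        have "\<bar>- 4 * a * (a - 1) * v powr (a - 2) * flat 0 (1 - v / T\<^sup>2)\<bar> = 4 * \<bar>a\<bar> * \<bar>a - 1\<bar> * v powr (a - 2) * \<bar>flat 0 (1 - v / T\<^sup>2)\<bar>"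
          unfolding abs_mult by simp
        also have "\<dots> \<le> 4 * \<bar>a\<bar> * \<bar>a - 1\<bar> * v powr (a - 2) * B0"
          by (intro mult_left_mono B0(2)[OF t]) auto
        finally show ?thesis by (simp only: mult_ac)
      qed
      have "\<bar>2 * real DIM('a) + 8 * a * ((v - 1) / v)\<bar> \<le> 2 * real DIM('a) + 8 * \<bar>a\<bar>"
        using mult_left_mono[OF r1, of "8 * \<bar>a\<bar>"] abs_triangle_ineq[of "2 * real DIM('a)" "8 * a * ((v - 1) / v)"] by (simp add: abs_mult)
      then have "\<bar>2 * real DIM('a) + 8 * a * ((v - 1) / v)\<bar> * (\<bar>flat 1 (1 - v / T\<^sup>2)\<bar> * (v powr a / T\<^sup>2)) \<le> (2 * real DIM('a) + 8 * \<bar>a\<bar>) * (B1 * (v powr a / T\<^sup>2))"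
        using B1(2)[OF t] by (intro mult_mono mult_right_mono) auto
      then have p2: "\<bar>(2 * real DIM('a) + 8 * a * ((v - 1) / v)) * (v powr a / T\<^sup>2) * flat 1 (1 - v / T\<^sup>2)\<bar> \<le> ((2 * real DIM('a) + 8 * \<bar>a\<bar>) * B1) * (v powr a / T\<^sup>2)"
        by (subst abs_mult_mid) (auto simp: mult.assoc)
      have "\<bar>(v - 1) / T\<^sup>2\<bar> * (\<bar>flat 2 (1 - v / T\<^sup>2)\<bar> * (v powr a / T\<^sup>2)) \<le> 1 * (B2 * (v powr a / T\<^sup>2))"
        using B2(2)[OF t] r2 by (intro mult_mono mult_right_mono) auto
      then have "4 * (\<bar>(v - 1) / T\<^sup>2\<bar> * (\<bar>flat 2 (1 - v / T\<^sup>2)\<bar> * (v powr a / T\<^sup>2))) \<le> (4 * B2) * (v powr a / T\<^sup>2)" by linarith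
      moreover have "\<bar>4 * ((v - 1) / T\<^sup>2) * (v powr a / T\<^sup>2) * flat 2 (1 - v / T\<^sup>2)\<bar>
          = 4 * (\<bar>(v - 1) / T\<^sup>2\<bar> * (\<bar>flat 2 (1 - v / T\<^sup>2)\<bar> * (v powr a / T\<^sup>2)))"
        by (subst abs_mult_mid, simp, simp only: abs_mult abs_numeral mult.assoc)
      ultimately have p3: "\<bar>4 * ((v - 1) / T\<^sup>2) * (v powr a / T\<^sup>2) * flat 2 (1 - v / T\<^sup>2)\<bar> \<le> (4 * B2) * (v powr a / T\<^sup>2)" by linarith
      have "\<bar>laplacian (trunc_potential a T) x\<bar> \<le> (4 * \<bar>a\<bar> * \<bar>a - 1\<bar> * B0) * v powr (a - 2)
          + ((2 * real DIM('a) + 8 * \<bar>a\<bar>) * B1) * (v powr a / T\<^sup>2) + (4 * B2) * (v powr a / T\<^sup>2)"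
        unfolding L using p1 p2 p3 by linarith
      also have "\<dots> \<le> C * v powr (a - 2) + C * (v powr a / T\<^sup>2)"
      proof -
        have "(4 * \<bar>a\<bar> * \<bar>a - 1\<bar> * B0) * v powr (a - 2) \<le> C * v powr (a - 2)"
          using B1 B2 by (intro mult_right_mono) (auto simp: C_def)
        moreover have "((2 * real DIM('a) + 8 * \<bar>a\<bar>) * B1 + 4 * B2) * (v powr a / T\<^sup>2) \<le> C * (v powr a / T\<^sup>2)"
          using B0 by (intro mult_right_mono) (auto simp: C_def)
        ultimately show ?thesis
          using distrib_right[of "(2 * real DIM('a) + 8 * \<bar>a\<bar>) * B1" "4 * B2" "v powr a / T\<^sup>2"] by linarith
      qed
      finally show ?thesis by (simp only: ind v_def[symmetric] distrib_left mult_1_right)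
    qed
  qed
  with C show ?thesis by blast
qed

text \<open>The point is that the constant does not depend on the cutoff radius.  With \<open>n + 2 (a - 2) = -2\<close> the first term of the pointwise
  bound gives a convergent geometric series; with \<open>n + 2 a = 2\<close> the second one gives a sum of order \<open>T\<^sup>2\<close>, compensated by the
  factor \<open>1 / T\<^sup>2\<close>.\<close>
lemma laplacian_trunc_potential_L1:
  assumes a: "a = (2 - real DIM('a)) / 2" and dim: "DIM('a) \<ge> 2"
  shows "\<exists>C\<ge>0. \<forall>k::nat. (\<integral>\<^sup>+x. ennreal \<bar>laplacian (trunc_potential a (2 ^ k)) (x::'a::euclidean_space)\<bar> \<partial>lborel) \<le> ennreal C"
proof -
  obtain C where C: "C \<ge> 0" "\<And>T x. T > 0 \<Longrightarrow> \<bar>laplacian (trunc_potential a T) (x::'a)\<bar>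
     \<le> C * ((1 + x \<bullet> x) powr (a - 2) + (1 + x \<bullet> x) powr a / T\<^sup>2) * indicator (cball 0 T) x"
    using laplacian_trunc_potential_bound[OF a] by blast
  define w where "w = unit_ball_vol (real DIM('a))"
  have w: "w \<ge> 0" by (simp add: w_def)
  define A where "A = w * (1 + 2 ^ DIM('a) * 2)"
  have A: "A \<ge> 0" using w by (simp add: A_def)
  have a0: "a \<le> 0" using dim by (simp add: a)
  have "(\<integral>\<^sup>+x. ennreal \<bar>laplacian (trunc_potential a (2 ^ k)) (x::'a)\<bar> \<partial>lborel) \<le> ennreal (C * (A + A))" for k :: nat
  proof -
    let ?i = "indicator (cball (0::'a) (2 ^ k)) :: 'a \<Rightarrow> ennreal"
    have [measurable]: "cball (0::'a) (2 ^ k) \<in> sets borel" by simp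
    have I1: "(\<integral>\<^sup>+x. ennreal ((1 + x \<bullet> x) powr (a - 2)) * ?i x \<partial>lborel) \<le> ennreal A"
    proof -
      have e: "real DIM('a) + 2 * (a - 2) = - 2" by (simp add: a field_simps)
      have "(\<Sum>i<k. (2 powr (real DIM('a) + 2 * (a - 2))) ^ i) = (\<Sum>i<k. (1 / 4) ^ i)"
        unfolding e by (simp add: powr_minus powr_numeral)
      also have "\<dots> = (1 - (1 / 4) ^ k) / (3 / 4)" by (subst sum_gp_strict) (auto simp: field_simps)
      also have "\<dots> \<le> 2" by (simp add: field_simps)
      finally have "w * (1 + 2 ^ DIM('a) * (\<Sum>i<k. (2 powr (real DIM('a) + 2 * (a - 2))) ^ i)) \<le> A"
        unfolding A_def using w by (intro mult_left_mono add_left_mono) auto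
      with nn_integral_power_cball[of "a - 2" k, where 'a = 'a] a0 show ?thesis
        by (simp add: w_def) (meson ennreal_leI order_trans)
    qed
    have I2: "(\<integral>\<^sup>+x. ennreal ((1 + x \<bullet> x) powr a) * ?i x \<partial>lborel) \<le> ennreal (A * (2 ^ k)\<^sup>2)"
    proof -
      have e: "real DIM('a) + 2 * a = 2" by (simp add: a field_simps)
      have "(\<Sum>i<k. (2 powr (real DIM('a) + 2 * a)) ^ i) = (\<Sum>i<k. 4 ^ i)"
        unfolding e by (simp add: powr_numeral)
      also have "\<dots> = (4 ^ k - 1) / 3" by (subst sum_gp_strict) (auto simp: field_simps)
      also have "\<dots> \<le> 2 * 4 ^ k" by (simp add: field_simps)
      finally have s: "(\<Sum>i<k. (2 powr (real DIM('a) + 2 * a)) ^ i) \<le> 2 * 4 ^ k" .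
      have "w * (1 + 2 ^ DIM('a) * (\<Sum>i<k. (2 powr (real DIM('a) + 2 * a)) ^ i)) \<le> w * (4 ^ k + 2 ^ DIM('a) * (2 * 4 ^ k))"
        using w s by (intro mult_left_mono add_mono) auto
      also have "\<dots> = A * (2 ^ k)\<^sup>2"
        by (simp add: A_def algebra_simps two_power_square)
      finally have "w * (1 + 2 ^ DIM('a) * (\<Sum>i<k. (2 powr (real DIM('a) + 2 * a)) ^ i)) \<le> A * (2 ^ k)\<^sup>2" .
      with nn_integral_power_cball[of a k, where 'a = 'a] a0 show ?thesis
        by (simp add: w_def) (meson ennreal_leI order_trans)
    qed
    have "(\<integral>\<^sup>+x. ennreal \<bar>laplacian (trunc_potential a (2 ^ k)) (x::'a)\<bar> \<partial>lborel)
      \<le> (\<integral>\<^sup>+x. ennreal C * (ennreal ((1 + x \<bullet> x) powr (a - 2)) * ?i x) + ennreal (C / (2 ^ k)\<^sup>2) * (ennreal ((1 + x \<bullet> x) powr a) * ?i x) \<partial>lborel)"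
    proof (rule nn_integral_mono)
      fix x :: 'a
      have "ennreal \<bar>laplacian (trunc_potential a (2 ^ k)) x\<bar> \<le> ennreal (C * ((1 + x \<bullet> x) powr (a - 2) + (1 + x \<bullet> x) powr a / (2 ^ k)\<^sup>2) * indicator (cball 0 (2 ^ k)) x)"
        by (intro ennreal_leI C(2)) simp
      also have "\<dots> = ennreal C * (ennreal ((1 + x \<bullet> x) powr (a - 2)) * ?i x) + ennreal (C / (2 ^ k)\<^sup>2) * (ennreal ((1 + x \<bullet> x) powr a) * ?i x)"
        using C(1) by (simp add: indicator_def ennreal_mult[symmetric] ennreal_plus[symmetric] algebra_simps del: ennreal_plus)
      finally show "ennreal \<bar>laplacian (trunc_potential a (2 ^ k)) x\<bar> \<le> ennreal C * (ennreal ((1 + x \<bullet> x) powr (a - 2)) * ?i x) + ennreal (C / (2 ^ k)\<^sup>2) * (ennreal ((1 + x \<bullet> x) powr a) * ?i x)" .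
    qed
    also have "\<dots> = ennreal C * (\<integral>\<^sup>+x. ennreal ((1 + x \<bullet> x) powr (a - 2)) * ?i x \<partial>lborel) + ennreal (C / (2 ^ k)\<^sup>2) * (\<integral>\<^sup>+x. ennreal ((1 + x \<bullet> x) powr a) * ?i x \<partial>lborel)"
      by (simp add: nn_integral_add nn_integral_cmult)
    also have "\<dots> \<le> ennreal C * ennreal A + ennreal (C / (2 ^ k)\<^sup>2) * ennreal (A * (2 ^ k)\<^sup>2)"
      by (intro add_mono mult_left_mono I1 I2) auto
    also have "\<dots> = ennreal (C * (A + A))"
      using C(1) A by (simp add: ennreal_mult[symmetric] ennreal_plus[symmetric] distrib_left del: ennreal_plus)
    finally show ?thesis .
  qed
  moreover have "C * (A + A) \<ge> 0" using C A by simp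
  ultimately show ?thesis by blast
qed

text \<open>Test the equation with the truncated potentials.  Since \<open>u\<close> is bounded and their Laplacians are bounded in \<open>L\<^sup>1\<close>, the integrals of
  \<open>f\<close> against them stay bounded; the compact set where \<open>f\<close> may be negative contributes a bounded amount, and Fatou's lemma applies to
  the rest.\<close>
lemma weighted_source_finite:
  fixes u :: "'a::euclidean_space \<Rightarrow> real"
  assumes uf: "weak_poisson u f" and dim: "DIM('a) \<ge> 2" and bdd: "\<And>x. \<bar>u x\<bar> \<le> K"
    and nn: "\<And>y. norm y > \<rho> \<Longrightarrow> f y \<ge> 0"
  shows "(\<integral>\<^sup>+x. ennreal (f x * (1 + x \<bullet> x) powr ((2 - real DIM('a)) / 2)) * indicator {x. norm x > \<rho>} x \<partial>lborel) < \<infinity>"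
proof -
  define a where "a = (2 - real DIM('a)) / 2"
  have a0: "a \<le> 0" using dim by (simp add: a_def)
  have [measurable]: "u \<in> borel_measurable borel" "f \<in> borel_measurable borel" using weak_poissonD[OF uf] by auto
  have [measurable]: "{x::'a. norm x > \<rho>} \<in> sets borel" by measurable
  have [measurable]: "cball (0::'a) \<rho> \<in> sets borel" by simp
  have K: "K \<ge> 0" using bdd[of 0] by linarith
  obtain F where F: "F \<ge> 0" "\<And>x. norm x \<le> \<rho> \<Longrightarrow> \<bar>f x\<bar> \<le> F" using locally_boundedD[OF weak_poissonD(4)[OF uf]] by blast
  obtain C where C: "C \<ge> 0" "\<And>k::nat. (\<integral>\<^sup>+x. ennreal \<bar>laplacian (trunc_potential a (2 ^ k)) (x::'a)\<bar> \<partial>lborel) \<le> ennreal C"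
    using laplacian_trunc_potential_L1[OF a_def dim] by blast
  define \<phi> where "\<phi> k = (trunc_potential a (2 ^ k) :: 'a \<Rightarrow> real)" for k :: nat
  have \<phi>t: "test_function (\<phi> k)" for k unfolding \<phi>_def by (rule trunc_potential_test) simp
  have [measurable]: "\<phi> k \<in> borel_measurable borel" for k using \<phi>t by (rule test_function_measurable)
  have [measurable]: "laplacian (\<phi> k) \<in> borel_measurable borel" for k
    unfolding laplacian_def[abs_def] by (intro borel_measurable_sum test_function_measurable test_function_partial_deriv \<phi>t)
  have \<phi>0: "\<phi> k x \<ge> 0" for k x by (simp add: \<phi>_def trunc_potential_def flat_nonneg)
  have \<phi>1: "\<phi> k x \<le> 1" for k x
  proof -
    have "(1 + x \<bullet> x) powr a \<le> 1" using a0 by (intro powr_nonpos_le_one) auto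
    then show ?thesis using flat_le_1 flat_nonneg unfolding \<phi>_def trunc_potential_def by (intro mult_le_one) auto
  qed
  define L where "L = K * C + F * measure lborel (cball (0::'a) \<rho>)"
  have bound: "(\<integral>\<^sup>+x. ennreal (f x * \<phi> k x) * indicator {x. norm x > \<rho>} x \<partial>lborel) \<le> ennreal L" for k
  proof -
    obtain M B where MB: "\<And>x. norm x > M \<Longrightarrow> \<phi> k x = 0" using test_function_bounds[OF \<phi>t] by metis
    have fi: "integrable lborel (\<lambda>x. f x * \<phi> k x)"
      using conv_integrable[OF _ weak_poissonD(4)[OF uf] test_function_reflect[OF \<phi>t[of k], where x = 0], where x = 0] by simp
    have i1: "integrable lborel (\<lambda>x. f x * \<phi> k x * indicator (cball 0 \<rho>) x)"
      using fi by (intro integrable_real_mult_indicator) simp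
    have i2: "integrable lborel (\<lambda>x. f x * \<phi> k x * indicator {x. norm x > \<rho>} x)"
      using fi by (intro integrable_real_mult_indicator) simp
    have "(LBINT x. f x * \<phi> k x) = (LBINT x. f x * \<phi> k x * indicator (cball 0 \<rho>) x + f x * \<phi> k x * indicator {x. norm x > \<rho>} x)"
      by (intro Bochner_Integration.integral_cong) (auto simp: indicator_def)
    also have "\<dots> = (LBINT x. f x * \<phi> k x * indicator (cball 0 \<rho>) x) + (LBINT x. f x * \<phi> k x * indicator {x. norm x > \<rho>} x)"
      by (rule Bochner_Integration.integral_add[OF i1 i2])
    finally have split: "(LBINT x. f x * \<phi> k x * indicator {x. norm x > \<rho>} x)
      = (LBINT x. f x * \<phi> k x) - (LBINT x. f x * \<phi> k x * indicator (cball 0 \<rho>) x)" by simp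
    have "(LBINT x. f x * \<phi> k x) = - (LBINT x. u x * laplacian (\<phi> k) x)"
      using uf \<phi>t by (simp add: weak_poisson_def)
    also have "\<dots> \<le> K * C"
    proof -
      have "ennreal \<bar>\<integral>x. u x * laplacian (\<phi> k) x \<partial>lborel\<bar> \<le> ennreal (K * C)"
      proof (cases "integrable lborel (\<lambda>x. u x * laplacian (\<phi> k) x)")
        case True
        then have "ennreal \<bar>\<integral>x. u x * laplacian (\<phi> k) x \<partial>lborel\<bar> \<le> (\<integral>\<^sup>+x. ennreal \<bar>u x * laplacian (\<phi> k) x\<bar> \<partial>lborel)"
          using integral_norm_bound_ennreal[OF True] by simp
        also have "\<dots> \<le> (\<integral>\<^sup>+x. ennreal K * ennreal \<bar>laplacian (\<phi> k) x\<bar> \<partial>lborel)"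
          using bdd K by (intro nn_integral_mono) (auto simp: ennreal_mult[symmetric] abs_mult intro!: ennreal_leI mult_right_mono)
        also have "\<dots> = ennreal K * (\<integral>\<^sup>+x. ennreal \<bar>laplacian (\<phi> k) x\<bar> \<partial>lborel)"
          by (intro nn_integral_cmult) measurable
        also have "\<dots> \<le> ennreal K * ennreal C" using C(2)[of k] by (intro mult_left_mono) (auto simp: \<phi>_def)
        finally show ?thesis using K C by (simp add: ennreal_mult)
      qed (simp add: not_integrable_integral_eq)
      then have "\<bar>\<integral>x. u x * laplacian (\<phi> k) x \<partial>lborel\<bar> \<le> K * C" using K C by (subst (asm) ennreal_le_iff) auto
      then show ?thesis by linarith
    qed
    finally have t1: "(LBINT x. f x * \<phi> k x) \<le> K * C" .
    have "(LBINT x. - F * indicator (cball (0::'a) \<rho>) x) \<le> (LBINT x. f x * \<phi> k x * indicator (cball 0 \<rho>) x)"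
    proof (rule integral_mono[OF integrable_cball_const i1])
      fix x :: 'a
      show "- F * indicator (cball 0 \<rho>) x \<le> f x * \<phi> k x * indicator (cball 0 \<rho>) x"
      proof (cases "norm x \<le> \<rho>")
        case True
        have "\<bar>f x * \<phi> k x\<bar> \<le> F * 1" unfolding abs_mult using F(1) F(2)[OF True] \<phi>0[of k x] \<phi>1[of k x] by (intro mult_mono) auto
        with True show ?thesis by (simp add: abs_le_iff)
      qed (simp add: indicator_def)
    qed
    then have t2: "- (F * measure lborel (cball (0::'a) \<rho>)) \<le> (LBINT x. f x * \<phi> k x * indicator (cball 0 \<rho>) x)"
      using emeasure_bounded_finite[of "cball (0::'a) \<rho>"] by simp
    have "(\<integral>\<^sup>+x. ennreal (f x * \<phi> k x) * indicator {x. norm x > \<rho>} x \<partial>lborel)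
       = (\<integral>\<^sup>+x. ennreal (f x * \<phi> k x * indicator {x. norm x > \<rho>} x) \<partial>lborel)"
      by (intro nn_integral_cong) (auto simp: indicator_def)
    also have "\<dots> = ennreal (LBINT x. f x * \<phi> k x * indicator {x. norm x > \<rho>} x)"
      using nn \<phi>0 by (intro nn_integral_eq_integral i2) (auto simp: indicator_def)
    also have "\<dots> \<le> ennreal L" unfolding split L_def using t1 t2 by (intro ennreal_leI) linarith
    finally show ?thesis .
  qed
  let ?I = "indicator {x::'a. norm x > \<rho>} :: 'a \<Rightarrow> ennreal"
  have lim: "liminf (\<lambda>k. ennreal (f x * \<phi> k x) * ?I x) = ennreal (f x * ((1 + x \<bullet> x) powr a * flat 0 1)) * ?I x" for x
  proof (rule lim_imp_Liminf)
    have "(\<lambda>k. 1 - (1 + x \<bullet> x) / (2 ^ k)\<^sup>2) \<longlonglongrightarrow> 1 - 0"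
    proof (intro tendsto_diff tendsto_const)
      have "(\<lambda>k. (1 + x \<bullet> x) * (1 / 4) ^ k) \<longlonglongrightarrow> (1 + x \<bullet> x) * 0"
        by (intro tendsto_mult tendsto_const LIMSEQ_realpow_zero) auto
      moreover have "(1 + x \<bullet> x) * (1 / 4) ^ k = (1 + x \<bullet> x) / (2 ^ k)\<^sup>2" for k :: nat
        by (simp add: two_power_square power_divide)
      ultimately show "(\<lambda>k. (1 + x \<bullet> x) / (2 ^ k)\<^sup>2) \<longlonglongrightarrow> 0" by simp
    qed
    then have "(\<lambda>k. flat 0 (1 - (1 + x \<bullet> x) / (2 ^ k)\<^sup>2)) \<longlonglongrightarrow> flat 0 1"
      by (intro continuous_on_tendsto_compose[OF flat_continuous[of UNIV]]) auto
    then have "(\<lambda>k. f x * \<phi> k x) \<longlonglongrightarrow> f x * ((1 + x \<bullet> x) powr a * flat 0 1)"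
      unfolding \<phi>_def trunc_potential_def by (intro tendsto_mult tendsto_const)
    then have "(\<lambda>k. ennreal (f x * \<phi> k x)) \<longlonglongrightarrow> ennreal (f x * ((1 + x \<bullet> x) powr a * flat 0 1))"
      by (rule tendsto_ennrealI)
    then show "(\<lambda>k. ennreal (f x * \<phi> k x) * ?I x) \<longlonglongrightarrow> ennreal (f x * ((1 + x \<bullet> x) powr a * flat 0 1)) * ?I x"
      by (auto simp: indicator_def)
  qed simp
  have "(\<integral>\<^sup>+x. ennreal (f x * ((1 + x \<bullet> x) powr a * flat 0 1)) * ?I x \<partial>lborel)
      \<le> liminf (\<lambda>k. \<integral>\<^sup>+x. ennreal (f x * \<phi> k x) * ?I x \<partial>lborel)"
    unfolding lim[symmetric] by (rule nn_integral_liminf) measurable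
  also have "\<dots> \<le> ennreal L"
    by (rule order_trans[OF Liminf_le_Limsup Limsup_bounded]) (use bound in auto)
  finally have fin: "(\<integral>\<^sup>+x. ennreal (f x * ((1 + x \<bullet> x) powr a * flat 0 1)) * ?I x \<partial>lborel) \<le> ennreal L" .
  have f1: "flat 0 1 > 0" by (rule flat_pos) simp
  have "(\<integral>\<^sup>+x. ennreal (f x * (1 + x \<bullet> x) powr a) * ?I x \<partial>lborel)
     = (\<integral>\<^sup>+x. ennreal (1 / flat 0 1) * (ennreal (f x * ((1 + x \<bullet> x) powr a * flat 0 1)) * ?I x) \<partial>lborel)"
  proof (intro nn_integral_cong)
    fix x
    show "ennreal (f x * (1 + x \<bullet> x) powr a) * ?I x = ennreal (1 / flat 0 1) * (ennreal (f x * ((1 + x \<bullet> x) powr a * flat 0 1)) * ?I x)"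
      using nn[of x] f1 by (auto simp: indicator_def ennreal_mult[symmetric])
  qed
  also have "\<dots> = ennreal (1 / flat 0 1) * (\<integral>\<^sup>+x. ennreal (f x * ((1 + x \<bullet> x) powr a * flat 0 1)) * ?I x \<partial>lborel)"
    by (intro nn_integral_cmult) measurable
  also have "\<dots> \<le> ennreal (1 / flat 0 1) * ennreal L" using fin by (intro mult_left_mono) auto
  also have "\<dots> < \<infinity>" by (simp add: ennreal_mult_less_top)
  finally show ?thesis by (simp add: a_def)
qed

section \<open>Uniqueness for compactly supported solutions\<close>

lemma integrable_continuous_support:
  fixes H :: "'a::euclidean_space \<Rightarrow> real"
  assumes "continuous_on UNIV H" "\<And>x. norm x > M \<Longrightarrow> H x = 0"
  shows "integrable lborel H"
proof -
  have "bounded (H ` cball 0 M)"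
    by (intro compact_imp_bounded compact_continuous_image continuous_on_subset[OF assms(1)]) auto
  then obtain B where "\<And>x. norm x \<le> M \<Longrightarrow> \<bar>H x\<bar> \<le> B" unfolding bounded_iff by (metis imageI mem_cball_0 real_norm_def)
  then have "\<bar>H x\<bar> \<le> max 0 B" for x using assms(2)[of x] by (cases "norm x \<le> M") fastforce+
  then show ?thesis
    using assms by (intro integrable_bounded_support[where B = "max 0 B" and M = M] borel_measurable_continuous_onI) auto
qed

text \<open>A Carleman estimate with linear weight.  For \<open>v = exp (\<tau> (x \<bullet> e)) w\<close> the conjugated Laplacian is
  \<open>L = \<Delta> v - 2 \<tau> \<partial>\<^sub>e v + \<tau>\<^sup>2 v\<close>.  Its first and last terms are orthogonal to \<open>\<partial>\<^sub>e v\<close>, by integration by parts.  Hence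
  \<open>\<integral> L \<partial>\<^sub>e v = - 2 \<tau> \<integral> (\<partial>\<^sub>e v)\<^sup>2\<close>, so the norm of \<open>L\<close> is at least \<open>2 \<tau>\<close> times that of \<open>\<partial>\<^sub>e v\<close>, and the Poincare inequality in the
  bounded direction \<open>e\<close> gives the claim.  The function \<open>w1 b\<close> stands for \<open>\<partial>\<^sub>b w\<close>, and \<open>w2 c b\<close> for \<open>\<partial>\<^sub>c \<partial>\<^sub>b w\<close>.\<close>
lemma carleman:
  fixes w :: "'a::euclidean_space \<Rightarrow> real" and w1 :: "'a \<Rightarrow> 'a \<Rightarrow> real" and w2 :: "'a \<Rightarrow> 'a \<Rightarrow> 'a \<Rightarrow> real"
  assumes cont: "continuous_on UNIV w" "\<And>b. b \<in> Basis \<Longrightarrow> continuous_on UNIV (w1 b)"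
      "\<And>b c. b \<in> Basis \<Longrightarrow> c \<in> Basis \<Longrightarrow> continuous_on UNIV (w2 c b)"
    and supp: "\<And>x. norm x > M \<Longrightarrow> w x = 0" "\<And>b x. b \<in> Basis \<Longrightarrow> norm x > M \<Longrightarrow> w1 b x = 0"
      "\<And>b c x. b \<in> Basis \<Longrightarrow> c \<in> Basis \<Longrightarrow> norm x > M \<Longrightarrow> w2 c b x = 0"
    and D0: "\<And>b x. b \<in> Basis \<Longrightarrow> ((\<lambda>t. w (x + t *\<^sub>R b)) has_real_derivative w1 b x) (at 0)"
    and D1: "\<And>b c x. b \<in> Basis \<Longrightarrow> c \<in> Basis \<Longrightarrow> ((\<lambda>t. w1 b (x + t *\<^sub>R c)) has_real_derivative w2 c b x) (at 0)"
    and sym: "\<And>b c x. b \<in> Basis \<Longrightarrow> c \<in> Basis \<Longrightarrow> w2 c b x = w2 b c x"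
    and e: "e \<in> Basis" and M: "M > 0"
  shows "\<tau>\<^sup>2 * (LBINT x. (exp (\<tau> * (x \<bullet> e)) * w x)\<^sup>2)
     \<le> M\<^sup>2 * (LBINT x. (exp (\<tau> * (x \<bullet> e)) * (\<Sum>b\<in>Basis. w2 b b x))\<^sup>2)"
proof -
  define E where "E x = exp (\<tau> * (x \<bullet> e))" for x :: 'a
  define v where "v x = E x * w x" for x
  define v1 where "v1 b x = E x * (w1 b x + \<tau> * (b \<bullet> e) * w x)" for b x
  define v2 where "v2 c b x = E x * (w2 c b x + \<tau> * (b \<bullet> e) * w1 c x + \<tau> * (c \<bullet> e) * (w1 b x + \<tau> * (b \<bullet> e) * w x))" for c b x
  define L where "L x = E x * (\<Sum>b\<in>Basis. w2 b b x)" for x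
  have Ec: "continuous_on UNIV E" unfolding E_def by (intro continuous_intros)
  have vc: "continuous_on UNIV v" unfolding v_def by (intro continuous_intros Ec cont)
  have v1c: "continuous_on UNIV (v1 b)" if "b \<in> Basis" for b unfolding v1_def by (intro continuous_intros Ec cont that)
  have v2c: "continuous_on UNIV (v2 c b)" if "b \<in> Basis" "c \<in> Basis" for b c unfolding v2_def by (intro continuous_intros Ec cont that)
  have Lc: "continuous_on UNIV L" unfolding L_def by (intro continuous_intros Ec cont)
  have v0: "v x = 0" if "norm x > M" for x using supp that by (simp add: v_def)
  have v10: "v1 b x = 0" if "norm x > M" "b \<in> Basis" for b x using supp that by (simp add: v1_def)
  have v20: "v2 c b x = 0" if "norm x > M" "b \<in> Basis" "c \<in> Basis" for b c x using supp that by (simp add: v2_def)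
  have L0: "L x = 0" if "norm x > M" for x using supp that by (simp add: L_def)
  have DE: "((\<lambda>t. E (x + t *\<^sub>R b)) has_real_derivative E x * (\<tau> * (b \<bullet> e))) (at 0)" for b x
    unfolding E_def by (auto intro!: derivative_eq_intros simp: inner_add_left)
  have Dv: "((\<lambda>t. v (x + t *\<^sub>R b)) has_real_derivative v1 b x) (at 0)" if "b \<in> Basis" for b x
    unfolding v_def v1_def by (rule DERIV_cong[OF DERIV_mult[OF DE D0[OF that]]]) (simp add: algebra_simps)
  have Dv1: "((\<lambda>t. v1 b (x + t *\<^sub>R c)) has_real_derivative v2 c b x) (at 0)" if "b \<in> Basis" "c \<in> Basis" for b c x
    unfolding v1_def v2_def 
    by (rule DERIV_cong[OF DERIV_mult[OF DE DERIV_add[OF D1[OF that] DERIV_cmult[OF D0[OF that(2)]]]]]) (simp add: algebra_simps)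
  have v2sym: "v2 c b x = v2 b c x" if "b \<in> Basis" "c \<in> Basis" for b c x
    using sym[OF that] by (simp add: v2_def algebra_simps)
  have int: "integrable lborel (\<lambda>x. F x * G x)" if "continuous_on UNIV F" "continuous_on UNIV G" "\<And>x. norm x > M \<Longrightarrow> G x = 0" for F G :: "'a \<Rightarrow> real"
    by (rule integrable_continuous_support[where M = M]) (use that in \<open>auto intro!: continuous_intros\<close>)
  have sumE: "(\<Sum>b\<in>Basis. (b \<bullet> e) * g b) = g e" for g :: "'a \<Rightarrow> real"
  proof -
    have "(\<Sum>b\<in>Basis. (b \<bullet> e) * g b) = (\<Sum>b\<in>Basis. if b = e then g b else 0)"
      by (rule sum.cong) (use e in \<open>auto simp: inner_Basis\<close>)
    then show ?thesis using e by simp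
  qed
  have Leq: "L x = (\<Sum>b\<in>Basis. v2 b b x) - 2 * \<tau> * v1 e x + \<tau>\<^sup>2 * v x" for x
  proof -
    have "(\<Sum>b\<in>Basis. v2 b b x) = E x * ((\<Sum>b\<in>Basis. w2 b b x) + 2 * \<tau> * (\<Sum>b\<in>Basis. (b \<bullet> e) * w1 b x) + \<tau>\<^sup>2 * w x * (\<Sum>b\<in>Basis. (b \<bullet> e) * (b \<bullet> e)))"
      unfolding v2_def by (simp add: sum_distrib_left sum.distrib[symmetric] algebra_simps power2_eq_square)
    also have "\<dots> = E x * ((\<Sum>b\<in>Basis. w2 b b x) + 2 * \<tau> * w1 e x + \<tau>\<^sup>2 * w x)"
      unfolding sumE using e by (simp add: inner_same_Basis)
    finally show ?thesis using e by (simp add: L_def v1_def v_def inner_same_Basis power2_eq_square algebra_simps)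
  qed
  \<comment> \<open>Integrate \<open>\<partial>\<^sub>b (\<partial>\<^sub>b v \<partial>\<^sub>e v)\<close> and subtract half of \<open>\<partial>\<^sub>e ((\<partial>\<^sub>b v)\<^sup>2)\<close>.\<close>
  have z1: "(LBINT x. v2 b b x * v1 e x) = 0" if b: "b \<in> Basis" for b
  proof -
    have "(LBINT x. v2 b b x * v1 e x + v2 b e x * v1 b x) = 0"
    proof (rule integral_directional_derivative_0[where F = "\<lambda>x. v1 b x * v1 e x" and M = M and b = b])
      show "((\<lambda>t. v1 b (x + t *\<^sub>R b) * v1 e (x + t *\<^sub>R b)) has_real_derivative v2 b b x * v1 e x + v2 b e x * v1 b x) (at 0)" for x
        by (rule DERIV_cong[OF DERIV_mult[OF Dv1[OF b b] Dv1[OF e b]]]) simp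
    qed (auto intro!: continuous_intros v1c v2c b e simp: v10 b e)
    moreover have "(LBINT x. v2 b e x * v1 b x + v2 b e x * v1 b x) = 0"
    proof (rule integral_directional_derivative_0[where F = "\<lambda>x. v1 b x * v1 b x" and M = M and b = e])
      show "((\<lambda>t. v1 b (x + t *\<^sub>R e) * v1 b (x + t *\<^sub>R e)) has_real_derivative v2 b e x * v1 b x + v2 b e x * v1 b x) (at 0)" for x
        by (rule DERIV_cong[OF DERIV_mult[OF Dv1[OF b e] Dv1[OF b e]]]) (simp add: v2sym[OF b e])
    qed (auto intro!: continuous_intros v1c v2c b e simp: v10 b e)
    ultimately show ?thesis
      by (simp add: int v1c v2c v10 b e mult.commute[of "v1 b _"])
  qed
  have z2: "(LBINT x. v x * v1 e x) = 0"
  proof -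
    have "(LBINT x. v x * v1 e x + v x * v1 e x) = 0"
    proof (rule integral_directional_derivative_0[where F = "\<lambda>x. v x * v x" and M = M and b = e])
      show "((\<lambda>t. v (x + t *\<^sub>R e) * v (x + t *\<^sub>R e)) has_real_derivative v x * v1 e x + v x * v1 e x) (at 0)" for x
        by (rule DERIV_cong[OF DERIV_mult[OF Dv[OF e] Dv[OF e]]]) simp
    qed (auto intro!: continuous_intros v1c vc e simp: v0 v10 e)
    then show ?thesis by (simp add: int vc v1c v10 e)
  qed
  \<comment> \<open>Integrate \<open>\<partial>\<^sub>e ((x \<bullet> e) v\<^sup>2)\<close>; this is the source of the Poincare inequality \<open>B\<close>.\<close>
  have z3: "(LBINT x. v x * v x) + 2 * (LBINT x. ((x \<bullet> e) * v x) * v1 e x) = 0"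
  proof -
    have "(LBINT x. v x * v x + 2 * (((x \<bullet> e) * v x) * v1 e x)) = 0"
    proof (rule integral_directional_derivative_0[where F = "\<lambda>x. (x \<bullet> e) * (v x * v x)" and M = M and b = e])
      have De: "((\<lambda>t. (x + t *\<^sub>R e) \<bullet> e) has_real_derivative 1) (at 0)" for x
        using e by (auto intro!: derivative_eq_intros simp: inner_add_left inner_same_Basis)
      show "((\<lambda>t. ((x + t *\<^sub>R e) \<bullet> e) * (v (x + t *\<^sub>R e) * v (x + t *\<^sub>R e))) has_real_derivative v x * v x + 2 * (((x \<bullet> e) * v x) * v1 e x)) (at 0)" for x
        by (rule DERIV_cong[OF DERIV_mult[OF De DERIV_mult[OF Dv[OF e] Dv[OF e]]]]) (simp add: algebra_simps)
    qed (auto intro!: continuous_intros v1c vc e simp: v0 v10 e)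
    then show ?thesis
      by (subst (asm) Bochner_Integration.integral_add) (auto intro!: int integrable_mult_right continuous_intros vc v1c v0 v10 e)
  qed
  define J where "J = (LBINT x. v1 e x * v1 e x)"
  have LJ: "(LBINT x. L x * v1 e x) = - 2 * \<tau> * J"
  proof -
    have "(LBINT x. L x * v1 e x) = (LBINT x. (\<Sum>b\<in>Basis. v2 b b x * v1 e x) - 2 * \<tau> * (v1 e x * v1 e x) + \<tau>\<^sup>2 * (v x * v1 e x))"
      by (simp add: Leq algebra_simps sum_distrib_left sum_distrib_right)
    also have "\<dots> = (\<Sum>b\<in>Basis. \<integral>x. v2 b b x * v1 e x \<partial>lborel) - 2 * \<tau> * J + \<tau>\<^sup>2 * (LBINT x. v x * v1 e x)"
      unfolding J_def
      by (subst Bochner_Integration.integral_add Bochner_Integration.integral_diff Bochner_Integration.integral_sum;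
          (auto intro!: int integrable_mult_right Bochner_Integration.integrable_sum Bochner_Integration.integrable_diff vc v1c v2c v10 e)?)+
    also have "\<dots> = - 2 * \<tau> * J" by (simp add: z1 z2)
    finally show ?thesis .
  qed
  have A: "4 * \<tau>\<^sup>2 * J \<le> (LBINT x. L x * L x)"
  proof -
    \<comment> \<open>The square is chosen so that its mixed term is \<open>- 8 \<tau>\<^sup>2 J\<close>.\<close>
    have "0 \<le> (LBINT x. (L x + 2 * \<tau> * v1 e x)\<^sup>2)" by (intro integral_nonneg_AE) auto
    also have "\<dots> = (LBINT x. L x * L x + (4 * \<tau>) * (L x * v1 e x) + (4 * \<tau>\<^sup>2) * (v1 e x * v1 e x))"
      by (simp add: power2_eq_square algebra_simps)
    also have "\<dots> = (LBINT x. L x * L x) + (4 * \<tau>) * (LBINT x. L x * v1 e x) + (4 * \<tau>\<^sup>2) * J"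
      unfolding J_def
      by (simp add: int Lc v1c L0 v10 e)
    also have "\<dots> = (LBINT x. L x * L x) - 4 * \<tau>\<^sup>2 * J"
      unfolding LJ by (simp add: power2_eq_square)
    finally show ?thesis by simp
  qed
  have B: "(LBINT x. v x * v x) \<le> 4 * M\<^sup>2 * J"
  proof -
    have "0 \<le> (LBINT x. (v x + 2 * (x \<bullet> e) * v1 e x)\<^sup>2)" by (intro integral_nonneg_AE) auto
    also have "\<dots> = (LBINT x. v x * v x + 4 * (((x \<bullet> e) * v x) * v1 e x) + 4 * (((x \<bullet> e)\<^sup>2 * v1 e x) * v1 e x))"
      by (simp add: power2_eq_square algebra_simps)
    also have "\<dots> = (LBINT x. v x * v x) + 4 * (LBINT x. ((x \<bullet> e) * v x) * v1 e x) + 4 * (LBINT x. ((x \<bullet> e)\<^sup>2 * v1 e x) * v1 e x)"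
      by (subst Bochner_Integration.integral_add Bochner_Integration.integral_diff;
          (auto intro!: int integrable_mult_right Bochner_Integration.integrable_add continuous_intros vc v1c v0 v10 e)?)+
    finally have "(LBINT x. v x * v x) \<le> 4 * (LBINT x. ((x \<bullet> e)\<^sup>2 * v1 e x) * v1 e x)"
      using z3 by linarith
    also have "(LBINT x. ((x \<bullet> e)\<^sup>2 * v1 e x) * v1 e x) \<le> (LBINT x. M\<^sup>2 * (v1 e x * v1 e x))"
    proof (rule integral_mono)
      fix x
      show "((x \<bullet> e)\<^sup>2 * v1 e x) * v1 e x \<le> M\<^sup>2 * (v1 e x * v1 e x)"
      proof (cases "norm x \<le> M")
        case True
        then have "\<bar>x \<bullet> e\<bar> \<le> \<bar>M\<bar>" using Basis_le_norm[OF e, of x] M by simp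
        then have "(x \<bullet> e)\<^sup>2 \<le> M\<^sup>2" by (simp add: abs_le_square_iff)
        then have "(x \<bullet> e)\<^sup>2 * (v1 e x * v1 e x) \<le> M\<^sup>2 * (v1 e x * v1 e x)" by (intro mult_right_mono) auto
        then show ?thesis by (simp only: mult.assoc)
      qed (simp add: v10 e)
    qed (auto intro!: int integrable_mult_right continuous_intros v1c v10 e)
    finally show ?thesis by (simp add: J_def)
  qed
  have "\<tau>\<^sup>2 * (LBINT x. v x * v x) \<le> \<tau>\<^sup>2 * (4 * M\<^sup>2 * J)" by (intro mult_left_mono B) auto
  also have "\<dots> = M\<^sup>2 * (4 * \<tau>\<^sup>2 * J)" by simp
  also have "\<dots> \<le> M\<^sup>2 * (LBINT x. L x * L x)" by (intro mult_left_mono A) auto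
  finally show ?thesis by (simp add: v_def L_def E_def power2_eq_square)
qed

lemma conv_kern_support:
  assumes "\<And>x. norm x > M \<Longrightarrow> u x = 0" "0 < s" "s \<le> 1" "norm x > M + 1" "\<And>z. norm z > s \<Longrightarrow> \<phi> z = 0"
  shows "conv u \<phi> x = 0"
proof -
  have "u y * \<phi> (x - y) = 0" for y
  proof (cases "norm y > M")
    case False
    then have "norm (x - y) > s" using assms norm_triangle_ineq2[of x y] by linarith
    then show ?thesis using assms(5) by simp
  qed (use assms in simp)
  then show ?thesis unfolding conv_def by (simp only: Bochner_Integration.integral_zero)
qed

lemma conv_kern_bounded:
  fixes u :: "'a::euclidean_space \<Rightarrow> real"
  assumes [measurable]: "u \<in> borel_measurable borel" and u: "\<And>x. \<bar>u x\<bar> \<le> K" and s: "s > 0"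
  shows "\<bar>conv u (kern s) x\<bar> \<le> K"
proof -
  have lb: "locally_bounded u" using u by (auto simp: locally_bounded_def)
  have "\<bar>conv u (kern s) x\<bar> \<le> (LBINT y. \<bar>u y * kern s (x - y)\<bar>)"
    unfolding conv_def by (rule integral_abs_bound)
  also have "\<dots> \<le> (LBINT y. K * kern s (x - y))"
  proof (rule integral_mono)
    show "integrable lborel (\<lambda>y. \<bar>u y * kern s (x - y)\<bar>)"
      by (rule integrable_abs[OF conv_integrable[OF assms(1) lb kern_test[OF s]]])
    show "integrable lborel (\<lambda>y. K * kern s (x - y))" by (rule integrable_mult_right[OF kern_integrable[OF s]])
    show "\<bar>u y * kern s (x - y)\<bar> \<le> K * kern s (x - y)" for y
      using u[of y] kern_nonneg[OF s, of "x - y"] by (simp add: abs_mult mult_right_mono)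
  qed
  also have "\<dots> = K" by (simp add: kern_integral[OF s])
  finally show ?thesis .
qed

lemma kern_partial_support:
  assumes s: "s > 0" and z: "norm z > s"
  shows "partial_deriv b (kern s) z = 0" "partial_deriv c (partial_deriv b (kern s)) z = 0"
proof -
  have *: "partial_deriv b g z = 0" if "\<And>z. norm z > s \<Longrightarrow> g z = 0" "norm z > s" for g :: "'a \<Rightarrow> real" and b z
  proof -
    have o: "open {z :: 'a. norm z > s}" by (intro open_Collect_less continuous_intros)
    have "(g has_derivative (\<lambda>h. 0)) (at z)"
      by (rule has_derivative_transform_within_open[where s = "{z. norm z > s}" and f = "\<lambda>x. 0"])
         (use that o in auto)
    from partial_deriv_eq[OF this] show ?thesis .
  qed
  have k: "kern s z = 0" if "norm z > s" for z :: 'a using kern_support[OF s, of z] that by simp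
  show "partial_deriv b (kern s) z = 0" by (rule *[OF k z])
  show "partial_deriv c (partial_deriv b (kern s)) z = 0" by (rule *[OF *[OF k] z])
qed

text \<open>Unique continuation in the only case that is needed.  Apply \<open>carleman\<close> to the mollifications of \<open>u\<close>, whose Laplacians are the
  mollifications of \<open>- f\<close>, and let the scale tend to zero.  With \<open>\<bar>f\<bar> \<le> C \<bar>u\<bar>\<close> the result is
  \<open>\<tau>\<^sup>2 I \<le> N\<^sup>2 C\<^sup>2 I\<close> for the weighted square integral \<open>I\<close> of \<open>u\<close>, so \<open>I = 0\<close> once \<open>\<tau> > N C\<close>.\<close>
lemma compact_support_solution_0:
  fixes u :: "'a::euclidean_space \<Rightarrow> real"
  assumes uf: "weak_poisson u f" and K: "\<And>x. \<bar>u x\<bar> \<le> K"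
    and supp: "\<And>x. norm x > M \<Longrightarrow> u x = 0" and M: "M > 0"
    and f: "\<And>x. \<bar>f x\<bar> \<le> C * \<bar>u x\<bar>" and C: "C \<ge> 0"
  shows "AE x in lborel. u x = 0"
proof -
  note u = weak_poissonD(1,2)[OF uf] and f' = weak_poissonD(3,4)[OF uf]
  have [measurable]: "u \<in> borel_measurable borel" "f \<in> borel_measurable borel" by (rule u f')+
  have fK: "\<bar>f x\<bar> \<le> C * K" for x using f[of x] K[of x] C by (meson mult_left_mono order_trans)
  have fs: "f x = 0" if "norm x > M" for x using f[of x] supp[OF that] by simp
  obtain e :: 'a where e: "e \<in> Basis" using nonempty_Basis by blast
  \<comment> \<open>Mollification at scales at most \<open>1\<close> enlarges the support by at most \<open>1\<close>.\<close>
  define N where "N = M + 1"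
  have N: "N > 0" using M by (simp add: N_def)
  \<comment> \<open>Any \<open>\<tau> > N C\<close> would do.\<close>
  define \<tau> where "\<tau> = N * C + 1"
  have \<tau>: "\<tau> > 0" using N C by (simp add: \<tau>_def add_nonneg_pos)
  define E where "E x = exp (\<tau> * (x \<bullet> e))" for x :: 'a
  have Ec: "continuous_on UNIV E" unfolding E_def by (intro continuous_intros)
  have [measurable]: "E \<in> borel_measurable borel" using Ec by (rule borel_measurable_continuous_onI)
  have Eb: "\<bar>E x\<bar> \<le> exp (\<tau> * N)" if "norm x \<le> N" for x
    using Basis_le_norm[OF e, of x] that \<tau> by (auto simp: E_def)
  obtain s :: "nat \<Rightarrow> real" where s: "\<And>j. s j > 0" "\<And>j. s j \<le> 1" "s \<longlonglongrightarrow> 0"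
    and ae: "AE x in lborel. norm x \<le> N \<longrightarrow> (\<lambda>j. conv u (kern (s j)) x) \<longlonglongrightarrow> u x \<and> (\<lambda>j. conv f (kern (s j)) x) \<longlonglongrightarrow> f x"
    using conv_kern_AE2[OF u(1) f'(1) u(2) f'(2), of N] by blast
  have ineq: "\<tau>\<^sup>2 * (LBINT x. (E x * conv u (kern (s j)) x)\<^sup>2) \<le> N\<^sup>2 * (LBINT x. (E x * conv f (kern (s j)) x)\<^sup>2)" for j
  proof -
    let ?k = "kern (s j) :: 'a \<Rightarrow> real"
    note k = kern_test[OF s(1), of j, where 'a = 'a]
    have "\<tau>\<^sup>2 * (LBINT x. (exp (\<tau> * (x \<bullet> e)) * conv u ?k x)\<^sup>2)
      \<le> N\<^sup>2 * (LBINT x. (exp (\<tau> * (x \<bullet> e)) * (\<Sum>b\<in>Basis. conv u (partial_deriv b (partial_deriv b ?k)) x))\<^sup>2)"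
    proof (rule carleman[where w = "conv u ?k" and ?w1.0 = "\<lambda>b. conv u (partial_deriv b ?k)"
            and ?w2.0 = "\<lambda>c b. conv u (partial_deriv c (partial_deriv b ?k))"])
      fix b x assume b: "b \<in> (Basis :: 'a set)"
      show "((\<lambda>t. conv u ?k (x + t *\<^sub>R b)) has_real_derivative conv u (partial_deriv b ?k) x) (at 0)"
        using conv_DERIV[OF u k b, of x 0] by simp
      fix c assume c: "c \<in> (Basis :: 'a set)"
      show "((\<lambda>t. conv u (partial_deriv b ?k) (x + t *\<^sub>R c)) has_real_derivative conv u (partial_deriv c (partial_deriv b ?k)) x) (at 0)"
        using conv_DERIV[OF u test_function_partial_deriv[OF k b] c, of x 0] by simp
      show "conv u (partial_deriv c (partial_deriv b ?k)) x = conv u (partial_deriv b (partial_deriv c ?k)) x"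
        by (simp only: kern_partial_commute[of c b])
    next
      fix x :: 'a assume x: "norm x > N"
      have sup: "conv u \<phi> x = 0" if "\<And>z. norm z > s j \<Longrightarrow> \<phi> z = 0" for \<phi>
        by (rule conv_kern_support[OF supp s(1)[of j] s(2)[of j]]) (use x that in \<open>auto simp: N_def\<close>)
      show "conv u ?k x = 0" by (rule sup) (simp add: kern_support s(1))
      show "conv u (partial_deriv b ?k) x = 0" for b by (rule sup) (rule kern_partial_support[OF s(1)])
      show "conv u (partial_deriv c (partial_deriv b ?k)) x = 0" for b c by (rule sup) (rule kern_partial_support[OF s(1)])
    qed (auto intro!: conv_continuous u test_function_partial_deriv k e N)
    then show ?thesis by (simp add: conv_laplacian_sum[OF u k] conv_laplacian[OF uf k] E_def)
  qed
  have lim: "(\<lambda>j. \<integral>x. (E x * conv v (kern (s j)) x)\<^sup>2 \<partial>lborel) \<longlonglongrightarrow> (LBINT x. (E x * v x)\<^sup>2)"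
    if [measurable]: "v \<in> borel_measurable borel" and v: "\<And>x. \<bar>v x\<bar> \<le> B" "\<And>x. norm x > M \<Longrightarrow> v x = 0"
      and lim: "AE x in lborel. norm x \<le> N \<longrightarrow> (\<lambda>j. conv v (kern (s j)) x) \<longlonglongrightarrow> v x" for v B
  proof (rule integral_dominated_convergence[where w = "\<lambda>x. (exp (\<tau> * N) * B)\<^sup>2 * indicator (cball 0 N) x"])
    have lb: "locally_bounded v" using v(1) by (auto simp: locally_bounded_def)
    have out: "conv v (kern (s j)) x = 0" if "norm x > N" for x j
      by (rule conv_kern_support[OF v(2) s(1)[of j] s(2)[of j]]) (use that in \<open>auto simp: N_def kern_support[OF s(1)]\<close>)
    have [measurable]: "conv v (kern (s j)) \<in> borel_measurable borel" for j
      by (rule borel_measurable_continuous_onI, rule conv_continuous[OF that(1) lb kern_test[OF s(1)]])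
    show "(\<lambda>x. (E x * conv v (kern (s j)) x)\<^sup>2) \<in> borel_measurable lborel" for j by measurable
    show "AE x in lborel. (\<lambda>j. (E x * conv v (kern (s j)) x)\<^sup>2) \<longlonglongrightarrow> (E x * v x)\<^sup>2"
      using lim
    proof eventually_elim
      fix x assume l: "norm x \<le> N \<longrightarrow> (\<lambda>j. conv v (kern (s j)) x) \<longlonglongrightarrow> v x"
      show "(\<lambda>j. (E x * conv v (kern (s j)) x)\<^sup>2) \<longlonglongrightarrow> (E x * v x)\<^sup>2"
      proof (cases "norm x \<le> N")
        case True
        with l show ?thesis by (intro tendsto_intros) auto
      next
        case False
        then show ?thesis using out[of x] v(2)[of x] by (simp add: N_def)
      qed
    qed
    show "AE x in lborel. norm ((E x * conv v (kern (s j)) x)\<^sup>2) \<le> (exp (\<tau> * N) * B)\<^sup>2 * indicator (cball 0 N) x" for j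
    proof (rule AE_I2)
      fix x
      show "norm ((E x * conv v (kern (s j)) x)\<^sup>2) \<le> (exp (\<tau> * N) * B)\<^sup>2 * indicator (cball 0 N) x"
      proof (cases "norm x \<le> N")
        case True
        have "\<bar>E x\<bar> * \<bar>conv v (kern (s j)) x\<bar> \<le> exp (\<tau> * N) * B"
          using Eb[OF True] conv_kern_bounded[OF that(1) v(1) s(1)] by (intro mult_mono) auto
        then have "\<bar>E x * conv v (kern (s j)) x\<bar>\<^sup>2 \<le> (exp (\<tau> * N) * B)\<^sup>2" unfolding abs_mult by (intro power_mono) auto
        with True show ?thesis by simp
      qed (use out in simp)
    qed
  qed (simp_all only: integrable_cball_const, simp_all)
  have le0: "\<tau>\<^sup>2 * (LBINT x. (E x * u x)\<^sup>2) \<le> N\<^sup>2 * (LBINT x. (E x * f x)\<^sup>2)"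
  proof (rule LIMSEQ_le)
    show "(\<lambda>j. \<tau>\<^sup>2 * (LBINT x. (E x * conv u (kern (s j)) x)\<^sup>2)) \<longlonglongrightarrow> \<tau>\<^sup>2 * (LBINT x. (E x * u x)\<^sup>2)"
      by (intro tendsto_mult tendsto_const lim[OF u(1) K supp]) (use ae in auto)
    show "(\<lambda>j. N\<^sup>2 * (LBINT x. (E x * conv f (kern (s j)) x)\<^sup>2)) \<longlonglongrightarrow> N\<^sup>2 * (LBINT x. (E x * f x)\<^sup>2)"
      by (intro tendsto_mult tendsto_const lim[OF f'(1) fK fs]) (use ae in auto)
  qed (use ineq in auto)
  have ui: "integrable lborel (\<lambda>x. (E x * u x)\<^sup>2)" and fi: "integrable lborel (\<lambda>x. (E x * f x)\<^sup>2)"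
  proof -
    have bnd: "\<bar>(E x * v x)\<^sup>2\<bar> \<le> (exp (\<tau> * N) * B)\<^sup>2" if "\<And>x. \<bar>v x\<bar> \<le> B" "\<And>x. norm x > M \<Longrightarrow> v x = 0" for v B x
    proof (cases "norm x \<le> N")
      case True
      have "\<bar>E x\<bar> * \<bar>v x\<bar> \<le> exp (\<tau> * N) * B" using Eb[OF True] that(1) by (intro mult_mono) auto
      then have "\<bar>E x * v x\<bar>\<^sup>2 \<le> (exp (\<tau> * N) * B)\<^sup>2" unfolding abs_mult by (intro power_mono) auto
      then show ?thesis by simp
    qed (use that(2)[of x] in \<open>simp add: N_def\<close>)
    show "integrable lborel (\<lambda>x. (E x * u x)\<^sup>2)"
      by (rule integrable_bounded_support[where M = M, OF _ bnd[OF K supp]]) (use supp in auto)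
    show "integrable lborel (\<lambda>x. (E x * f x)\<^sup>2)"
      by (rule integrable_bounded_support[where M = M, OF _ bnd[OF fK fs]]) (use fs in auto)
  qed
  have "(LBINT x. (E x * f x)\<^sup>2) \<le> (LBINT x. C\<^sup>2 * (E x * u x)\<^sup>2)"
  proof (rule integral_mono[OF fi integrable_mult_right[OF ui]])
    fix x
    have "\<bar>f x\<bar>\<^sup>2 \<le> (C * \<bar>u x\<bar>)\<^sup>2" using f by (intro power_mono) auto
    then have "(E x)\<^sup>2 * (f x)\<^sup>2 \<le> (E x)\<^sup>2 * (C\<^sup>2 * (u x)\<^sup>2)" by (intro mult_left_mono) (auto simp: power_mult_distrib)
    then show "(E x * f x)\<^sup>2 \<le> C\<^sup>2 * (E x * u x)\<^sup>2" by (simp add: power_mult_distrib mult_ac)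
  qed
  then have "N\<^sup>2 * (LBINT x. (E x * f x)\<^sup>2) \<le> N\<^sup>2 * (C\<^sup>2 * (LBINT x. (E x * u x)\<^sup>2))" 
    by (intro mult_left_mono) auto
  with le0 have le: "\<tau>\<^sup>2 * (LBINT x. (E x * u x)\<^sup>2) \<le> (N * C)\<^sup>2 * (LBINT x. (E x * u x)\<^sup>2)"
    by (simp add: power_mult_distrib mult.assoc)
  have "(N * C)\<^sup>2 < \<tau>\<^sup>2" unfolding \<tau>_def using N C by (intro power_strict_mono) auto
  moreover have "(LBINT x. (E x * u x)\<^sup>2) \<ge> 0" by (intro integral_nonneg_AE) auto
  ultimately have "(LBINT x. (E x * u x)\<^sup>2) = 0" using le by (smt (verit) mult_strict_right_mono)
  then have "AE x in lborel. (E x * u x)\<^sup>2 = 0"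
    using integral_nonneg_eq_0_iff_AE[OF ui] by simp
  then show ?thesis by eventually_elim (simp add: E_def)
qed

section \<open>Passage to Borel representatives and conclusion\<close>

text \<open>Modifying \<open>f\<close> on a null set gives a Borel function for which a property valid almost everywhere holds at every point where the new
  function is not zero; all bounds and signs used here are compatible with the value zero.\<close>
lemma borel_representative:
  fixes f :: "'a::euclidean_space \<Rightarrow> real"
  assumes f: "f \<in> borel_measurable lebesgue" and Q: "AE x in lebesgue. Q x"
  obtains g where "g \<in> borel_measurable borel" "AE x in lebesgue. g x = f x"
    "\<And>x. g x = 0 \<or> g x = f x \<and> Q x"
proof -
  obtain g0 where g0 [measurable]: "g0 \<in> borel_measurable lborel" and eq: "AE x in lborel. f x = g0 x"
    using completion_ex_borel_measurable_real[OF f] by auto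
  have "AE x in lborel. Q x" using Q by (simp add: AE_completion_iff)
  with eq have "AE x in lborel. f x = g0 x \<and> Q x" by eventually_elim simp
  then obtain N where N: "N \<in> null_sets lborel" "\<And>x. x \<notin> N \<Longrightarrow> f x = g0 x \<and> Q x"
    unfolding eventually_ae_filter by auto
  define g where "g x = (if x \<in> N then 0 else g0 x)" for x
  show ?thesis
  proof
    have "N \<in> sets lborel" using N by auto
    then have "g \<in> borel_measurable lborel" unfolding g_def by (intro measurable_If_set) (auto intro: g0)
    then show "g \<in> borel_measurable borel" by simp
    have "AE x in lborel. x \<notin> N" using N(1) by (rule AE_not_in)
    then have "AE x in lborel. g x = f x" by eventually_elim (use N(2) in \<open>auto simp: g_def\<close>)
    then show "AE x in lebesgue. g x = f x" by (simp add: AE_completion_iff)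
    show "g x = 0 \<or> g x = f x \<and> Q x" for x using N(2)[of x] by (auto simp: g_def)
  qed
qed

lemma integral_lebesgue_eq_lborel:
  fixes f g :: "'a::euclidean_space \<Rightarrow> real"
  assumes "f \<in> borel_measurable lebesgue" "g \<in> borel_measurable borel" "AE x in lebesgue. g x = f x"
  shows "(LINT x|lebesgue. f x) = (LBINT x. g x)"
proof -
  have "(LINT x|lebesgue. f x) = (LINT x|lebesgue. g x)"
    using assms by (intro integral_cong_AE) (auto simp: eq_commute measurable_completion)
  also have "\<dots> = (LBINT x. g x)" using assms by (intro integral_completion) simp
  finally show ?thesis .
qed

lemma test_function_laplacian_measurable:
  "test_function \<phi> \<Longrightarrow> laplacian \<phi> \<in> borel_measurable borel"
  unfolding laplacian_def[abs_def] by (intro borel_measurable_sum test_function_measurable test_function_partial_deriv)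

text \<open>Combine the two parts: \<open>\<integral> V u \<bar>x\<bar>\<^bsup>2-n\<^esup>\<close> converges at infinity, and \<open>u\<close> is at least a multiple of \<open>\<bar>x\<bar>\<^bsup>2-n\<^esup>\<close> there.\<close>
lemma exterior_potential_mass_finite:
  fixes V u :: "'a::euclidean_space \<Rightarrow> real"
  assumes dim: "DIM('a) \<ge> 2" and uf: "weak_poisson u (\<lambda>x. V x * u x)" and K: "\<And>x. \<bar>u x\<bar> \<le> K"
    and V [measurable]: "V \<in> borel_measurable borel" and Vb: "locally_bounded V"
    and r: "r \<ge> 1" and rho: "\<rho> > 0"
    and nn: "\<And>x. norm x > \<rho> \<Longrightarrow> u x \<ge> 0" "\<And>x. norm x > \<rho> \<Longrightarrow> V x \<ge> 0"
    and nz: "\<not> (AE x in lborel. norm x > \<rho> \<longrightarrow> u x = 0)"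
  shows "(\<integral>\<^sup>+x. ennreal (norm x powi (4 - 2 * int DIM('a)) * V x) * indicator {x. norm x > r} x \<partial>lborel) < \<infinity>"
proof -
  define a where "a = (2 - real DIM('a)) / 2"
  have a0: "a \<le> 0" using dim by (simp add: a_def)
  have [measurable]: "u \<in> borel_measurable borel" by (rule weak_poissonD[OF uf])
  have fnn: "V x * u x \<ge> 0" if "norm x > \<rho>" for x using nn that by simp
  define \<rho>1 where "\<rho>1 = \<rho> + 1"
  obtain c where c: "c > 0" and low: "AE x in lborel. norm x > \<rho>1 \<longrightarrow> u x \<ge> c * (1 + x \<bullet> x) powr a"
    using superharmonic_lower_bound[OF uf dim rho _ nn(1) fnn nz, of \<rho>1] by (auto simp: a_def \<rho>1_def)
  obtain C where C: "C \<ge> 0" "\<And>x. norm x \<le> \<rho>1 \<Longrightarrow> \<bar>V x\<bar> \<le> C" using locally_boundedD[OF Vb] by blast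
  have [measurable]: "{x::'a. norm x > \<rho>} \<in> sets borel" "cball (0::'a) \<rho>1 \<in> sets borel" by simp_all
  have fin: "(\<integral>\<^sup>+x. ennreal (V x * u x * (1 + x \<bullet> x) powr a) * indicator {x. norm x > \<rho>} x \<partial>lborel) < \<infinity>"
    unfolding a_def by (rule weighted_source_finite[OF uf dim K fnn])
  define A where "A = 2 powr (- 2 * a) / c"
  have A: "A \<ge> 0" using c by (simp add: A_def)
  have "(\<integral>\<^sup>+x. ennreal (norm x powi (4 - 2 * int DIM('a)) * V x) * indicator {x. norm x > r} x \<partial>lborel)
    \<le> (\<integral>\<^sup>+x. ennreal C * indicator (cball 0 \<rho>1) x
        + ennreal A * (ennreal (V x * u x * (1 + x \<bullet> x) powr a) * indicator {x. norm x > \<rho>} x) \<partial>lborel)"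
  proof (rule nn_integral_mono_AE)
    show "AE x in lborel. ennreal (norm x powi (4 - 2 * int DIM('a)) * V x) * indicator {x. norm x > r} x
      \<le> ennreal C * indicator (cball 0 \<rho>1) x + ennreal A * (ennreal (V x * u x * (1 + x \<bullet> x) powr a) * indicator {x. norm x > \<rho>} x)"
      using low
    proof eventually_elim
      fix x :: 'a assume l: "norm x > \<rho>1 \<longrightarrow> u x \<ge> c * (1 + x \<bullet> x) powr a"
      show "ennreal (norm x powi (4 - 2 * int DIM('a)) * V x) * indicator {x. norm x > r} x
        \<le> ennreal C * indicator (cball 0 \<rho>1) x + ennreal A * (ennreal (V x * u x * (1 + x \<bullet> x) powr a) * indicator {x. norm x > \<rho>} x)"
      proof (cases "norm x > r")
        case True
        then have n1: "norm x \<ge> 1" using r by simp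
        have "norm x powi (4 - 2 * int DIM('a)) = norm x powr (4 - 2 * real DIM('a))"
          using n1 powr_real_of_int'[of "norm x" "4 - 2 * int DIM('a)"] by (cases "x = 0") auto
        also have "\<dots> = norm x powr (2 * (2 * a))"
        proof -
          have "4 - 2 * real DIM('a) = 2 * (2 * a)" by (simp add: a_def)
          then show ?thesis by (simp only:)
        qed
        also have "\<dots> = (norm x powr 2) powr (2 * a)" by (simp only: powr_powr)
        also have "norm x powr 2 = x \<bullet> x" using n1 by (simp add: dot_square_norm powr_numeral)
        finally have pw: "norm x powi (4 - 2 * int DIM('a)) = (x \<bullet> x) powr (2 * a)" .
        have xx: "x \<bullet> x \<ge> 1" using n1 by (simp add: dot_square_norm)
        show ?thesis
        proof (cases "norm x \<le> \<rho>1")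
          case in1: True
          have "(x \<bullet> x) powr (2 * a) \<le> 1" using xx a0 by (intro powr_nonpos_le_one) auto
          then have "(x \<bullet> x) powr (2 * a) * C \<le> 1 * C" using C(1) by (rule mult_right_mono)
          moreover have "(x \<bullet> x) powr (2 * a) * V x \<le> (x \<bullet> x) powr (2 * a) * C"
            using C(2)[OF in1] by (intro mult_left_mono) auto
          ultimately have "(x \<bullet> x) powr (2 * a) * V x \<le> C" by linarith
          then show ?thesis using in1 True by (simp add: pw ennreal_leI add_increasing2)
        next
          case False
          then have f: "norm x > \<rho>" "norm x > \<rho>1" by (auto simp: \<rho>1_def)
          have V0: "V x \<ge> 0" using nn f by simp
          have "(x \<bullet> x) powr (2 * a) \<le> ((1 + x \<bullet> x) / 2) powr (2 * a)"
            using xx a0 by (intro powr_mono2') auto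
          also have "\<dots> = 2 powr (- 2 * a) * ((1 + x \<bullet> x) powr a * (1 + x \<bullet> x) powr a)"
            using xx by (simp add: powr_divide powr_minus_divide powr_add[symmetric])
          finally have "(x \<bullet> x) powr (2 * a) \<le> A * (c * (1 + x \<bullet> x) powr a) * (1 + x \<bullet> x) powr a"
            using c by (simp add: A_def)
          also have "\<dots> \<le> A * u x * (1 + x \<bullet> x) powr a"
            using l f A by (intro mult_right_mono mult_left_mono) auto
          finally have "(x \<bullet> x) powr (2 * a) * V x \<le> A * u x * (1 + x \<bullet> x) powr a * V x"
            using V0 by (rule mult_right_mono)
          also have "\<dots> = A * (V x * u x * (1 + x \<bullet> x) powr a)" by simp
          finally have "ennreal ((x \<bullet> x) powr (2 * a) * V x) \<le> ennreal (A * (V x * u x * (1 + x \<bullet> x) powr a))"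
            by (rule ennreal_leI)
          also have "\<dots> = ennreal A * ennreal (V x * u x * (1 + x \<bullet> x) powr a)"
            using A V0 nn(1)[OF f(1)] by (intro ennreal_mult) auto
          finally show ?thesis using f True False by (simp add: pw)
        qed
      qed simp
    qed
  qed
  also have "\<dots> = ennreal C * emeasure lborel (cball (0::'a) \<rho>1)
      + ennreal A * (\<integral>\<^sup>+x. ennreal (V x * u x * (1 + x \<bullet> x) powr a) * indicator {x. norm x > \<rho>} x \<partial>lborel)"
    by (simp add: nn_integral_add nn_integral_cmult nn_integral_cmult_indicator)
  also have "\<dots> < \<infinity>"
    using fin emeasure_bounded_finite[of "cball (0::'a) \<rho>1"] by (simp add: ennreal_mult_less_top)
  finally show ?thesis .
qed

text \<open>The divergence of the weighted integral of \<open>V\<close> forces \<open>u\<close> to vanish outside a ball, and a solution with compact support is zero.\<close>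
lemma nonneg_solution_0:
  fixes V u :: "'a::euclidean_space \<Rightarrow> real"
  assumes dim: "DIM('a) \<ge> 2" and V: "Linf_loc V" and R: "R > 1" and VR: "nonneg_outside R V" and r: "r \<ge> R"
    and inf: "(\<integral>\<^sup>+ x \<in> {x. norm x > r}. ennreal (norm x powi (4 - 2 * int DIM('a)) * V x) \<partial>lebesgue) = \<infinity>"
    and weak: "\<And>\<phi>. test_function \<phi> \<Longrightarrow> (LINT x|lebesgue. u x * (- laplacian \<phi> x)) = (LINT x|lebesgue. V x * u x * \<phi> x)"
    and u: "ess_bounded u" and R': "R' > 0" "nonneg_outside R' u"
  shows "AE x in lebesgue. u x = 0"
proof -
  have Vm: "V \<in> borel_measurable lebesgue" and "\<And>m::nat. \<exists>C. AE x in lebesgue. x \<in> cball 0 (real m) \<longrightarrow> \<bar>V x\<bar> \<le> C"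
    using V compact_cball unfolding Linf_loc_def by blast+
  then obtain C where C: "\<And>m::nat. AE x in lebesgue. x \<in> cball 0 (real m) \<longrightarrow> \<bar>V x\<bar> \<le> C m" by metis
  have "AE x in lebesgue. \<forall>m::nat. x \<in> cball 0 (real m) \<longrightarrow> \<bar>V x\<bar> \<le> C m"
    using C by (subst AE_all_countable) blast
  with VR have Vae: "AE x in lebesgue. (norm x > R \<longrightarrow> V x \<ge> 0) \<and> (\<forall>m::nat. norm x \<le> real m \<longrightarrow> \<bar>V x\<bar> \<le> C m)"
    unfolding nonneg_outside_def by eventually_elim auto
  obtain V1 where V1 [measurable]: "V1 \<in> borel_measurable borel" and VV1: "AE x in lebesgue. V1 x = V x"
    and V1p: "\<And>x. V1 x = 0 \<or> V1 x = V x \<and> (norm x > R \<longrightarrow> V x \<ge> 0) \<and> (\<forall>m::nat. norm x \<le> real m \<longrightarrow> \<bar>V x\<bar> \<le> C m)"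
    using borel_representative[OF Vm Vae] by blast
  have V1nn: "V1 x \<ge> 0" if "norm x > R" for x using V1p[of x] that by auto
  have V1b: "locally_bounded V1"
    unfolding locally_bounded_def
  proof
    fix M :: real
    obtain m :: nat where m: "M \<le> real m" using real_arch_simple by blast
    have "\<bar>V1 x\<bar> \<le> max 0 (C m)" if "norm x \<le> M" for x
    proof -
      have "norm x \<le> real m" using that m by simp
      then show ?thesis using V1p[of x] by (auto simp: le_max_iff_disj)
    qed
    then show "\<exists>C. \<forall>x. norm x \<le> M \<longrightarrow> \<bar>V1 x\<bar> \<le> C" by blast
  qed
  obtain K where um: "u \<in> borel_measurable lebesgue" and uK: "AE x in lebesgue. \<bar>u x\<bar> \<le> K"
    using u by (auto simp: ess_bounded_def)
  from uK R'(2) have uae: "AE x in lebesgue. \<bar>u x\<bar> \<le> K \<and> (norm x > R' \<longrightarrow> u x \<ge> 0)"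
    unfolding nonneg_outside_def by eventually_elim auto
  obtain u1 where u1 [measurable]: "u1 \<in> borel_measurable borel" and uu1: "AE x in lebesgue. u1 x = u x"
    and u1p: "\<And>x. u1 x = 0 \<or> u1 x = u x \<and> \<bar>u x\<bar> \<le> K \<and> (norm x > R' \<longrightarrow> u x \<ge> 0)"
    using borel_representative[OF um uae] by blast
  have u1K: "\<bar>u1 x\<bar> \<le> max 0 K" for x using u1p[of x] by (auto simp: le_max_iff_disj)
  have u1nn: "u1 x \<ge> 0" if "norm x > R'" for x using u1p[of x] that by auto
  have poisson: "weak_poisson w (\<lambda>x. V1 x * w x)"
    if w [measurable]: "w \<in> borel_measurable borel" and uw: "AE x in lebesgue. w x = u x" and wK: "\<And>x. \<bar>w x\<bar> \<le> K'" for w K'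
    unfolding weak_poisson_def
  proof (intro conjI allI impI)
    show "locally_bounded w" using wK by (auto simp: locally_bounded_def)
    show "locally_bounded (\<lambda>x. V1 x * w x)"
      unfolding locally_bounded_def
    proof
      fix M :: real
      obtain B where B: "B \<ge> 0" "\<And>x. norm x \<le> M \<Longrightarrow> \<bar>V1 x\<bar> \<le> B" using locally_boundedD[OF V1b] by blast
      have "\<bar>V1 x * w x\<bar> \<le> B * K'" if "norm x \<le> M" for x
        unfolding abs_mult using B that wK by (intro mult_mono) auto
      then show "\<exists>C. \<forall>x. norm x \<le> M \<longrightarrow> \<bar>V1 x * w x\<bar> \<le> C" by blast
    qed
    fix \<phi> :: "'a \<Rightarrow> real" assume \<phi>: "test_function \<phi>"
    have [measurable]: "\<phi> \<in> borel_measurable borel" "laplacian \<phi> \<in> borel_measurable borel"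
      using \<phi> by (auto intro: test_function_measurable test_function_laplacian_measurable)
    have [measurable]: "\<phi> \<in> borel_measurable lebesgue" "laplacian \<phi> \<in> borel_measurable lebesgue"
        "V \<in> borel_measurable lebesgue" "u \<in> borel_measurable lebesgue"
      using Vm um by (auto simp: measurable_completion)
    have "(LINT x|lebesgue. u x * (- laplacian \<phi> x)) = (LBINT x. w x * (- laplacian \<phi> x))"
      by (rule integral_lebesgue_eq_lborel) (use uw in auto)
    moreover have "(LINT x|lebesgue. V x * u x * \<phi> x) = (LBINT x. V1 x * w x * \<phi> x)"
      by (rule integral_lebesgue_eq_lborel) (use uw VV1 in auto)
    ultimately show "(LBINT x. w x * laplacian \<phi> x) = - (LBINT x. V1 x * w x * \<phi> x)"
      using weak[OF \<phi>] by simp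
  qed measurable
  define \<rho> where "\<rho> = max R R'"
  have rho: "\<rho> > 0" using R by (simp add: \<rho>_def)
  have zero: "AE x in lborel. norm x > \<rho> \<longrightarrow> u1 x = 0"
  proof (rule ccontr)
    assume nz: "\<not> (AE x in lborel. norm x > \<rho> \<longrightarrow> u1 x = 0)"
    have [measurable]: "{x::'a. norm x > r} \<in> sets borel" by simp
    have [measurable]: "(\<lambda>x::'a. norm x powi (4 - 2 * int DIM('a))) \<in> borel_measurable borel"
      by (simp add: power_int_def)
    have "(\<integral>\<^sup>+x. ennreal (norm x powi (4 - 2 * int DIM('a)) * V1 x) * indicator {x. norm x > r} x \<partial>lborel) < \<infinity>"
      by (rule exterior_potential_mass_finite[OF dim poisson[OF u1 uu1 u1K] u1K V1 V1b _ rho _ _ nz])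
         (use R r u1nn V1nn in \<open>auto simp: \<rho>_def\<close>)
    also have "(\<integral>\<^sup>+x. ennreal (norm x powi (4 - 2 * int DIM('a)) * V1 x) * indicator {x. norm x > r} x \<partial>lborel)
       = (\<integral>\<^sup>+x. ennreal (norm x powi (4 - 2 * int DIM('a)) * V1 x) * indicator {x. norm x > r} x \<partial>lebesgue)"
      by (rule nn_integral_completion[symmetric])
    also have "\<dots> = (\<integral>\<^sup>+ x \<in> {x. norm x > r}. ennreal (norm x powi (4 - 2 * int DIM('a)) * V x) \<partial>lebesgue)"
      by (rule nn_integral_cong_AE) (use VV1 in auto)
    finally show False using inf by simp
  qed
  define u2 where "u2 x = u1 x * indicator (cball 0 \<rho>) x" for x
  have [measurable]: "cball (0::'a) \<rho> \<in> sets borel" by simp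
  have u2: "u2 \<in> borel_measurable borel" unfolding u2_def[abs_def] by measurable
  have "AE x in lebesgue. norm x > \<rho> \<longrightarrow> u1 x = 0" using zero by (simp add: AE_completion_iff)
  with uu1 have uu2: "AE x in lebesgue. u2 x = u x"
    by eventually_elim (auto simp: u2_def indicator_def)
  have u2K: "\<bar>u2 x\<bar> \<le> max 0 K" for x using u1K[of x] by (auto simp: u2_def indicator_def)
  obtain B where B: "B \<ge> 0" "\<And>x. norm x \<le> \<rho> \<Longrightarrow> \<bar>V1 x\<bar> \<le> B" using locally_boundedD[OF V1b] by blast
  have "AE x in lborel. u2 x = 0"
  proof (rule compact_support_solution_0[OF poisson[OF u2 uu2 u2K] u2K _ rho _ B(1)])
    show "u2 x = 0" if "norm x > \<rho>" for x using that by (simp add: u2_def)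
    show "\<bar>V1 x * u2 x\<bar> \<le> B * \<bar>u2 x\<bar>" for x
      using B(2)[of x] by (cases "norm x \<le> \<rho>") (auto simp: u2_def abs_mult intro!: mult_right_mono)
  qed
  then have "AE x in lebesgue. u2 x = 0" by (simp add: AE_completion_iff)
  with uu2 show ?thesis by eventually_elim simp
qed

(* In ennreal, 1 / 0 = \<infinity>, which is the convention for the first integral. *)
theorem theorem1p6:
  fixes V :: "real ^ 'n \<Rightarrow> real" and R r :: real
  assumes "CARD('n) \<ge> 2"
    and "Linf_loc V"
    and "R > 1"
    and "nonneg_outside R V"
    and "r \<ge> R"
    and "(\<integral>\<^sup>+ x \<in> {x. norm x > r}. 1 / ennreal (norm x ^ (CARD('n) + 2) * V x) \<partial>lebesgue) < \<infinity>"
    and "(\<integral>\<^sup>+ x \<in> {x. norm x > r}. ennreal (norm x powi (4 - 2 * int CARD('n)) * V x) \<partial>lebesgue) = \<infinity>"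
  shows "(\<forall>u. weak_solution V u \<and> ess_bounded u \<and> \<not> ae_constant u \<longrightarrow> changes_sign_near_infinity u) \<and>
         (\<forall>u. weak_solution V u \<and> ess_bounded u \<and>
              (\<exists>R'>0. nonneg_outside R' u \<or> nonpos_outside R' u) \<longrightarrow> (AE x in lebesgue. u x = 0))"
proof -
  have zero: "AE x in lebesgue. u x = 0"
    if u: "weak_solution V u" "ess_bounded u" and R': "R' > 0" "nonneg_outside R' u \<or> nonpos_outside R' u" for u R'
  proof -
    have dim: "DIM(real ^ 'n) \<ge> 2" using assms(1) by simp
    have inf: "(\<integral>\<^sup>+ x \<in> {x. norm x > r}. ennreal (norm x powi (4 - 2 * int DIM(real ^ 'n)) * V x) \<partial>lebesgue) = \<infinity>"
      using assms(7) by simp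
    note main = nonneg_solution_0[OF dim assms(2-5) inf _ _ R'(1)]
    from R'(2) show ?thesis
    proof
      assume "nonneg_outside R' u"
      with u show ?thesis by (intro main) (auto simp: weak_solution_def)
    next
      assume np: "nonpos_outside R' u"
      have "AE x in lebesgue. - u x = 0"
      proof (rule main)
        show "nonneg_outside R' (\<lambda>x. - u x)" using np by (simp add: nonneg_outside_def nonpos_outside_def)
        show "ess_bounded (\<lambda>x. - u x)" using u(2) by (auto simp: ess_bounded_def)
        show "(LINT x|lebesgue. - u x * (- laplacian \<phi> x)) = (LINT x|lebesgue. V x * - u x * \<phi> x)"
          if "test_function \<phi>" for \<phi>
        proof -
          have "(LINT x|lebesgue. u x * (- laplacian \<phi> x)) = (LINT x|lebesgue. V x * u x * \<phi> x)"
            using u(1) that by (simp only: weak_solution_def)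
          then show ?thesis by simp
        qed
      qed
      then show ?thesis by simp
    qed
  qed
  show ?thesis
    using zero unfolding changes_sign_near_infinity_def ae_constant_def by blast
qed

end
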